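(* Let $K$ be a field of characteristic zero, $n\ge 1$, and let $V$ be the defining ($n$-dimensional) permutation representation of $\mathfrak S_n$ over $K$. Let $\mu$ be a partition of $n$ and let $S^\mu$ be the corresponding irreducible representation of $\mathfrak S_n$. Let $\tilde\mu$ be the partition $\mu$ with its first part removed, and $p=|\tilde\mu|$. Then for $n\ge 2r$ there is a natural isomorphism $$\mathrm{Hom}_{\mathfrak S_n}(S^\mu,\otimes^rV)\cong\mathrm{Inf}_p^r(S^{\tilde\mu})$$ of $D_r$-modules, where $D_r$ is the partition algebra with parameter $\delta=n$.
   Context: For $r,s\ge0$ let $D(r,s)$ be the set of set partitions of $[r]\amalg[s]$ ($r$ points on the top row, $s$ points on the bottom row). For $x\in D(r,s)$, $y\in D(s,t)$, consider the equivalence relation on $[r]\amalg[s]\amalg[t]$ generated by $x$ and $y$; $x\circ y\in D(r,t)$ consists of the nonempty intersections of its classes with $[r]\amalg[t]$, $c(x,y)$ is the number of classes contained in $[s]$, and $x\cdot y=\delta^{c(x,y)}x\circ y$. $D_r$ is the $K$-algebra with basis $D(r,r)$ and this product. $\mathrm{pr}(x)$ is the number of blocks meeting both rows; $D(r,s;p)=\{x:\mathrm{pr}(x)=p\}$. $KD(p,r;p)$ is a $K\mathfrak S_p$-$D_r$ bimodule under the product, diagrams with propagating number less than $p$ being set to zero, and $\mathrm{Inf}_p^rU=U\otimes_{K\mathfrak S_p}KD(p,r;p)$ (zero if $p>r$). Action on tensors: let $v_1,\dots,v_n$ be the permutation basis of $V$. For $x\in D(r,s)$, $\mathrm{ev}(x)\colon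 V^{\otimes r}\to V^{\otimes s}$ sends $v_{i_1}\otimes\dots\otimes v_{i_r}$ to $\sum_{i_{r+1},\dots,i_{r+s}}(x)\,v_{i_{r+1}}\otimes\dots\otimes v_{i_{r+s}}$, where $(x)=1$ if $i_k=i_\ell$ whenever the points $k,\ell$ are in the same block of $x$ and $(x)=0$ otherwise; $\mathrm{ev}(x\cdot y)=\mathrm{ev}(y)\circ\mathrm{ev}(x)$. $D_r$ acts (on the right) on $\mathrm{Hom}_{\mathfrak S_n}(S^\mu,\otimes^rV)$ by post-composition with $\mathrm{ev}(x)$. *)

theory Defs
  imports Complex_Main "HOL-Library.Poly_Mapping" "HOL-Library.Disjoint_Sets" "HOL-Library.FuncSet"
    "HOL-Combinatorics.Permutations" "HOL-Algebra.Ring"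
begin

section \<open>Free vector spaces\<close>

text \<open>
  The vector space with basis \<open>X\<close> is the set of finitely supported functions with support
  in \<open>X\<close>. Throughout, the finite set \<open>[m]\<close> is rendered as \<open>{..<m}\<close>.
\<close>

definition free_on :: "'a set \<Rightarrow> ('a \<Rightarrow>\<^sub>0 'k::field) set" where
  "free_on X = {f. Poly_Mapping.keys f \<subseteq> X}"

definition fscale :: "'k::field \<Rightarrow> ('a \<Rightarrow>\<^sub>0 'k) \<Rightarrow> ('a \<Rightarrow>\<^sub>0 'k)" where
  "fscale c f = Poly_Mapping.map ((*) c) f"

lemma lookup_fscale: "Poly_Mapping.lookup (fscale c f) x = c * Poly_Mapping.lookup f x"
  by (simp add: fscale_def Poly_Mapping.map.rep_eq when_def)

global_interpretation fvs: vector_space "fscale :: 'k::field \<Rightarrow> ('a \<Rightarrow>\<^sub>0 'k) \<Rightarrow> ('a \<Rightarrow>\<^sub>0 'k)"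
  by unfold_locales
    (auto intro!: poly_mapping_eqI simp: lookup_fscale lookup_add algebra_simps)

abbreviation basis :: "'a \<Rightarrow> ('a \<Rightarrow>\<^sub>0 'k::field)" where
  "basis x \<equiv> Poly_Mapping.single x 1"

definition lin_ext :: "('a \<Rightarrow> ('b \<Rightarrow>\<^sub>0 'k::field)) \<Rightarrow> ('a \<Rightarrow>\<^sub>0 'k) \<Rightarrow> ('b \<Rightarrow>\<^sub>0 'k)" where
  "lin_ext g f = (\<Sum>x\<in>Poly_Mapping.keys f. fscale (Poly_Mapping.lookup f x) (g x))"


section \<open>Diagrams and the partition algebra\<close>

text \<open>\<open>Inl i\<close> is a point of the top row, \<open>Inr j\<close> a point of the bottom row.\<close>

type_synonym diagram = "(nat + nat) set set"

definition diagrams :: "nat \<Rightarrow> nat \<Rightarrow> diagram set" where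
  "diagrams r s = {x. partition_on ({..<r} <+> {..<s}) x}"

text \<open>
  When \<open>x\<close> is stacked on \<open>y\<close>, the three rows are tagged by \<open>Inl\<close>, \<open>Inr \<circ> Inl\<close> and
  \<open>Inr \<circ> Inr\<close>. The blocks cover all points, so the transitive closure below is the generated
  equivalence relation.
\<close>

definition stacked_blocks :: "diagram \<Rightarrow> diagram \<Rightarrow> (nat + nat + nat) set set" where
  "stacked_blocks x y = (`) (map_sum id Inl) ` x \<union> (`) Inr ` y"

definition stacked_classes :: "diagram \<Rightarrow> diagram \<Rightarrow> (nat + nat + nat) set set" where
  "stacked_classes x y =
     \<Union>(stacked_blocks x y) // {(a, b). \<exists>B\<in>stacked_blocks x y. a \<in> B \<and> b \<in> B}\<^sup>+"

definition dcomp :: "diagram \<Rightarrow> diagram \<Rightarrow> diagram" where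
  "dcomp x y = (\<lambda>C. map_sum id Inr -` C) ` stacked_classes x y - {{}}"

definition loops :: "diagram \<Rightarrow> diagram \<Rightarrow> nat" where
  "loops x y = card {C \<in> stacked_classes x y. C \<subseteq> range (Inr \<circ> Inl)}"

definition dmult ::
  "'k::field \<Rightarrow> (diagram \<Rightarrow>\<^sub>0 'k) \<Rightarrow> (diagram \<Rightarrow>\<^sub>0 'k) \<Rightarrow> (diagram \<Rightarrow>\<^sub>0 'k)" where
  "dmult \<delta> a b =
     lin_ext (\<lambda>x. lin_ext (\<lambda>y. fscale (\<delta> ^ loops x y) (basis (dcomp x y))) b) a"

text \<open>
  With this orientation \<open>perm_diagram p (\<sigma> \<circ> \<tau>) = dcomp (perm_diagram p \<sigma>) (perm_diagram p \<tau>)\<close>,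
  so that the symmetric group, multiplied by composing functions, embeds in the partition algebra.
\<close>

definition perm_diagram :: "nat \<Rightarrow> (nat \<Rightarrow> nat) \<Rightarrow> diagram" where
  "perm_diagram p \<sigma> = (\<lambda>i. {Inl (\<sigma> i), Inr i}) ` {..<p}"

definition partition_algebra :: "'k::field \<Rightarrow> nat \<Rightarrow> (diagram \<Rightarrow>\<^sub>0 'k) ring" where
  "partition_algebra \<delta> r =
     \<lparr>carrier = free_on (diagrams r r), monoid.mult = dmult \<delta>, one = basis (perm_diagram r id),
      zero = 0, add = (+)\<rparr>"

definition prop_number :: "diagram \<Rightarrow> nat" where
  "prop_number x = card {B \<in> x. B \<inter> range Inl \<noteq> {} \<and> B \<inter> range Inr \<noteq> {}}"

definition prop_diagrams :: "nat \<Rightarrow> nat \<Rightarrow> nat \<Rightarrow> diagram set" where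
  "prop_diagrams r s p = {x \<in> diagrams r s. prop_number x = p}"

definition prop_truncate :: "nat \<Rightarrow> (diagram \<Rightarrow>\<^sub>0 'k::field) \<Rightarrow> (diagram \<Rightarrow>\<^sub>0 'k)" where
  "prop_truncate p = lin_ext (\<lambda>x. if prop_number x < p then 0 else basis x)"


section \<open>Right modules and tensor products\<close>

record ('k, 'a, 'm) rmodule = "'m partial_object" +
  radd :: "'m \<Rightarrow> 'm \<Rightarrow> 'm"
  rscale :: "'k \<Rightarrow> 'm \<Rightarrow> 'm"
  ract :: "'m \<Rightarrow> 'a \<Rightarrow> 'm"

definition rmodule_iso ::
  "'a ring \<Rightarrow> ('k, 'a, 'm) rmodule \<Rightarrow> ('k, 'a, 'n) rmodule \<Rightarrow> ('m \<Rightarrow> 'n) \<Rightarrow> bool" where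
  "rmodule_iso A M N f \<longleftrightarrow>
     bij_betw f (carrier M) (carrier N) \<and>
     (\<forall>x\<in>carrier M. \<forall>y\<in>carrier M. f (radd M x y) = radd N (f x) (f y)) \<and>
     (\<forall>c. \<forall>x\<in>carrier M. f (rscale M c x) = rscale N c (f x)) \<and>
     (\<forall>x\<in>carrier M. \<forall>a\<in>carrier A. f (ract M x a) = ract N (f x) a)"

text \<open>
  \<open>tensor_rel A rU lW U W\<close> is the congruence on the vector space with basis \<open>U \<times> W\<close> whose
  quotient is the tensor product over \<open>A\<close> of the right \<open>A\<close>-module \<open>U\<close> (action \<open>rU\<close>) with the
  left \<open>A\<close>-module \<open>W\<close> (action \<open>lW\<close>).
\<close>

definition tensor_relators ::
  "'a ring \<Rightarrow> (('x \<Rightarrow>\<^sub>0 'k::field) \<Rightarrow> 'a \<Rightarrow> ('x \<Rightarrow>\<^sub>0 'k)) \<Rightarrow> ('a \<Rightarrow> ('y \<Rightarrow>\<^sub>0 'k) \<Rightarrow> ('y \<Rightarrow>\<^sub>0 'k)) \<Rightarrow>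
   ('x \<Rightarrow>\<^sub>0 'k) set \<Rightarrow> ('y \<Rightarrow>\<^sub>0 'k) set \<Rightarrow> (('x \<Rightarrow>\<^sub>0 'k) \<times> ('y \<Rightarrow>\<^sub>0 'k) \<Rightarrow>\<^sub>0 'k) set" where
  "tensor_relators A rU lW U W =
     {basis (u + u', w) - basis (u, w) - basis (u', w) | u u' w. u \<in> U \<and> u' \<in> U \<and> w \<in> W} \<union>
     {basis (u, w + w') - basis (u, w) - basis (u, w') | u w w'. u \<in> U \<and> w \<in> W \<and> w' \<in> W} \<union>
     {basis (fscale c u, w) - fscale c (basis (u, w)) | c u w. u \<in> U \<and> w \<in> W} \<union>
     {basis (u, fscale c w) - fscale c (basis (u, w)) | c u w. u \<in> U \<and> w \<in> W} \<union>
     {basis (rU u a, w) - basis (u, lW a w) | u a w. u \<in> U \<and> a \<in> carrier A \<and> w \<in> W}"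

definition tensor_rel ::
  "'a ring \<Rightarrow> (('x \<Rightarrow>\<^sub>0 'k::field) \<Rightarrow> 'a \<Rightarrow> ('x \<Rightarrow>\<^sub>0 'k)) \<Rightarrow> ('a \<Rightarrow> ('y \<Rightarrow>\<^sub>0 'k) \<Rightarrow> ('y \<Rightarrow>\<^sub>0 'k)) \<Rightarrow>
   ('x \<Rightarrow>\<^sub>0 'k) set \<Rightarrow> ('y \<Rightarrow>\<^sub>0 'k) set \<Rightarrow> (('x \<Rightarrow>\<^sub>0 'k) \<times> ('y \<Rightarrow>\<^sub>0 'k) \<Rightarrow>\<^sub>0 'k) rel" where
  "tensor_rel A rU lW U W =
     {(y, z). y \<in> free_on (U \<times> W) \<and> z \<in> free_on (U \<times> W) \<and>
        y - z \<in> fvs.span (tensor_relators A rU lW U W)}"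


section \<open>Specht modules\<close>

definition partition_of :: "nat \<Rightarrow> nat list \<Rightarrow> bool" where
  "partition_of n \<mu> \<longleftrightarrow> sorted_wrt (\<ge>) \<mu> \<and> 0 \<notin> set \<mu> \<and> sum_list \<mu> = n"

definition cells :: "nat list \<Rightarrow> (nat \<times> nat) set" where
  "cells \<mu> = {(i, j). i < length \<mu> \<and> j < \<mu> ! i}"

definition tableaux :: "nat list \<Rightarrow> (nat \<times> nat \<Rightarrow> nat) set" where
  "tableaux \<mu> = {t. bij_betw t (cells \<mu>) {..<sum_list \<mu>}}"

text \<open>A tabloid is given by the list of the sets of entries of its rows.\<close>

definition tabloid :: "nat list \<Rightarrow> (nat \<times> nat \<Rightarrow> nat) \<Rightarrow> nat set list" where
  "tabloid \<mu> t = map (\<lambda>i. (\<lambda>j. t (i, j)) ` {..<\<mu> ! i}) [0..<length \<mu>]"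

definition column_stabilizer :: "nat list \<Rightarrow> (nat \<times> nat \<Rightarrow> nat) \<Rightarrow> (nat \<Rightarrow> nat) set" where
  "column_stabilizer \<mu> t =
     {\<sigma>. \<sigma> permutes {..<sum_list \<mu>} \<and>
        (\<forall>(i, j)\<in>cells \<mu>. \<exists>i'. (i', j) \<in> cells \<mu> \<and> \<sigma> (t (i, j)) = t (i', j))}"

definition polytabloid ::
  "nat list \<Rightarrow> (nat \<times> nat \<Rightarrow> nat) \<Rightarrow> (nat set list \<Rightarrow>\<^sub>0 'k::field)" where
  "polytabloid \<mu> t =
     (\<Sum>\<sigma>\<in>column_stabilizer \<mu> t. fscale (of_int (sign \<sigma>)) (basis (tabloid \<mu> (\<sigma> \<circ> t))))"

definition specht :: "nat list \<Rightarrow> (nat set list \<Rightarrow>\<^sub>0 'k::field) set" where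
  "specht \<mu> = fvs.span (polytabloid \<mu> ` tableaux \<mu>)"

definition specht_perm ::
  "(nat \<Rightarrow> nat) \<Rightarrow> (nat set list \<Rightarrow>\<^sub>0 'k::field) \<Rightarrow> (nat set list \<Rightarrow>\<^sub>0 'k)" where
  "specht_perm \<sigma> = lin_ext (\<lambda>T. basis (map ((`) \<sigma>) T))"


section \<open>Tensor powers of the permutation representation\<close>

text \<open>
  The \<open>r\<close>-th tensor power of the \<open>n\<close>-dimensional permutation representation is
  \<open>free_on (words n r)\<close>, where the word \<open>[i\<^sub>1, \<dots>, i\<^sub>r]\<close> stands for the tensor product of the
  basis vectors with indices \<open>i\<^sub>1, \<dots>, i\<^sub>r\<close>.
\<close>

definition words :: "nat \<Rightarrow> nat \<Rightarrow> nat list set" where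
  "words n r = {v. length v = r \<and> set v \<subseteq> {..<n}}"

definition tensor_perm ::
  "(nat \<Rightarrow> nat) \<Rightarrow> (nat list \<Rightarrow>\<^sub>0 'k::field) \<Rightarrow> (nat list \<Rightarrow>\<^sub>0 'k)" where
  "tensor_perm \<sigma> = lin_ext (\<lambda>v. basis (map \<sigma> v))"

definition compatible :: "diagram \<Rightarrow> nat list \<Rightarrow> nat list \<Rightarrow> bool" where
  "compatible x v w \<longleftrightarrow>
     (\<forall>B\<in>x. \<forall>k\<in>B. \<forall>l\<in>B. case_sum ((!) v) ((!) w) k = case_sum ((!) v) ((!) w) l)"

text \<open>\<open>ev n s a\<close> is the operator of an element \<open>a\<close> of the span of \<open>diagrams r s\<close>, for any \<open>r\<close>.\<close>

definition ev ::
  "nat \<Rightarrow> nat \<Rightarrow> (diagram \<Rightarrow>\<^sub>0 'k::field) \<Rightarrow> (nat list \<Rightarrow>\<^sub>0 'k) \<Rightarrow> (nat list \<Rightarrow>\<^sub>0 'k)" where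
  "ev n s a u =
     lin_ext (\<lambda>x. lin_ext (\<lambda>v. \<Sum>w\<in>words n s. if compatible x v w then basis w else 0) u) a"


section \<open>The two modules\<close>

definition hom_space ::
  "nat \<Rightarrow> nat list \<Rightarrow> nat \<Rightarrow> ((nat set list \<Rightarrow>\<^sub>0 'k::field) \<Rightarrow> (nat list \<Rightarrow>\<^sub>0 'k)) set" where
  "hom_space n \<mu> r =
     {\<phi> \<in> specht \<mu> \<rightarrow>\<^sub>E free_on (words n r).
        (\<forall>u\<in>specht \<mu>. \<forall>v\<in>specht \<mu>. \<phi> (u + v) = \<phi> u + \<phi> v) \<and>
        (\<forall>c. \<forall>u\<in>specht \<mu>. \<phi> (fscale c u) = fscale c (\<phi> u)) \<and>
        (\<forall>\<sigma>. \<sigma> permutes {..<n} \<longrightarrow>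
           (\<forall>u\<in>specht \<mu>. \<phi> (specht_perm \<sigma> u) = tensor_perm \<sigma> (\<phi> u)))}"

text \<open>
  \<open>hom_act n \<mu> s \<phi> a\<close> and \<open>inflation_act \<delta> \<nu> s Z a\<close> give the action of an element \<open>a\<close> of the span of
  \<open>diagrams r s\<close>, going from the space with index \<open>r\<close> to the space with index \<open>s\<close>.
\<close>

definition hom_act ::
  "nat \<Rightarrow> nat list \<Rightarrow> nat \<Rightarrow> ((nat set list \<Rightarrow>\<^sub>0 'k::field) \<Rightarrow> (nat list \<Rightarrow>\<^sub>0 'k)) \<Rightarrow>
   (diagram \<Rightarrow>\<^sub>0 'k) \<Rightarrow> ((nat set list \<Rightarrow>\<^sub>0 'k) \<Rightarrow> (nat list \<Rightarrow>\<^sub>0 'k))" where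
  "hom_act n \<mu> s \<phi> a = (\<lambda>u\<in>specht \<mu>. ev n s a (\<phi> u))"

definition hom_module ::
  "nat \<Rightarrow> nat list \<Rightarrow> nat \<Rightarrow>
   ('k::field, diagram \<Rightarrow>\<^sub>0 'k, (nat set list \<Rightarrow>\<^sub>0 'k) \<Rightarrow> (nat list \<Rightarrow>\<^sub>0 'k)) rmodule" where
  "hom_module n \<mu> r =
     \<lparr>carrier = hom_space n \<mu> r,
      radd = (\<lambda>\<phi> \<psi>. \<lambda>u\<in>specht \<mu>. \<phi> u + \<psi> u),
      rscale = (\<lambda>c \<phi>. \<lambda>u\<in>specht \<mu>. fscale c (\<phi> u)),
      ract = hom_act n \<mu> r\<rparr>"

definition sym_group_algebra :: "nat \<Rightarrow> ((nat \<Rightarrow> nat) \<Rightarrow>\<^sub>0 'k::field) ring" where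
  "sym_group_algebra p =
     \<lparr>carrier = free_on {\<sigma>. \<sigma> permutes {..<p}},
      monoid.mult = (\<lambda>a b. lin_ext (\<lambda>\<sigma>. lin_ext (\<lambda>\<tau>. basis (\<sigma> \<circ> \<tau>)) b) a),
      one = basis id, zero = 0, add = (+)\<rparr>"

text \<open>A left module for the symmetric group is a right module through inverses.\<close>

definition specht_ract ::
  "(nat set list \<Rightarrow>\<^sub>0 'k::field) \<Rightarrow> ((nat \<Rightarrow> nat) \<Rightarrow>\<^sub>0 'k) \<Rightarrow> (nat set list \<Rightarrow>\<^sub>0 'k)" where
  "specht_ract u a = lin_ext (\<lambda>\<sigma>. specht_perm (inv_into UNIV \<sigma>) u) a"

definition diagram_lact ::
  "'k::field \<Rightarrow> nat \<Rightarrow> ((nat \<Rightarrow> nat) \<Rightarrow>\<^sub>0 'k) \<Rightarrow> (diagram \<Rightarrow>\<^sub>0 'k) \<Rightarrow> (diagram \<Rightarrow>\<^sub>0 'k)" where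
  "diagram_lact \<delta> p a y = prop_truncate p (dmult \<delta> (lin_ext (\<lambda>\<sigma>. basis (perm_diagram p \<sigma>)) a) y)"

text \<open>
  The inflation of the Specht module of a partition \<open>\<nu>\<close> of \<open>p\<close>. For \<open>p > r\<close> the set
  \<open>prop_diagrams p r p\<close> is empty, so the tensor product is zero.
\<close>

definition inflation_rel ::
  "'k::field \<Rightarrow> nat list \<Rightarrow> nat \<Rightarrow> ((nat set list \<Rightarrow>\<^sub>0 'k) \<times> (diagram \<Rightarrow>\<^sub>0 'k) \<Rightarrow>\<^sub>0 'k) rel" where
  "inflation_rel \<delta> \<nu> r =
     (let p = sum_list \<nu> in
      tensor_rel (sym_group_algebra p) specht_ract (diagram_lact \<delta> p)
        (specht \<nu>) (free_on (prop_diagrams p r p)))"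

definition inflation_act ::
  "'k::field \<Rightarrow> nat list \<Rightarrow> nat \<Rightarrow> ((nat set list \<Rightarrow>\<^sub>0 'k) \<times> (diagram \<Rightarrow>\<^sub>0 'k) \<Rightarrow>\<^sub>0 'k) set \<Rightarrow>
   (diagram \<Rightarrow>\<^sub>0 'k) \<Rightarrow> ((nat set list \<Rightarrow>\<^sub>0 'k) \<times> (diagram \<Rightarrow>\<^sub>0 'k) \<Rightarrow>\<^sub>0 'k) set" where
  "inflation_act \<delta> \<nu> s Z a =
     (\<Union>z\<in>Z. inflation_rel \<delta> \<nu> s ``
        {lin_ext (\<lambda>(u, w). basis (u, prop_truncate (sum_list \<nu>) (dmult \<delta> w a))) z})"

definition inflation ::
  "'k::field \<Rightarrow> nat list \<Rightarrow> nat \<Rightarrow>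
   ('k, diagram \<Rightarrow>\<^sub>0 'k, ((nat set list \<Rightarrow>\<^sub>0 'k) \<times> (diagram \<Rightarrow>\<^sub>0 'k) \<Rightarrow>\<^sub>0 'k) set) rmodule" where
  "inflation \<delta> \<nu> r =
     \<lparr>carrier =
        free_on (specht \<nu> \<times> free_on (prop_diagrams (sum_list \<nu>) r (sum_list \<nu>)))
          // inflation_rel \<delta> \<nu> r,
      radd = (\<lambda>Y Z. \<Union>y\<in>Y. \<Union>z\<in>Z. inflation_rel \<delta> \<nu> r `` {y + z}),
      rscale = (\<lambda>c Z. \<Union>z\<in>Z. inflation_rel \<delta> \<nu> r `` {fscale c z}),
      ract = inflation_act \<delta> \<nu> r\<rparr>"

end

theory Submission
  imports Defs
begin

text \<open>
  Write \<open>\<mu> = m # \<nu>\<close> with \<open>\<nu>\<close> a partition of \<open>p\<close>. A vector \<open>s\<close> of the Specht module of \<open>\<nu>\<close> gives a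
  homomorphism \<open>phi s\<close> from the Specht module of \<open>\<mu>\<close> to the \<open>p\<close>-th tensor power: its coefficient at an
  injective word \<open>v\<close> pairs \<open>s\<close> with the coefficients of \<open>u\<close> at the tabloids whose lower rows are filled
  with the letters of \<open>v\<close>. By the Garnir relations \<open>phi s\<close> is killed by all diagrams with fewer than
  \<open>p\<close> propagating blocks, so \<open>(s, y) \<mapsto> ev y \<circ> phi s\<close> induces a natural map from the inflation.

  Surjectivity: the coefficient of a homomorphism at a word \<open>w\<close> is a functional invariant under the
  permutations fixing the letters of \<open>w\<close>. Averaging and the Garnir relations reduce it to
  coefficients at tabloids whose lower rows use only letters of \<open>w\<close>. For a fixed set of \<open>p\<close> such
  letters these coefficients form a vector of the Specht module of \<open>\<nu>\<close>, on which, in characteristic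
  zero, every functional is the pairing with a vector. Words are treated in decreasing order of
  their number of letters.

  Injectivity: as \<open>n \<ge> 2 * r\<close>, any tableau of shape \<open>\<nu>\<close> on \<open>p\<close> letters of \<open>w\<close> extends to a tableau
  of shape \<open>\<mu>\<close> with no letter of \<open>w\<close> above it. Its polytabloid restricts to the polytabloid
  of the lower rows, and to zero for every other choice of \<open>p\<close> letters, which separates the
  contributions of the different diagrams; the form on the Specht module of \<open>\<nu>\<close> is nondegenerate.
\<close>

section \<open>Linear extension\<close>

text \<open>The tensor product is a quotient of the formal sums of all pairs, so the work is done
  with one linear map \<open>Psi\<close> on formal sums: the sums it sends to zero are shown to be
  the span of the relators, and its image is the whole space of homomorphisms. The isomorphism is
  then read backwards: a class of the quotient is the full set of formal sums with a given image, so
  \<open>fibre r f\<close> needs no choice of representatives and inherits naturality from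
  \<open>Psi\<close>.

  The obstacle in both directions is that words compatible with a diagram may give the same letter
  to different blocks, so diagrams do not correspond to separate words. Counting makes the system
  triangular: a bottom word with at least as many letters as the diagram has blocks leaves no room
  for such identifications. Hence the start from diagrams with the most blocks, respectively words
  with the most letters. A test word with \<open>k\<close> letters has
  \<open>p \<le> k \<le> r\<close>, so \<open>p + k \<le> n\<close>.

  Characteristic zero is used to divide by the sizes of groups and orbits, and to control the form,
  whose positivity makes sense only after passing to the rationals.\<close>

abbreviation coef :: "('a \<Rightarrow>\<^sub>0 'k::zero) \<Rightarrow> 'a \<Rightarrow> 'k" where
  "coef \<equiv> Poly_Mapping.lookup"

abbreviation invf :: "('a \<Rightarrow> 'b) \<Rightarrow> 'b \<Rightarrow> 'a" where
  "invf \<equiv> inv_into UNIV"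

lemma fscale_zero_left [simp]: "fscale 0 f = 0"
  and fscale_zero_right [simp]: "fscale c 0 = 0"
  and fscale_one [simp]: "fscale 1 f = f"
  by simp_all

lemma coef_lin_ext:
  assumes "finite A" "Poly_Mapping.keys f \<subseteq> A"
  shows "coef (lin_ext g f) y = (\<Sum>x\<in>A. coef f x * coef (g x) y)"
proof -
  have "coef (lin_ext g f) y = (\<Sum>x\<in>Poly_Mapping.keys f. coef f x * coef (g x) y)"
    by (simp add: lin_ext_def lookup_sum lookup_fscale)
  also have "\<dots> = (\<Sum>x\<in>A. coef f x * coef (g x) y)"
    using assms by (intro sum.mono_neutral_left) (auto simp: in_keys_iff)
  finally show ?thesis .
qed

lemma lin_ext_eq_sum:
  assumes "finite A" "Poly_Mapping.keys f \<subseteq> A"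
  shows "lin_ext g f = (\<Sum>x\<in>A. fscale (coef f x) (g x))"
  by (rule poly_mapping_eqI) (simp add: coef_lin_ext[OF assms] lookup_sum lookup_fscale)

lemma lin_ext_single [simp]: "lin_ext g (basis x) = g x"
  by (simp add: lin_ext_def)

lemma lin_ext_zero [simp]: "lin_ext g 0 = 0"
  by (simp add: lin_ext_def)

lemma lin_ext_add: "lin_ext g (f + f') = lin_ext g f + lin_ext g f'"
proof (rule poly_mapping_eqI)
  fix y
  let ?A = "Poly_Mapping.keys f \<union> Poly_Mapping.keys f'"
  have k: "Poly_Mapping.keys (f + f') \<subseteq> ?A" by (rule Poly_Mapping.keys_add)
  show "coef (lin_ext g (f + f')) y = coef (lin_ext g f + lin_ext g f') y"
    by (simp add: lookup_add coef_lin_ext[OF _ k] coef_lin_ext[of ?A f] coef_lin_ext[of ?A f']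
        sum.distrib algebra_simps)
qed

lemma lin_ext_fscale: "lin_ext g (fscale c f) = fscale c (lin_ext g f)"
proof (rule poly_mapping_eqI)
  fix y
  have k: "Poly_Mapping.keys (fscale c f) \<subseteq> Poly_Mapping.keys f"
    by (auto simp: in_keys_iff lookup_fscale)
  show "coef (lin_ext g (fscale c f)) y = coef (fscale c (lin_ext g f)) y"
    by (simp add: coef_lin_ext[OF Poly_Mapping.finite_keys k] coef_lin_ext[OF _ order_refl, of f g y]
        lookup_fscale sum_distrib_left algebra_simps)
qed

lemma lin_ext_diff: "lin_ext g (f - f') = lin_ext g f - lin_ext g f'"
  using lin_ext_add[of g "f - f'" f'] by (simp add: algebra_simps)

lemma lin_ext_sum: "lin_ext g (\<Sum>i\<in>I. f i) = (\<Sum>i\<in>I. lin_ext g (f i))"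
  by (induction I rule: infinite_finite_induct) (simp_all add: lin_ext_add)

lemma lin_ext_basis [simp]: "lin_ext basis f = f"
proof (rule poly_mapping_eqI)
  fix y
  show "coef (lin_ext basis f) y = coef f y"
    by (subst coef_lin_ext[of "insert y (Poly_Mapping.keys f)"])
      (auto simp: lookup_single when_def if_distrib sum.delta cong: if_cong)
qed

lemma poly_mapping_eq_sum:
  "finite A \<Longrightarrow> Poly_Mapping.keys f \<subseteq> A \<Longrightarrow> f = (\<Sum>x\<in>A. fscale (coef f x) (basis x))"
  using lin_ext_eq_sum[of A f basis] by simp

lemma coef_lin_ext_bij:
  assumes "bij h"
  shows "coef (lin_ext (\<lambda>x. basis (h x)) f) (h x) = coef f x"
proof -
  have "coef (lin_ext (\<lambda>x. basis (h x)) f) (h x)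
    = (\<Sum>y\<in>insert x (Poly_Mapping.keys f). coef f y * coef (basis (h y)) (h x))"
    by (rule coef_lin_ext) auto
  also have "\<dots> = (\<Sum>y\<in>insert x (Poly_Mapping.keys f). if y = x then coef f x else 0)"
    using assms by (intro sum.cong) (auto simp: lookup_single when_def bij_def dest: injD)
  finally show ?thesis by (simp add: sum.delta)
qed

lemma free_on_zero [simp]: "0 \<in> free_on X"
  and free_on_basis [simp]: "basis x \<in> free_on X \<longleftrightarrow> x \<in> X"
  by (simp_all add: free_on_def)

lemma subspace_free_on: "fvs.subspace (free_on X)"
proof (rule fvs.subspaceI)
  fix f g :: "'b \<Rightarrow>\<^sub>0 'a" and c
  assume "f \<in> free_on X" "g \<in> free_on X"
  then show "f + g \<in> free_on X"
    using Poly_Mapping.keys_add[of f g] by (auto simp: free_on_def)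
next
  fix f :: "'b \<Rightarrow>\<^sub>0 'a" and c
  assume "f \<in> free_on X"
  then show "fscale c f \<in> free_on X"
    by (auto simp: free_on_def in_keys_iff lookup_fscale)
qed simp

lemmas free_on_add = fvs.subspace_add[OF subspace_free_on]
  and free_on_diff = fvs.subspace_diff[OF subspace_free_on]
  and free_on_fscale = fvs.subspace_scale[OF subspace_free_on]
  and free_on_sum = fvs.subspace_sum[OF subspace_free_on]

lemma free_on_coef: "f \<in> free_on X \<Longrightarrow> x \<notin> X \<Longrightarrow> coef f x = 0"
  by (auto simp: free_on_def in_keys_iff)

lemma free_on_iff: "f \<in> free_on X \<longleftrightarrow> (\<forall>x. x \<notin> X \<longrightarrow> coef f x = 0)"
  by (auto simp: free_on_def in_keys_iff)

lemma lin_ext_in_subspace: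
  assumes "fvs.subspace S" "\<And>x. x \<in> Poly_Mapping.keys f \<Longrightarrow> g x \<in> S"
  shows "lin_ext g f \<in> S"
  unfolding lin_ext_def using assms by (intro fvs.subspace_sum fvs.subspace_scale)

section \<open>Duality for finitely many functionals on a subspace\<close>

definition functional_on :: "('a \<Rightarrow>\<^sub>0 'k::field) set \<Rightarrow> (('a \<Rightarrow>\<^sub>0 'k) \<Rightarrow> 'k) \<Rightarrow> bool" where
  "functional_on S F \<longleftrightarrow>
     (\<forall>u\<in>S. \<forall>v\<in>S. F (u + v) = F u + F v) \<and> (\<forall>c. \<forall>u\<in>S. F (fscale c u) = c * F u)"

lemma functional_onD:
  assumes "functional_on S F"
  shows "u \<in> S \<Longrightarrow> v \<in> S \<Longrightarrow> F (u + v) = F u + F v" "u \<in> S \<Longrightarrow> F (fscale c u) = c * F u"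
  using assms by (auto simp: functional_on_def)

lemma functional_on_coef: "functional_on S (\<lambda>u. coef u x)"
  by (simp add: functional_on_def lookup_add lookup_fscale)

text \<open>One functional \<open>g k\<close> is split off at a time: on its kernel in
  \<open>S\<close> the induction hypothesis applies, and what is left of \<open>f\<close> vanishes
  on that kernel, hence is a multiple of \<open>g k\<close>. The result serves once for the
  coordinates at tabloids and once for the pairings with polytabloids.\<close>

lemma functional_on_comb:
  assumes "finite I" "fvs.subspace S" "functional_on S f" "\<And>i. i \<in> I \<Longrightarrow> functional_on S (g i)"
    and "\<And>u. u \<in> S \<Longrightarrow> \<forall>i\<in>I. g i u = 0 \<Longrightarrow> f u = 0"
  shows "\<exists>a. \<forall>u\<in>S. f u = (\<Sum>i\<in>I. a i * g i u)"
  using assms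
proof (induction I arbitrary: S f rule: finite_induct)
  case empty
  then show ?case by auto
next
  case (insert k I)
  have lin: "\<And>i. i \<in> insert k I \<Longrightarrow> functional_on S (g i)" and f: "functional_on S f"
    and S: "fvs.subspace S" using insert.prems by auto
  define S' where "S' = {u \<in> S. g k u = 0}"
  have gk: "functional_on S (g k)" using lin by simp
  have gk0: "g k 0 = 0" using functional_onD(2)[OF gk, of 0 0] S by (simp add: fvs.subspace_0)
  have sub: "S' \<subseteq> S" by (auto simp: S'_def)
  have "fvs.subspace S'"
    unfolding S'_def
    by (rule fvs.subspaceI)
      (auto simp: gk0 S fvs.subspace_0 fvs.subspace_add fvs.subspace_scale functional_onD[OF gk])
  moreover have res: "functional_on S' h" if "functional_on S h" for h
    using that sub by (simp add: functional_on_def subset_iff)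
  moreover have "f u = 0" if "u \<in> S'" "\<forall>i\<in>I. g i u = 0" for u
    using insert.prems(4)[of u] that by (auto simp: S'_def)
  ultimately obtain a where a: "\<And>u. u \<in> S' \<Longrightarrow> f u = (\<Sum>i\<in>I. a i * g i u)"
    using insert.IH[of S' f] f lin by auto
  define h where "h u = f u - (\<Sum>i\<in>I. a i * g i u)" for u
  have h: "functional_on S h"
    using f lin unfolding functional_on_def h_def
    by (simp add: sum.distrib sum_distrib_left algebra_simps)
  have h0: "h u = 0" if "u \<in> S'" for u using a[OF that] by (simp add: h_def)
  have "\<exists>b. \<forall>u\<in>S. h u = b * g k u"
  proof (cases "\<exists>x\<in>S. g k x \<noteq> 0")
    case False
    then have "S' = S" by (auto simp: S'_def)
    then show ?thesis using h0 by (intro exI[of _ 0]) auto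
  next
    case True
    then obtain x where x: "x \<in> S" "g k x \<noteq> 0" by auto
    show ?thesis
    proof (intro exI[of _ "h x / g k x"] ballI)
      fix u assume u: "u \<in> S"
      \<comment> \<open>This \<open>c\<close> moves \<open>u\<close> along \<open>x\<close> into the
        kernel \<open>S'\<close> of \<open>g k\<close>, where \<open>h\<close> vanishes.\<close>
      define c where "c = - (g k u / g k x)"
      have wS: "fscale c x \<in> S" using S x(1) by (rule fvs.subspace_scale)
      then have "u + fscale c x \<in> S" by (rule fvs.subspace_add[OF S u])
      moreover have "g k (u + fscale c x) = g k u + c * g k x" "h (u + fscale c x) = h u + c * h x"
        using functional_onD(1)[OF gk u wS] functional_onD(2)[OF gk x(1)]
          functional_onD(1)[OF h u wS] functional_onD(2)[OF h x(1)] by simp_all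
      ultimately have "h u + c * h x = 0" using h0 x by (simp add: S'_def c_def)
      then show "h u = h x / g k x * g k u" using x by (simp add: c_def field_simps)
    qed
  qed
  then obtain b where b: "\<And>u. u \<in> S \<Longrightarrow> h u = b * g k u" by auto
  show ?case
  proof (intro exI[of _ "a(k := b)"] ballI)
    fix u assume u: "u \<in> S"
    have "(\<Sum>i\<in>I. (a(k := b)) i * g i u) = (\<Sum>i\<in>I. a i * g i u)"
      using insert.hyps by (intro sum.cong) auto
    then show "f u = (\<Sum>i\<in>insert k I. (a(k := b)) i * g i u)"
      using b[OF u] insert.hyps by (simp add: h_def algebra_simps)
  qed
qed

section \<open>Specht modules\<close>

lemma bij_map_image:
  fixes \<sigma> :: "'a \<Rightarrow> 'a"
  assumes "bij \<sigma>"
  shows "bij (map ((`) \<sigma>))"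
proof (rule o_bij[of "map ((`) (invf \<sigma>))"])
  have "invf \<sigma> ` \<sigma> ` A = A" "\<sigma> ` invf \<sigma> ` A = A" for A
    using assms by (simp_all add: image_inv_f_f image_f_inv_f bij_is_inj bij_is_surj)
  then show "map ((`) (invf \<sigma>)) \<circ> map ((`) \<sigma>) = id" "map ((`) \<sigma>) \<circ> map ((`) (invf \<sigma>)) = id"
    by (simp_all add: fun_eq_iff o_def)
qed

lemma bij_map:
  fixes \<sigma> :: "'a \<Rightarrow> 'a"
  assumes "bij \<sigma>"
  shows "bij (map \<sigma>)"
  by (rule o_bij[of "map (invf \<sigma>)"])
    (use assms in \<open>simp_all add: fun_eq_iff bij_is_inj surj_iff[THEN iffD1, OF bij_is_surj]\<close>)

lemma coef_specht_perm_map: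
  "bij \<sigma> \<Longrightarrow> coef (specht_perm \<sigma> u) (map ((`) \<sigma>) T) = coef u T"
  unfolding specht_perm_def by (rule coef_lin_ext_bij[OF bij_map_image])

lemma coef_specht_perm:
  assumes "bij \<sigma>"
  shows "coef (specht_perm \<sigma> u) T = coef u (map ((`) (invf \<sigma>)) T)"
  using coef_specht_perm_map[OF assms, of u "map ((`) (invf \<sigma>)) T"] assms
  by (simp add: o_def image_f_inv_f bij_is_surj)

lemma coef_tensor_perm:
  assumes "bij \<sigma>"
  shows "coef (tensor_perm \<sigma> u) w = coef u (map (invf \<sigma>) w)"
  using coef_lin_ext_bij[OF bij_map[OF assms], of u "map (invf \<sigma>) w"] assms
  by (simp add: tensor_perm_def surj_iff[THEN iffD1, OF bij_is_surj])

lemma specht_perm_linear: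
  "specht_perm \<sigma> (u + v) = specht_perm \<sigma> u + specht_perm \<sigma> v"
  "specht_perm \<sigma> (fscale c u) = fscale c (specht_perm \<sigma> u)"
  "specht_perm \<sigma> 0 = 0"
  "specht_perm \<sigma> (\<Sum>i\<in>I. f i) = (\<Sum>i\<in>I. specht_perm \<sigma> (f i))"
  by (simp_all add: specht_perm_def lin_ext_add lin_ext_fscale lin_ext_sum)

lemma subspace_specht: "fvs.subspace (specht \<mu>)"
  by (simp add: specht_def)

lemmas specht_add = fvs.subspace_add[OF subspace_specht]
  and specht_scale = fvs.subspace_scale[OF subspace_specht]
  and specht_sum = fvs.subspace_sum[OF subspace_specht]
  and specht_0 = fvs.subspace_0[OF subspace_specht]

lemma polytabloid_in_specht: "t \<in> tableaux \<mu> \<Longrightarrow> polytabloid \<mu> t \<in> specht \<mu>"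
  by (simp add: specht_def fvs.span_base)

lemma specht_induct [consumes 1, case_names zero add scale polytabloid]:
  assumes "u \<in> specht \<mu>" "P 0" "\<And>u v. u \<in> specht \<mu> \<Longrightarrow> v \<in> specht \<mu> \<Longrightarrow> P u \<Longrightarrow> P v \<Longrightarrow> P (u + v)"
    "\<And>c u. u \<in> specht \<mu> \<Longrightarrow> P u \<Longrightarrow> P (fscale c u)" "\<And>t. t \<in> tableaux \<mu> \<Longrightarrow> P (polytabloid \<mu> t)"
  shows "P u"
proof -
  have "u \<in> specht \<mu> \<and> P u"
    using assms(1) unfolding specht_def
  proof (rule fvs.span_induct)
    show "fvs.subspace {u. u \<in> fvs.span (polytabloid \<mu> ` tableaux \<mu>) \<and> P u}"
      using assms(2-4) by (intro fvs.subspaceI)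
       (auto simp: specht_def[symmetric] specht_0 specht_add specht_scale)
  qed (use assms(5) in \<open>auto simp: fvs.span_base\<close>)
  then show ?thesis ..
qed

section \<open>Permutations acting on polytabloids\<close>

lemma finite_cells: "finite (cells \<mu>)"
proof -
  have "cells \<mu> = (SIGMA i:{..<length \<mu>}. {..<\<mu> ! i})" by (auto simp: cells_def)
  then show ?thesis by simp
qed

lemma finite_column_stabilizer [simp]: "finite (column_stabilizer \<mu> t)"
  by (rule finite_subset[OF _ finite_permutations[of "{..<sum_list \<mu>}"]])
    (auto simp: column_stabilizer_def)

lemma tabloid_comp: "tabloid \<mu> (\<rho> \<circ> t) = map ((`) \<rho>) (tabloid \<mu> t)"
  by (simp add: tabloid_def image_image)

lemma tableaux_comp:
  "\<rho> permutes {..<sum_list \<mu>} \<Longrightarrow> t \<in> tableaux \<mu> \<Longrightarrow> \<rho> \<circ> t \<in> tableaux \<mu>"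
  by (auto simp: tableaux_def intro: bij_betw_trans permutes_imp_bij)

lemma specht_perm_basis [simp]: "specht_perm \<sigma> (basis T) = basis (map ((`) \<sigma>) T)"
  by (simp add: specht_perm_def)

lemma specht_perm_polytabloid_sum:
  "specht_perm \<rho> (polytabloid \<mu> t) =
    (\<Sum>\<sigma>\<in>column_stabilizer \<mu> t. fscale (of_int (sign \<sigma>)) (basis (tabloid \<mu> (\<rho> \<circ> \<sigma> \<circ> t))))"
  by (simp add: polytabloid_def specht_perm_linear tabloid_comp[symmetric] o_assoc)

lemma column_stabilizer_conj:
  assumes \<rho>: "\<rho> permutes {..<sum_list \<mu>}" and \<sigma>: "\<sigma> \<in> column_stabilizer \<mu> t"
  shows "\<rho> \<circ> \<sigma> \<circ> invf \<rho> \<in> column_stabilizer \<mu> (\<rho> \<circ> t)"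
proof -
  have "\<rho> \<circ> \<sigma> \<circ> invf \<rho> permutes {..<sum_list \<mu>}"
    using \<rho> \<sigma> by (auto simp: column_stabilizer_def intro!: permutes_compose permutes_inv)
  moreover have "(\<rho> \<circ> \<sigma> \<circ> invf \<rho>) ((\<rho> \<circ> t) c) = \<rho> (\<sigma> (t c))" for c
    using permutes_inverses[OF \<rho>] by simp
  ultimately show ?thesis using \<sigma> by (fastforce simp: column_stabilizer_def)
qed

text \<open>Conjugation by \<open>\<rho>\<close> matches the column stabilizers of \<open>t\<close>
  and \<open>\<rho> \<circ> t\<close> and keeps signs.\<close>

lemma specht_perm_polytabloid:
  assumes \<rho>: "\<rho> permutes {..<sum_list \<mu>}"
  shows "specht_perm \<rho> (polytabloid \<mu> t) = polytabloid \<mu> (\<rho> \<circ> t)"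
proof -
  note pi = permutes_inv_o[OF \<rho>]
  have b: "bij_betw (\<lambda>\<sigma>. \<rho> \<circ> \<sigma> \<circ> invf \<rho>) (column_stabilizer \<mu> t) (column_stabilizer \<mu> (\<rho> \<circ> t))"
  proof (rule bij_betw_byWitness[of _ "\<lambda>\<sigma>. invf \<rho> \<circ> \<sigma> \<circ> \<rho>"])
    show "\<forall>\<sigma>\<in>column_stabilizer \<mu> t. invf \<rho> \<circ> (\<rho> \<circ> \<sigma> \<circ> invf \<rho>) \<circ> \<rho> = \<sigma>"
      using permutes_inverses[OF \<rho>] by (simp add: fun_eq_iff)
    show "\<forall>\<sigma>\<in>column_stabilizer \<mu> (\<rho> \<circ> t). \<rho> \<circ> (invf \<rho> \<circ> \<sigma> \<circ> \<rho>) \<circ> invf \<rho> = \<sigma>"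
      using permutes_inverses[OF \<rho>] by (simp add: fun_eq_iff)
    show "(\<lambda>\<sigma>. \<rho> \<circ> \<sigma> \<circ> invf \<rho>) ` column_stabilizer \<mu> t \<subseteq> column_stabilizer \<mu> (\<rho> \<circ> t)"
      using column_stabilizer_conj[OF \<rho>] by auto
    have "invf \<rho> \<circ> \<sigma> \<circ> \<rho> \<in> column_stabilizer \<mu> t" if "\<sigma> \<in> column_stabilizer \<mu> (\<rho> \<circ> t)" for \<sigma>
      using column_stabilizer_conj[OF permutes_inv[OF \<rho>] that] pi
      by (simp add: permutes_inv_inv[OF \<rho>] o_assoc)
    then show "(\<lambda>\<sigma>. invf \<rho> \<circ> \<sigma> \<circ> \<rho>) ` column_stabilizer \<mu> (\<rho> \<circ> t) \<subseteq> column_stabilizer \<mu> t" by auto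
  qed
  have "sign (\<rho> \<circ> \<sigma> \<circ> invf \<rho>) = sign \<sigma>" if "\<sigma> \<in> column_stabilizer \<mu> t" for \<sigma>
  proof -
    have "permutation \<rho>" "permutation \<sigma>" "permutation (invf \<rho>)"
      using \<rho> that permutes_inv[OF \<rho>]
      by (auto simp: column_stabilizer_def permutation_permutes intro: finite_lessThan)
    then show ?thesis
      by (simp add: sign_compose sign_inverse permutation_compose)
  qed
  moreover have "tabloid \<mu> (\<rho> \<circ> \<sigma> \<circ> invf \<rho> \<circ> (\<rho> \<circ> t)) = tabloid \<mu> (\<rho> \<circ> \<sigma> \<circ> t)" for \<sigma>
    using permutes_inverses[OF \<rho>] by (simp add: tabloid_def)
  ultimately show ?thesis
    unfolding specht_perm_polytabloid_sum unfolding polytabloid_def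
    by (subst sum.reindex_bij_betw[OF b, symmetric]) simp
qed

lemma column_stabilizer_comp:
  assumes "\<rho> \<in> column_stabilizer \<mu> t" "\<sigma> \<in> column_stabilizer \<mu> t"
  shows "\<rho> \<circ> \<sigma> \<in> column_stabilizer \<mu> t"
proof -
  have "\<exists>i'. (i', j) \<in> cells \<mu> \<and> (\<rho> \<circ> \<sigma>) (t (i, j)) = t (i', j)" if "(i, j) \<in> cells \<mu>" for i j
  proof -
    from that assms(2) obtain i' where "(i', j) \<in> cells \<mu>" "\<sigma> (t (i, j)) = t (i', j)"
      by (fastforce simp: column_stabilizer_def)
    moreover from this assms(1) obtain i'' where "(i'', j) \<in> cells \<mu>" "\<rho> (t (i', j)) = t (i'', j)"
      by (fastforce simp: column_stabilizer_def)
    ultimately show ?thesis by auto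
  qed
  then show ?thesis using assms by (auto simp: column_stabilizer_def intro: permutes_compose)
qed

text \<open>Left translation by \<open>\<rho>\<close> permutes the column stabilizer and multiplies
  every sign by that of \<open>\<rho>\<close>. The Garnir relations rest on this
  antisymmetry.\<close>

lemma specht_perm_polytabloid_column:
  assumes \<rho>: "\<rho> \<in> column_stabilizer \<mu> t"
  shows "specht_perm \<rho> (polytabloid \<mu> t) = fscale (of_int (sign \<rho>)) (polytabloid \<mu> t)"
proof -
  let ?C = "column_stabilizer \<mu> t"
  have p: "\<rho> permutes {..<sum_list \<mu>}" using \<rho> by (simp add: column_stabilizer_def)
  have "inj_on ((\<circ>) \<rho>) ?C" using permutes_inj[OF p] by (auto simp: inj_on_def fun_eq_iff dest: injD)
  moreover have "(\<circ>) \<rho> ` ?C \<subseteq> ?C" using column_stabilizer_comp[OF \<rho>] by auto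
  ultimately have b: "bij_betw ((\<circ>) \<rho>) ?C ?C"
    by (simp add: bij_betw_def endo_inj_surj)
  have s: "sign \<rho> * sign (\<rho> \<circ> \<sigma>) = sign \<sigma>" if "\<sigma> \<in> ?C" for \<sigma>
  proof -
    have "permutation \<rho>" "permutation \<sigma>"
      using \<rho> that by (auto simp: column_stabilizer_def permutation_permutes intro: finite_lessThan)
    then show ?thesis by (simp add: sign_compose mult.assoc[symmetric])
  qed
  have "fscale (of_int (sign \<rho>)) (polytabloid \<mu> t) =
     (\<Sum>\<sigma>\<in>?C. fscale (of_int (sign \<rho> * sign \<sigma>)) (basis (tabloid \<mu> (\<sigma> \<circ> t))))"
    by (simp add: polytabloid_def fvs.scale_sum_right)
  also have "\<dots> = (\<Sum>\<sigma>\<in>?C. fscale (of_int (sign \<rho> * sign (\<rho> \<circ> \<sigma>))) (basis (tabloid \<mu> (\<rho> \<circ> \<sigma> \<circ> t))))"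
    by (rule sum.reindex_bij_betw[OF b, symmetric])
  also have "\<dots> = specht_perm \<rho> (polytabloid \<mu> t)"
    unfolding specht_perm_polytabloid_sum by (intro sum.cong) (simp_all only: s)
  finally show ?thesis ..
qed

lemma specht_perm_specht:
  assumes "\<rho> permutes {..<sum_list \<mu>}" "u \<in> specht \<mu>"
  shows "specht_perm \<rho> u \<in> specht \<mu>"
  using assms(2) by (induction rule: specht_induct)
    (auto simp: specht_perm_linear specht_0 specht_add specht_scale specht_perm_polytabloid assms(1)
      intro!: polytabloid_in_specht tableaux_comp)

lemma transpose_column_stabilizer:
  assumes t: "t \<in> tableaux \<mu>" and "(i, j) \<in> cells \<mu>" "(i', j) \<in> cells \<mu>"
  shows "transpose (t (i, j)) (t (i', j)) \<in> column_stabilizer \<mu> t"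
proof -
  have inj: "inj_on t (cells \<mu>)" and m: "t ` cells \<mu> = {..<sum_list \<mu>}"
    using t by (auto simp: tableaux_def bij_betw_def)
  have "\<exists>k'. (k', l) \<in> cells \<mu> \<and> transpose (t (i, j)) (t (i', j)) (t (k, l)) = t (k', l)"
    if "(k, l) \<in> cells \<mu>" for k l
  proof (cases "(k, l) = (i, j) \<or> (k, l) = (i', j)")
    case True
    then show ?thesis using assms by auto
  next
    case False
    then have "t (k, l) \<noteq> t (i, j)" "t (k, l) \<noteq> t (i', j)"
      using inj_onD[OF inj, of "(k, l)"] that assms by auto
    then show ?thesis using that by (auto simp: transpose_def)
  qed
  moreover have "t (i, j) \<in> {..<sum_list \<mu>}" "t (i', j) \<in> {..<sum_list \<mu>}"
    using m assms by blast+
  ultimately show ?thesis unfolding column_stabilizer_def by (auto intro: permutes_swap_id)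
qed

lemma coef_polytabloid_transpose:
  fixes t :: "nat \<times> nat \<Rightarrow> nat"
  assumes t: "t \<in> tableaux \<mu>" and c: "(i, j) \<in> cells \<mu>" "(i', j) \<in> cells \<mu>" "i \<noteq> i'"
  shows "coef (polytabloid \<mu> t :: _ \<Rightarrow>\<^sub>0 'k::field) (map ((`) (transpose (t (i, j)) (t (i', j)))) T)
     = - coef (polytabloid \<mu> t) T"
proof -
  let ?\<tau> = "transpose (t (i, j)) (t (i', j))"
  have ne: "t (i, j) \<noteq> t (i', j)"
    using c t inj_onD[of t "cells \<mu>" "(i, j)" "(i', j)"] by (auto simp: tableaux_def bij_betw_def)
  have b: "bij ?\<tau>" by simp
  have "coef (specht_perm ?\<tau> (polytabloid \<mu> t)) (map ((`) ?\<tau>) T) = coef (polytabloid \<mu> t :: _ \<Rightarrow>\<^sub>0 'k) T"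
    by (rule coef_specht_perm_map[OF b])
  moreover have "specht_perm ?\<tau> (polytabloid \<mu> t) = fscale (-1) (polytabloid \<mu> t :: _ \<Rightarrow>\<^sub>0 'k)"
    using specht_perm_polytabloid_column[OF transpose_column_stabilizer[OF t c(1,2)], where 'a='k] ne
    by (simp add: sign_swap_id)
  ultimately show ?thesis by (simp add: lookup_fscale minus_equation_iff)
qed

section \<open>Tabloids and Garnir relations\<close>

definition tabloids :: "nat list \<Rightarrow> nat set list set" where
  "tabloids \<mu> = tabloid \<mu> ` tableaux \<mu>"

lemma tabloidsD:
  assumes "T \<in> tabloids \<mu>"
  shows "length T = length \<mu>" "i < length \<mu> \<Longrightarrow> card (T ! i) = \<mu> ! i"
    "i < length \<mu> \<Longrightarrow> j < length \<mu> \<Longrightarrow> i \<noteq> j \<Longrightarrow> T ! i \<inter> T ! j = {}"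
    "\<Union>(set T) = {..<sum_list \<mu>}"
proof -
  obtain t where t: "T = tabloid \<mu> t" "bij_betw t (cells \<mu>) {..<sum_list \<mu>}"
    using assms by (auto simp: tabloids_def tableaux_def)
  then have inj: "inj_on t (cells \<mu>)" and im: "t ` cells \<mu> = {..<sum_list \<mu>}"
    by (auto simp: bij_betw_def)
  show "length T = length \<mu>" by (simp add: t tabloid_def)
  show "card (T ! i) = \<mu> ! i" if "i < length \<mu>"
  proof -
    have "inj_on (\<lambda>j. t (i, j)) {..<\<mu> ! i}"
      using inj that by (auto simp: inj_on_def cells_def)
    then show ?thesis using that by (simp add: t tabloid_def card_image)
  qed
  show "T ! i \<inter> T ! j = {}" if "i < length \<mu>" "j < length \<mu>" "i \<noteq> j"
  proof -
    have "t (i, k) \<noteq> t (j, l)" if "k < \<mu> ! i" "l < \<mu> ! j" for k l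
      using inj_onD[OF inj, of "(i, k)" "(j, l)"] that \<open>i < _\<close> \<open>j < _\<close> \<open>i \<noteq> j\<close>
      by (auto simp: cells_def)
    then show ?thesis using that by (auto simp: t tabloid_def)
  qed
  have "\<Union>(set T) = t ` cells \<mu>"
    by (force simp: t tabloid_def cells_def)
  then show "\<Union>(set T) = {..<sum_list \<mu>}" using im by simp
qed

lemma finite_tabloids [simp]: "finite (tabloids \<mu>)"
proof (rule finite_subset)
  show "tabloids \<mu> \<subseteq> {T. set T \<subseteq> Pow {..<sum_list \<mu>} \<and> length T = length \<mu>}"
    using tabloidsD(1,4) by blast
qed (simp add: finite_lists_length_eq)

lemma column_stabilizerD: "\<sigma> \<in> column_stabilizer \<mu> t \<Longrightarrow> \<sigma> permutes {..<sum_list \<mu>}"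
  "\<sigma> \<in> column_stabilizer \<mu> t \<Longrightarrow> (i, j) \<in> cells \<mu>
    \<Longrightarrow> \<exists>i'. (i', j) \<in> cells \<mu> \<and> \<sigma> (t (i, j)) = t (i', j)"
  unfolding column_stabilizer_def by blast+

lemma coef_polytabloid:
  "coef (polytabloid \<mu> t :: _ \<Rightarrow>\<^sub>0 'k::field) T =
    of_int (\<Sum>\<sigma>\<in>column_stabilizer \<mu> t. if tabloid \<mu> (\<sigma> \<circ> t) = T then sign \<sigma> else 0)"
  unfolding polytabloid_def lookup_sum of_int_sum
  by (intro sum.cong) (auto simp: lookup_fscale lookup_single when_def)

lemma specht_subset_free_on: "specht \<mu> \<subseteq> free_on (tabloids \<mu>)"
  unfolding specht_def
proof (rule fvs.span_minimal[OF _ subspace_free_on], safe)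
  fix t assume "t \<in> tableaux \<mu>"
  then have "tabloid \<mu> (\<sigma> \<circ> t) \<in> tabloids \<mu>" if "\<sigma> \<in> column_stabilizer \<mu> t" for \<sigma>
    using tableaux_comp[OF column_stabilizerD(1)[OF that]] by (auto simp: tabloids_def)
  then show "(polytabloid \<mu> t :: _ \<Rightarrow>\<^sub>0 'a) \<in> free_on (tabloids \<mu>)"
    unfolding polytabloid_def by (auto intro!: free_on_sum free_on_fscale)
qed

lemma coef_specht_outside: "u \<in> specht \<mu> \<Longrightarrow> T \<notin> tabloids \<mu> \<Longrightarrow> coef u T = 0"
  by (rule free_on_coef[OF subsetD[OF specht_subset_free_on]])

lemma transpose_image_mem:
  assumes "x \<in> X" "y \<in> X"
  shows "transpose x y ` X = X"
  using assms by (simp add: transpose_image_eq)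

lemma inj_on_transpose: "inj_on (transpose x y) X"
  by (rule inj_on_subset[OF _ subset_UNIV]) simp

text \<open>The terms of a Garnir relation are indexed by the element \<open>a\<close> of
  \<open>X\<close> that leaves the first row for row \<open>j\<close> of \<open>L\<close>. The rows
  of \<open>L\<close> miss \<open>X\<close>, so a transposition of two elements of \<open>X\<close>
  only changes this index.\<close>

lemma map_transpose_update:
  assumes xy: "x \<in> X" "y \<in> X" and L: "\<And>A. A \<in> set L \<Longrightarrow> X \<inter> A = {}" and j: "j < length L"
  shows "map ((`) (transpose x y)) ((X - {a}) # L[j := insert a (L ! j)]) =
    (X - {transpose x y a}) # L[j := insert (transpose x y a) (L ! j)]"
proof -
  let ?\<tau> = "transpose x y"
  have A: "?\<tau> ` A = A" if "X \<inter> A = {}" for A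
  proof -
    have "?\<tau> z = id z" if "z \<in> A" for z
      using xy \<open>X \<inter> A = {}\<close> that by (auto simp: transpose_def)
    then have "?\<tau> ` A = id ` A" by (rule image_cong[OF refl])
    then show ?thesis by simp
  qed
  have "?\<tau> ` (X - {a}) = X - {?\<tau> a}"
    using image_set_diff[of ?\<tau> X "{a}"] transpose_image_mem[OF xy] by (simp add: inj_on_transpose)
  moreover have "map ((`) ?\<tau>) L = L" using L A by (simp add: map_idI)
  moreover have "?\<tau> ` (L ! j) = L ! j" using L A j by simp
  ultimately show ?thesis by (simp add: map_update)
qed

text \<open>A Garnir relation: two of the \<open>m + 1\<close> elements of \<open>X\<close> lie in the same column of a given
  tableau, and the transposition of these two permutes the summands and changes their sign.\<close>

lemma coef_sum_updates_eq_0: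
  fixes u :: "nat set list \<Rightarrow>\<^sub>0 'k::field_char_0"
  assumes u: "u \<in> specht (m # \<nu>)" and \<nu>: "\<And>i. i < length \<nu> \<Longrightarrow> \<nu> ! i \<le> m"
    and X: "X \<subseteq> {..<m + sum_list \<nu>}" "card X = Suc m" "\<And>A. A \<in> set L \<Longrightarrow> X \<inter> A = {}"
    and j: "j < length L"
  shows "(\<Sum>a\<in>X. coef u ((X - {a}) # L[j := insert a (L ! j)])) = 0"
  using u
proof (induction rule: specht_induct)
  case (polytabloid t)
  then have "bij_betw t (cells (m # \<nu>)) {..<m + sum_list \<nu>}" by (simp add: tableaux_def)
  then have inj: "inj_on t (cells (m # \<nu>))" and im: "t ` cells (m # \<nu>) = {..<m + sum_list \<nu>}"
    by (auto simp: bij_betw_def)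
  define c where "c x = inv_into (cells (m # \<nu>)) t x" for x
  have c: "c x \<in> cells (m # \<nu>)" "t (c x) = x" if "x \<in> X" for x
  proof -
    have "x \<in> t ` cells (m # \<nu>)" using that X(1) unfolding im by auto
    then show "c x \<in> cells (m # \<nu>)" "t (c x) = x"
      unfolding c_def by (simp_all add: inv_into_into f_inv_into_f)
  qed
  \<comment> \<open>No row is longer than the first, so only \<open>m\<close> columns are available
    for the \<open>m + 1\<close> elements of \<open>X\<close>.\<close>
  have "snd (c x) < m" if x: "x \<in> X" for x
  proof -
    obtain i j where ij: "c x = (i, j)" by (cases "c x")
    show ?thesis
    proof (cases i)
      case (Suc k)
      then have "k < length \<nu>" "j < \<nu> ! k" using c(1)[OF x] ij by (simp_all add: cells_def)
      then show ?thesis using \<nu>[of k] ij by simp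
    qed (use c(1)[OF x] ij in \<open>simp add: cells_def\<close>)
  qed
  then have "snd ` c ` X \<subseteq> {..<m}" by auto
  then have "card ((snd \<circ> c) ` X) \<le> m"
    using card_mono[OF finite_lessThan, of "snd ` c ` X" m] by (simp add: image_comp)
  then have "\<not> inj_on (snd \<circ> c) X" using X(2) card_image by fastforce
  then obtain x y where xy: "x \<in> X" "y \<in> X" "x \<noteq> y" "snd (c x) = snd (c y)"
    by (auto simp: inj_on_def)
  define \<tau> where "\<tau> = transpose x y"
  define T where "T a = (X - {a}) # L[j := insert a (L ! j)]" for a
  define F where "F T = coef (polytabloid (m # \<nu>) t :: _ \<Rightarrow>\<^sub>0 'k) T" for T
  have "map ((`) \<tau>) (T a) = T (\<tau> a)" if "a \<in> X" for a
    unfolding T_def \<tau>_def using xy(1,2) X(3) j by (rule map_transpose_update)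
  note T\<tau> = this
  have F\<tau>: "F (map ((`) \<tau>) T') = - F T'" for T'
  proof -
    obtain i i' l where "c x = (i, l)" "c y = (i', l)" using xy(4) by (cases "c x", cases "c y") auto
    then show ?thesis unfolding F_def \<tau>_def
      using coef_polytabloid_transpose[OF polytabloid, of i l i' T', where 'k='k] c[OF xy(1)] c[OF xy(2)] xy(3)
      by auto
  qed
  have "bij_betw \<tau> X X" using transpose_image_mem[OF xy(1,2)]
    by (simp add: \<tau>_def bij_betw_def inj_on_transpose)
  then have "(\<Sum>a\<in>X. F (T a)) = (\<Sum>a\<in>X. F (T (\<tau> a)))" by (rule sum.reindex_bij_betw[symmetric])
  also have "\<dots> = (\<Sum>a\<in>X. - F (T a))"
    by (intro sum.cong) (simp_all add: F\<tau> flip: T\<tau>)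
  also have "\<dots> = - (\<Sum>a\<in>X. F (T a))" by (rule sum_negf)
  finally have "(\<Sum>a\<in>X. F (T a)) = - (\<Sum>a\<in>X. F (T a))" .
  then have "2 * (\<Sum>a\<in>X. F (T a)) = 0" by (metis add.right_inverse mult_2)
  then show ?case unfolding F_def T_def by simp
next
  case (scale c u)
  then show ?case by (simp add: lookup_fscale sum_distrib_left[symmetric])
qed (simp_all add: lookup_add sum.distrib)

section \<open>Polytabloids with a prescribed first row\<close>

lemma cells_Cons [simp]:
  "(0, j) \<in> cells (m # \<nu>) \<longleftrightarrow> j < m" "(Suc i, j) \<in> cells (m # \<nu>) \<longleftrightarrow> (i, j) \<in> cells \<nu>"
  by (auto simp: cells_def)

definition lower_rows :: "(nat \<times> nat \<Rightarrow> nat) \<Rightarrow> nat \<times> nat \<Rightarrow> nat" where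
  "lower_rows t = (\<lambda>(i, j). t (Suc i, j))"

lemma lower_rows_simp [simp]: "lower_rows t (i, j) = t (Suc i, j)"
  by (simp add: lower_rows_def)

lemma tabloid_Cons:
  "tabloid (m # \<nu>) t = (\<lambda>j. t (0, j)) ` {..<m} # tabloid \<nu> (lower_rows t)"
  by (simp add: tabloid_def map_upt_Suc del: upt_Suc)

lemma tableauxD:
  assumes "t \<in> tableaux \<mu>"
  shows "c \<in> cells \<mu> \<Longrightarrow> d \<in> cells \<mu> \<Longrightarrow> t c = t d \<longleftrightarrow> c = d"
    "c \<in> cells \<mu> \<Longrightarrow> t c < sum_list \<mu>" "t ` cells \<mu> = {..<sum_list \<mu>}"
  using assms by (auto simp: tableaux_def bij_betw_def dest: inj_onD)

text \<open>If \<open>\<sigma>\<close> moved \<open>t (0, j)\<close> down, this entry would lie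
  above a cell of \<open>\<nu>\<close>, hence in \<open>R\<close>, and so be the image of some top
  entry \<open>t (0, j')\<close>. As \<open>\<sigma>\<close> preserves columns,
  \<open>j' = j\<close>, so \<open>t (0, j)\<close> is fixed after all.\<close>

lemma column_stabilizer_fixes_top:
  assumes t: "t \<in> tableaux (m # \<nu>)" and R: "\<And>i j. (i, j) \<in> cells \<nu> \<Longrightarrow> t (0, j) \<in> R"
    and \<sigma>: "\<sigma> \<in> column_stabilizer (m # \<nu>) t" "tabloid (m # \<nu>) (\<sigma> \<circ> t) = R # U" and j: "j < m"
  shows "\<sigma> (t (0, j)) = t (0, j)"
proof -
  obtain i' where i': "(i', j) \<in> cells (m # \<nu>)" "\<sigma> (t (0, j)) = t (i', j)"
    using column_stabilizerD(2)[OF \<sigma>(1), of 0 j] j by auto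
  show ?thesis
  proof (cases i')
    case (Suc i)
    then have "t (0, j) \<in> R" using R i' by auto
    then obtain j' where j': "j' < m" "t (0, j) = \<sigma> (t (0, j'))"
      using \<sigma>(2) by (auto simp: tabloid_Cons)
    moreover obtain i'' where "(i'', j') \<in> cells (m # \<nu>)" "\<sigma> (t (0, j')) = t (i'', j')"
      using column_stabilizerD(2)[OF \<sigma>(1), of 0 j'] j' by auto
    ultimately have "j' = j" using tableauxD(1)[OF t, of "(0, j)" "(i'', j')"] j by auto
    then show ?thesis using j' by simp
  qed (use i' in simp)
qed

text \<open>Among the first rows containing every entry above a cell of \<open>\<nu>\<close>, only
  the first row of \<open>t\<close> itself occurs in the polytabloid. For injectivity,
  \<open>R\<close> will be the complement of the letters of a word, and this tells different sets of
  letters apart.\<close>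

lemma coef_polytabloid_other_top:
  assumes t: "t \<in> tableaux (m # \<nu>)" and R: "\<And>i j. (i, j) \<in> cells \<nu> \<Longrightarrow> t (0, j) \<in> R"
    and ne: "R \<noteq> (\<lambda>j. t (0, j)) ` {..<m}"
  shows "coef (polytabloid (m # \<nu>) t) (R # U) = 0"
proof -
  have "tabloid (m # \<nu>) (\<sigma> \<circ> t) \<noteq> R # U" if \<sigma>: "\<sigma> \<in> column_stabilizer (m # \<nu>) t" for \<sigma>
  proof
    assume eq: "tabloid (m # \<nu>) (\<sigma> \<circ> t) = R # U"
    have "(\<lambda>j. (\<sigma> \<circ> t) (0, j)) ` {..<m} = (\<lambda>j. t (0, j)) ` {..<m}"
      using column_stabilizer_fixes_top[OF t R \<sigma> eq] by (intro image_cong) auto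
    then show False using eq ne by (simp add: tabloid_Cons)
  qed
  then show ?thesis by (simp add: coef_polytabloid)
qed

lemma lower_rows_tableaux:
  assumes t: "t \<in> tableaux (m # \<nu>)"
    and row: "(\<lambda>j. t (0, j)) ` {..<m} = {sum_list \<nu>..<sum_list \<nu> + m}"
  shows "lower_rows t \<in> tableaux \<nu>"
proof -
  have "inj_on (lower_rows t) (cells \<nu>)"
    using tableauxD(1)[OF t] by (auto simp: inj_on_def)
  moreover have "lower_rows t ` cells \<nu> = {..<sum_list \<nu>}"
  proof safe
    fix i j assume ij: "(i, j) \<in> cells \<nu>"
    then have "t (Suc i, j) < sum_list \<nu> + m" using tableauxD(2)[OF t, of "(Suc i, j)"] by simp
    moreover have "t (Suc i, j) \<noteq> t (0, j')" if "j' < m" for j'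
      using tableauxD(1)[OF t, of "(Suc i, j)" "(0, j')"] ij that by simp
    then have "t (Suc i, j) \<notin> {sum_list \<nu>..<sum_list \<nu> + m}" unfolding row[symmetric] by auto
    ultimately show "lower_rows t (i, j) < sum_list \<nu>" by auto
  next
    fix x assume x: "x < sum_list \<nu>"
    then have "x \<in> t ` cells (m # \<nu>)" using tableauxD(3)[OF t] by simp
    then obtain i j where ij: "(i, j) \<in> cells (m # \<nu>)" "x = t (i, j)" by auto
    have "x \<notin> (\<lambda>j. t (0, j)) ` {..<m}" using x row by auto
    then have "i \<noteq> 0" using ij by (intro notI) auto
    then show "x \<in> lower_rows t ` cells \<nu>" using ij
      by (cases i) (auto intro!: image_eqI[of _ _ "(i - 1, j)"])
  qed
  ultimately show ?thesis by (simp add: tableaux_def bij_betw_def)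
qed

text \<open>The column permutations of \<open>t\<close> that keep the first row fix it pointwise, so
  they are exactly the column permutations of the lower rows.\<close>

lemma coef_polytabloid_same_top:
  assumes t: "t \<in> tableaux (m # \<nu>)"
    and row: "(\<lambda>j. t (0, j)) ` {..<m} = {sum_list \<nu>..<sum_list \<nu> + m}"
    and R: "\<And>i j. (i, j) \<in> cells \<nu> \<Longrightarrow> j < m"
  shows "coef (polytabloid (m # \<nu>) t) ({sum_list \<nu>..<sum_list \<nu> + m} # U) =
    coef (polytabloid \<nu> (lower_rows t)) U"
proof -
  let ?R = "{sum_list \<nu>..<sum_list \<nu> + m}" and ?C = "column_stabilizer (m # \<nu>) t"
  have top: "t (0, j) \<in> ?R" if "j < m" for j
    using that unfolding row[symmetric] by auto
  have R': "t (0, j) \<in> ?R" if "(i, j) \<in> cells \<nu>" for i j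
    using top R[OF that] by simp
  have sub: "column_stabilizer \<nu> (lower_rows t) \<subseteq> ?C"
  proof
    fix \<sigma> assume \<sigma>: "\<sigma> \<in> column_stabilizer \<nu> (lower_rows t)"
    have p: "\<sigma> permutes {..<sum_list \<nu>}" using column_stabilizerD(1)[OF \<sigma>] .
    have "\<exists>i'. (i', j) \<in> cells (m # \<nu>) \<and> \<sigma> (t (i, j)) = t (i', j)" if "(i, j) \<in> cells (m # \<nu>)" for i j
    proof (cases i)
      case 0
      then have "t (i, j) \<in> ?R" using that top by simp
      then have "\<sigma> (t (i, j)) = t (i, j)" using p by (intro permutes_not_in) auto
      then show ?thesis using that by auto
    next
      case (Suc k)
      then obtain i' where "(i', j) \<in> cells \<nu>" "\<sigma> (lower_rows t (k, j)) = lower_rows t (i', j)"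
        using column_stabilizerD(2)[OF \<sigma>, of k j] \<open>(i, j) \<in> _\<close> by auto
      then show ?thesis using Suc by (intro exI[of _ "Suc i'"]) auto
    qed
    moreover have "\<sigma> permutes {..<sum_list (m # \<nu>)}" by (rule permutes_subset[OF p]) auto
    ultimately show "\<sigma> \<in> ?C" by (auto simp: column_stabilizer_def)
  qed
  have lower: "\<sigma> \<in> column_stabilizer \<nu> (lower_rows t)"
    if \<sigma>: "\<sigma> \<in> ?C" and eq: "tabloid (m # \<nu>) (\<sigma> \<circ> t) = ?R # U" for \<sigma>
  proof -
    have fix0: "\<sigma> (t (0, j)) = t (0, j)" if "j < m" for j
      by (rule column_stabilizer_fixes_top[OF t R' \<sigma> eq that])
    have pn: "\<sigma> permutes {..<sum_list (m # \<nu>)}" using column_stabilizerD(1)[OF \<sigma>] .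
    have "\<sigma> x = x" if "x \<in> ?R" for x
    proof -
      have "x \<in> (\<lambda>j. t (0, j)) ` {..<m}" using that by (simp only: row)
      then obtain j where "j < m" "x = t (0, j)" by auto
      then show ?thesis using fix0 by simp
    qed
    then have "\<sigma> x = x" if "x \<in> {..<sum_list (m # \<nu>)} - {..<sum_list \<nu>}" for x
      using that by simp
    then have "\<sigma> permutes {..<sum_list \<nu>}" by (rule permutes_superset[OF pn])
    moreover have "\<exists>i'. (i', j) \<in> cells \<nu> \<and> \<sigma> (t (Suc i, j)) = t (Suc i', j)" if ij: "(i, j) \<in> cells \<nu>" for i j
    proof -
      obtain i' where i': "(i', j) \<in> cells (m # \<nu>)" "\<sigma> (t (Suc i, j)) = t (i', j)"
        using column_stabilizerD(2)[OF \<sigma>, of "Suc i" j] ij by auto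
      have "i' \<noteq> 0"
      proof
        assume "i' = 0"
        then have "\<sigma> (t (Suc i, j)) = \<sigma> (t (0, j))" using i' fix0 by simp
        then have "t (Suc i, j) = t (0, j)" using permutes_inj[OF pn] by (simp add: inj_eq)
        then show False using tableauxD(1)[OF t, of "(Suc i, j)" "(0, j)"] ij i' \<open>i' = 0\<close> by simp
      qed
      then show ?thesis using i' by (cases i') auto
    qed
    ultimately show ?thesis by (auto simp: column_stabilizer_def)
  qed
  have tab: "tabloid (m # \<nu>) (\<sigma> \<circ> t) = ?R # U \<longleftrightarrow> tabloid \<nu> (\<sigma> \<circ> lower_rows t) = U"
    if \<sigma>: "\<sigma> \<in> column_stabilizer \<nu> (lower_rows t)" for \<sigma>
  proof -
    have "\<sigma> (t (0, j)) = t (0, j)" if "j < m" for j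
      using top[OF that] by (intro permutes_not_in[OF column_stabilizerD(1)[OF \<sigma>]]) auto
    then have "(\<lambda>j. (\<sigma> \<circ> t) (0, j)) ` {..<m} = (\<lambda>j. t (0, j)) ` {..<m}" by (intro image_cong) auto
    then have "(\<lambda>j. (\<sigma> \<circ> t) (0, j)) ` {..<m} = ?R" by (simp only: row)
    moreover have "lower_rows (\<sigma> \<circ> t) = \<sigma> \<circ> lower_rows t" by (auto simp: lower_rows_def)
    ultimately show ?thesis by (simp add: tabloid_Cons)
  qed
  have "(\<Sum>\<sigma>\<in>?C. if tabloid (m # \<nu>) (\<sigma> \<circ> t) = ?R # U then sign \<sigma> else 0) =
    (\<Sum>\<sigma>\<in>column_stabilizer \<nu> (lower_rows t). if tabloid (m # \<nu>) (\<sigma> \<circ> t) = ?R # U then sign \<sigma> else 0)"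
    using sub lower by (intro sum.mono_neutral_right) auto
  also have "\<dots> = (\<Sum>\<sigma>\<in>column_stabilizer \<nu> (lower_rows t).
      if tabloid \<nu> (\<sigma> \<circ> lower_rows t) = U then sign \<sigma> else 0)"
    by (intro sum.cong refl if_cong tab)
  finally show ?thesis unfolding coef_polytabloid by (rule arg_cong)
qed

lemma extend_to_permutation:
  assumes S: "finite S" and A: "A \<subseteq> S" "f ` A \<subseteq> S" "inj_on f A"
  obtains \<beta> where "\<beta> permutes S" "\<And>x. x \<in> A \<Longrightarrow> \<beta> x = f x"
proof -
  have "card (S - A) = card (S - f ` A)"
    using assms finite_subset[OF A(1) S] by (simp add: card_Diff_subset card_image)
  then obtain g where g: "bij_betw g (S - A) (S - f ` A)"
    using S finite_same_card_bij[of "S - A" "S - f ` A"] by auto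
  define \<beta> where "\<beta> x = (if x \<in> A then f x else if x \<in> S then g x else x)" for x
  have "bij_betw \<beta> A (f ` A)"
    using A by (auto simp: bij_betw_def \<beta>_def inj_on_def)
  moreover have "bij_betw \<beta> (S - A) (S - f ` A)"
    using g by (subst bij_betw_cong[of _ _ g]) (auto simp: \<beta>_def)
  ultimately have "bij_betw \<beta> (A \<union> (S - A)) (f ` A \<union> (S - f ` A))"
    by (rule bij_betw_combine) auto
  then have "bij_betw \<beta> S S" using A by (simp add: Un_absorb1)
  then have "\<beta> permutes S" by (rule bij_imp_permutes) (use A in \<open>auto simp: \<beta>_def\<close>)
  then show ?thesis using that by (simp add: \<beta>_def)
qed

text \<open>Column transpositions, each at the cost of a sign, bring an entry of the prescribed
  first row to the top of every column that has one. If some column has none, no column permutation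
  produces this first row and the restriction is zero; otherwise it is, up to sign, the polytabloid
  of the lower rows. The induction counts the top entries that are still wrong.\<close>

lemma restrict_top_polytabloid:
  assumes \<nu>: "\<And>i j. (i, j) \<in> cells \<nu> \<Longrightarrow> j < m" and t: "t \<in> tableaux (m # \<nu>)"
  shows "\<exists>s\<in>specht \<nu>. \<forall>U. coef s U =
    coef (polytabloid (m # \<nu>) t :: _ \<Rightarrow>\<^sub>0 'k::field) ({sum_list \<nu>..<sum_list \<nu> + m} # U)"
  using t
proof (induction "card {j \<in> {..<m}. t (0, j) \<notin> {sum_list \<nu>..<sum_list \<nu> + m}}" arbitrary: t rule: less_induct)
  case less
  let ?X = "{sum_list \<nu>..<sum_list \<nu> + m}"
  note t = less.prems
  consider (empty) j where "j < m" "\<And>i. (i, j) \<in> cells (m # \<nu>) \<Longrightarrow> t (i, j) \<notin> ?X"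
    | (swap) i j where "j < m" "t (0, j) \<notin> ?X" "(i, j) \<in> cells (m # \<nu>)" "t (i, j) \<in> ?X"
    | (top) "\<And>j. j < m \<Longrightarrow> t (0, j) \<in> ?X" by blast
  then show ?case
  proof cases
    case empty
    have "tabloid (m # \<nu>) (\<sigma> \<circ> t) \<noteq> ?X # U" if \<sigma>: "\<sigma> \<in> column_stabilizer (m # \<nu>) t" for \<sigma> U
    proof
      assume "tabloid (m # \<nu>) (\<sigma> \<circ> t) = ?X # U"
      then have "\<sigma> (t (0, j)) \<in> ?X" using empty(1) by (auto simp: tabloid_Cons)
      moreover obtain i where "(i, j) \<in> cells (m # \<nu>)" "\<sigma> (t (0, j)) = t (i, j)"
        using column_stabilizerD(2)[OF \<sigma>, of 0 j] empty(1) by auto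
      ultimately show False using empty(2) by auto
    qed
    then have "coef (polytabloid (m # \<nu>) t :: _ \<Rightarrow>\<^sub>0 'k) (?X # U) = 0" for U
      unfolding coef_polytabloid by (simp del: of_int_sum)
    then show ?thesis by (intro bexI[of _ 0]) (simp_all add: specht_0)
  next
    case swap
    let ?\<tau> = "transpose (t (0, j)) (t (i, j))"
    have c0: "(0, j) \<in> cells (m # \<nu>)" using swap by simp
    have ne: "t (0, j) \<noteq> t (i, j)" using swap(2,4) by auto
    have \<tau>: "?\<tau> \<in> column_stabilizer (m # \<nu>) t"
      by (rule transpose_column_stabilizer[OF t c0 swap(3)])
    note p = column_stabilizerD(1)[OF \<tau>]
    have t': "?\<tau> \<circ> t \<in> tableaux (m # \<nu>)" by (rule tableaux_comp[OF p t])
    have e: "polytabloid (m # \<nu>) (?\<tau> \<circ> t) = - (polytabloid (m # \<nu>) t :: _ \<Rightarrow>\<^sub>0 'k)"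
      using specht_perm_polytabloid[OF p, of t, where 'a='k]
        specht_perm_polytabloid_column[OF \<tau>, where 'a='k] ne
      by (simp add: sign_swap_id)
    let ?J = "\<lambda>t. {j \<in> {..<m}. t (0, j) \<notin> ?X}"
    have other: "(?\<tau> \<circ> t) (0, j') = t (0, j')" if "j' < m" "j' \<noteq> j" for j'
    proof -
      have "t (0, j') \<noteq> t (0, j)" "t (0, j') \<noteq> t (i, j)"
        using tableauxD(1)[OF t, of "(0, j')"] that swap(3) c0 by simp_all
      then show ?thesis by (simp add: transpose_def)
    qed
    have "?J (?\<tau> \<circ> t) \<subseteq> ?J t"
    proof
      fix j' assume j': "j' \<in> ?J (?\<tau> \<circ> t)"
      have "j' \<noteq> j" using j' swap(4) by auto
      then show "j' \<in> ?J t" using other[of j'] j' by simp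
    qed
    moreover have "j \<in> ?J t" "j \<notin> ?J (?\<tau> \<circ> t)" using swap by simp_all
    ultimately have "?J (?\<tau> \<circ> t) \<subset> ?J t" by blast
    then have "card (?J (?\<tau> \<circ> t)) < card (?J t)" by (intro psubset_card_mono) auto
    from less.hyps[OF this t'] obtain s where s: "s \<in> specht \<nu>"
      "\<forall>U. coef s U = coef (- polytabloid (m # \<nu>) t :: _ \<Rightarrow>\<^sub>0 'k) (?X # U)" unfolding e by blast
    have "- s \<in> specht \<nu>" using fvs.subspace_neg[OF subspace_specht s(1)] .
    then show ?thesis using s(2) by (intro bexI[of _ "- s"]) simp_all
  next
    case top
    have "inj_on (\<lambda>j. t (0, j)) {..<m}"
      using tableauxD(1)[OF t] by (auto simp: inj_on_def)
    then have "card ((\<lambda>j. t (0, j)) ` {..<m}) = card ?X" by (simp add: card_image)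
    moreover have "(\<lambda>j. t (0, j)) ` {..<m} \<subseteq> ?X" using top by auto
    ultimately have row: "(\<lambda>j. t (0, j)) ` {..<m} = ?X" by (intro card_subset_eq) auto
    show ?thesis
      using lower_rows_tableaux[OF t row] coef_polytabloid_same_top[OF t row \<nu>, where ?'a='k]
      by (intro bexI[of _ "polytabloid \<nu> (lower_rows t)"]) (auto intro: polytabloid_in_specht)
  qed
qed

lemma restrict_top:
  assumes \<nu>: "\<And>i j. (i, j) \<in> cells \<nu> \<Longrightarrow> j < m" and u: "(u :: _ \<Rightarrow>\<^sub>0 'k::field) \<in> specht (m # \<nu>)"
  shows "\<exists>s\<in>specht \<nu>. \<forall>U. coef s U = coef u ({sum_list \<nu>..<sum_list \<nu> + m} # U)"
  using u
proof (induction rule: specht_induct)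
  case zero
  then show ?case by (intro bexI[of _ 0]) (simp_all add: specht_0)
next
  case (add u v)
  then obtain s s' where "s \<in> specht \<nu>" "\<forall>U. coef s U = coef u ({sum_list \<nu>..<sum_list \<nu> + m} # U)"
    "s' \<in> specht \<nu>" "\<forall>U. coef s' U = coef v ({sum_list \<nu>..<sum_list \<nu> + m} # U)" by blast
  then show ?case by (intro bexI[of _ "s + s'"]) (simp_all add: lookup_add specht_add)
next
  case (scale c u)
  then obtain s where "s \<in> specht \<nu>" "\<forall>U. coef s U = coef u ({sum_list \<nu>..<sum_list \<nu> + m} # U)"
    by blast
  then show ?case by (intro bexI[of _ "fscale c s"]) (simp_all add: lookup_fscale specht_scale)
qed (rule restrict_top_polytabloid, rule \<nu>)

text \<open>\<open>U\<close> consists of sets of positions, not of letters: a word \<open>v\<close>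
  without repetitions turns a tabloid of shape \<open>\<nu>\<close> into the lower rows of one of
  shape \<open>m # \<nu>\<close>.\<close>

definition fill :: "nat \<Rightarrow> nat list \<Rightarrow> nat set list \<Rightarrow> nat set list" where
  "fill n v U = ({..<n} - set v) # map ((`) ((!) v)) U"

text \<open>A permutation \<open>\<beta>\<close> with \<open>\<beta> i = v ! i\<close> for
  \<open>i < sum_list \<nu>\<close> transports the general set of lower letters to the standard one
  of \<open>restrict_top\<close>.\<close>

lemma restrict_word:
  assumes \<nu>: "\<And>i j. (i, j) \<in> cells \<nu> \<Longrightarrow> j < m" and u: "(u :: _ \<Rightarrow>\<^sub>0 'k::field) \<in> specht (m # \<nu>)"
    and n: "n = m + sum_list \<nu>" and v: "v \<in> words n (sum_list \<nu>)" "distinct v"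
  shows "\<exists>s\<in>specht \<nu>. \<forall>U. \<Union>(set U) \<subseteq> {..<sum_list \<nu>} \<longrightarrow> coef s U = coef u (fill n v U)"
proof -
  let ?p = "sum_list \<nu>"
  have len: "length v = ?p" and sv: "set v \<subseteq> {..<n}" using v by (auto simp: words_def)
  have "(!) v ` {..<?p} \<subseteq> {..<n}" using subsetD[OF sv nth_mem] len by auto
  moreover have "inj_on ((!) v) {..<?p}" using v(2) len by (simp add: inj_on_def nth_eq_iff_index_eq)
  moreover have "{..<?p} \<subseteq> {..<n}" using n by auto
  ultimately obtain \<beta> where \<beta>: "\<beta> permutes {..<n}" "\<And>x. x \<in> {..<?p} \<Longrightarrow> \<beta> x = v ! x"
    using extend_to_permutation[of "{..<n}" "{..<?p}" "(!) v"] by blast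
  have im: "\<beta> ` A = (!) v ` A" if "A \<subseteq> {..<?p}" for A using that \<beta>(2) by (intro image_cong) auto
  have "\<beta> ` {?p..<n} = \<beta> ` ({..<n} - {..<?p})" using n by (intro arg_cong[of _ _ "(`) \<beta>"]) auto
  also have "\<dots> = {..<n} - set v"
  proof -
    have "set v = (!) v ` {..<?p}" by (auto simp: set_conv_nth len)
    then show ?thesis
      using permutes_image[OF \<beta>(1)] im[of "{..<?p}"] by (simp only: image_set_diff[OF permutes_inj[OF \<beta>(1)]] order_refl)
  qed
  finally have top: "\<beta> ` {?p..<n} = {..<n} - set v" .
  have "bij \<beta>" "bij (invf \<beta>)" by (simp_all add: permutes_bij[OF \<beta>(1)] permutes_bij[OF permutes_inv[OF \<beta>(1)]])
  moreover have "invf \<beta> permutes {..<sum_list (m # \<nu>)}" using permutes_inv[OF \<beta>(1)] n by simp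
  then have "specht_perm (invf \<beta>) u \<in> specht (m # \<nu>)" using u by (rule specht_perm_specht)
  then have "\<exists>s\<in>specht \<nu>. \<forall>U. coef s U = coef (specht_perm (invf \<beta>) u) ({?p..<?p + m} # U)"
    by (rule restrict_top[rotated]) (rule \<nu>)
  then obtain s where s: "s \<in> specht \<nu>"
    "\<And>U. coef s U = coef (specht_perm (invf \<beta>) u) ({?p..<?p + m} # U)" by blast
  have "coef s U = coef u (fill n v U)" if "\<Union>(set U) \<subseteq> {..<?p}" for U
  proof -
    have "map ((`) \<beta>) U = map ((`) ((!) v)) U" using that by (intro map_cong refl im) blast
    moreover have "coef s U = coef u (\<beta> ` {?p..<n} # map ((`) \<beta>) U)"
      using n by (simp add: s(2) coef_specht_perm \<open>bij (invf \<beta>)\<close> permutes_inv_inv[OF \<beta>(1)] add.commute)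
    ultimately show ?thesis by (simp only: fill_def top)
  qed
  then show ?thesis using s(1) by blast
qed

section \<open>Nondegeneracy of the invariant form\<close>

definition pairing :: "nat list \<Rightarrow> (nat set list \<Rightarrow>\<^sub>0 'k::field) \<Rightarrow> (nat set list \<Rightarrow>\<^sub>0 'k) \<Rightarrow> 'k" where
  "pairing \<nu> s u = (\<Sum>U\<in>tabloids \<nu>. coef s U * coef u U)"

lemma pairing_commute: "pairing \<nu> s u = pairing \<nu> u s"
  by (simp add: pairing_def mult.commute)

lemma pairing_linear:
  "pairing \<nu> (s + s') u = pairing \<nu> s u + pairing \<nu> s' u"
  "pairing \<nu> s (u + u') = pairing \<nu> s u + pairing \<nu> s u'"
  "pairing \<nu> (fscale c s) u = c * pairing \<nu> s u"
  "pairing \<nu> s (fscale c u) = c * pairing \<nu> s u"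
  "pairing \<nu> 0 u = 0" "pairing \<nu> (\<Sum>i\<in>I. f i) u = (\<Sum>i\<in>I. pairing \<nu> (f i) u)"
proof -
  show sum: "pairing \<nu> (s + s') u = pairing \<nu> s u + pairing \<nu> s' u" for s s' u :: "_ \<Rightarrow>\<^sub>0 'a"
    by (simp add: pairing_def lookup_add algebra_simps sum.distrib)
  show "pairing \<nu> s (u + u') = pairing \<nu> s u + pairing \<nu> s u'"
    by (simp add: pairing_def lookup_add algebra_simps sum.distrib)
  show "pairing \<nu> (fscale c s) u = c * pairing \<nu> s u" "pairing \<nu> s (fscale c u) = c * pairing \<nu> s u"
    by (simp_all add: pairing_def lookup_fscale sum_distrib_left algebra_simps)
  show z: "pairing \<nu> 0 u = 0" by (simp add: pairing_def)
  show "pairing \<nu> (\<Sum>i\<in>I. f i) u = (\<Sum>i\<in>I. pairing \<nu> (f i) u)"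
    by (induction I rule: infinite_finite_induct) (simp_all add: sum z)
qed

text \<open>The field is a vector space over the rationals in which \<open>{c}\<close> is
  independent, so it extends to a basis. The field need not be orderable; positivity arguments
  become possible after applying such a functional.\<close>

lemma ex_rat_functional:
  fixes c :: "'k::field_char_0"
  assumes "c \<noteq> 0"
  obtains l :: "'k \<Rightarrow> rat" where "\<And>x y. l (x + y) = l x + l y" "\<And>q x. l (of_rat q * x) = q * l x"
    "l c = 1"
proof -
  interpret V: vector_space "\<lambda>(q::rat) (x::'k). of_rat q * x"
    by unfold_locales (simp_all add: algebra_simps of_rat_add of_rat_mult)
  interpret Q: vector_space "(*) :: rat \<Rightarrow> rat \<Rightarrow> rat"
    by unfold_locales (simp_all add: algebra_simps)
  interpret VQ: vector_space_pair "\<lambda>(q::rat) (x::'k). of_rat q * x" "(*) :: rat \<Rightarrow> rat \<Rightarrow> rat" ..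
  have "V.independent {c}" using assms by simp
  from VQ.linear_independent_extend[OF this, of "\<lambda>_. 1"]
  obtain l where l: "Vector_Spaces.linear (\<lambda>(q::rat) (x::'k). of_rat q * x) (*) l" "l c = 1" by auto
  show ?thesis
    using that[of l] l VQ.linear_add[OF l(1)] VQ.linear_scale[OF l(1)] by auto
qed

text \<open>Over \<open>\<rat>\<close> the form is positive definite on the whole permutation module. Polytabloids have
  integer coefficients, so a rational functional applied to all coefficients reduces the general
  case to that one.\<close>

lemma pairing_nondegenerate:
  fixes s :: "nat set list \<Rightarrow>\<^sub>0 'k::field_char_0"
  assumes s: "s \<in> specht \<nu>" and orth: "\<And>t. t \<in> tableaux \<nu> \<Longrightarrow> pairing \<nu> s (polytabloid \<nu> t) = 0"
  shows "s = 0"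
proof (rule ccontr)
  assume "s \<noteq> 0"
  then obtain U0 where "coef s U0 \<noteq> 0" by (metis lookup_zero poly_mapping_eqI)
  from ex_rat_functional[OF this] obtain l :: "'k \<Rightarrow> rat" where
    l: "\<And>x y. l (x + y) = l x + l y" "\<And>q x. l (of_rat q * x) = q * l x" "l (coef s U0) = 1" by blast
  have l0: "l 0 = 0" using l(2)[of 0 0] by simp
  have lsum: "l (\<Sum>i\<in>I. f i) = (\<Sum>i\<in>I. l (f i))" for I and f :: "'x \<Rightarrow> 'k"
    by (induction I rule: infinite_finite_induct) (simp_all add: l0 l)
  define z where "z t U = (\<Sum>\<sigma>\<in>column_stabilizer \<nu> t. if tabloid \<nu> (\<sigma> \<circ> t) = U then sign \<sigma> else 0)" for t U
  have z: "coef (polytabloid \<nu> t :: _ \<Rightarrow>\<^sub>0 'k) U = of_rat (of_int (z t U))" for t U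
    unfolding z_def coef_polytabloid by (simp only: of_rat_of_int_eq)
  obtain A c where A: "finite A" "A \<subseteq> polytabloid \<nu> ` tableaux \<nu>" "s = (\<Sum>e\<in>A. fscale (c e) e)"
    using s unfolding specht_def by (auto simp: fvs.span_explicit)
  then have "\<forall>e\<in>A. \<exists>t\<in>tableaux \<nu>. e = polytabloid \<nu> t" by auto
  then obtain \<tau> where \<tau>: "\<And>e. e \<in> A \<Longrightarrow> \<tau> e \<in> tableaux \<nu>" "\<And>e. e \<in> A \<Longrightarrow> e = polytabloid \<nu> (\<tau> e)"
    by metis
  have eU: "coef e U = of_rat (of_int (z (\<tau> e) U))" if "e \<in> A" for e U
    using z[of "\<tau> e" U] \<tau>(2)[OF that] by simp
  have ls: "l (coef s U) = (\<Sum>e\<in>A. of_int (z (\<tau> e) U) * l (c e))" for U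
  proof -
    have "coef s U = (\<Sum>e\<in>A. of_rat (of_int (z (\<tau> e) U)) * c e)"
      unfolding A(3) lookup_sum lookup_fscale by (intro sum.cong) (simp_all only: eU mult.commute)
    then show ?thesis by (simp only: lsum l(2))
  qed
  have zero: "(\<Sum>U\<in>tabloids \<nu>. of_int (z (\<tau> e) U) * l (coef s U)) = 0" if "e \<in> A" for e
  proof -
    have "(\<Sum>U\<in>tabloids \<nu>. of_int (z (\<tau> e) U) * l (coef s U)) =
        l (\<Sum>U\<in>tabloids \<nu>. of_rat (of_int (z (\<tau> e) U)) * coef s U)" by (simp only: lsum l(2))
    also have "(\<Sum>U\<in>tabloids \<nu>. of_rat (of_int (z (\<tau> e) U)) * coef s U) = pairing \<nu> s (polytabloid \<nu> (\<tau> e))"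
      unfolding pairing_def by (intro sum.cong) (simp_all only: z mult.commute)
    finally show ?thesis using orth[OF \<tau>(1)[OF that]] l0 by simp
  qed
  \<comment> \<open>The rational vector with entries \<open>l (coef s U)\<close> is a rational
    combination of the polytabloids in \<open>A\<close> by \<open>ls\<close>, and orthogonal to each
    of them by \<open>zero\<close>; expanding one factor shows that it is orthogonal to
    itself.\<close>
  have "(\<Sum>U\<in>tabloids \<nu>. l (coef s U) * l (coef s U)) =
      (\<Sum>U\<in>tabloids \<nu>. \<Sum>e\<in>A. l (c e) * (of_int (z (\<tau> e) U) * l (coef s U)))"
    by (subst ls) (simp add: sum_distrib_right sum_distrib_left algebra_simps)
  also have "\<dots> = (\<Sum>e\<in>A. l (c e) * (\<Sum>U\<in>tabloids \<nu>. of_int (z (\<tau> e) U) * l (coef s U)))"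
    by (subst sum.swap) (simp add: sum_distrib_left)
  also have "\<dots> = 0" using zero by simp
  finally have "\<forall>U\<in>tabloids \<nu>. l (coef s U) * l (coef s U) = 0"
    by (subst (asm) sum_nonneg_eq_0_iff) auto
  moreover have "U0 \<in> tabloids \<nu>" using coef_specht_outside[OF s, of U0] \<open>coef s U0 \<noteq> 0\<close> by blast
  ultimately show False using l(3) by simp
qed

text \<open>A tableau is a function on all pairs with arbitrary values outside the cells, so
  \<open>tableaux \<nu>\<close> is infinite. Cutting down to the cells shows that there are still
  only finitely many polytabloids.\<close>

lemma polytabloid_restrict: "polytabloid \<nu> (restrict t (cells \<nu>)) = polytabloid \<nu> t"
proof -
  have "tabloid \<nu> (\<sigma> \<circ> restrict t (cells \<nu>)) = tabloid \<nu> (\<sigma> \<circ> t)" for \<sigma>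
    by (auto simp: tabloid_def cells_def intro!: image_cong)
  moreover have "column_stabilizer \<nu> (restrict t (cells \<nu>)) = column_stabilizer \<nu> t"
    unfolding column_stabilizer_def by (intro Collect_cong conj_cong refl ball_cong) auto
  ultimately show ?thesis by (simp add: polytabloid_def)
qed

lemma finite_polytabloids: "finite (polytabloid \<nu> ` tableaux \<nu>)"
proof (rule finite_subset)
  show "polytabloid \<nu> ` tableaux \<nu> \<subseteq> polytabloid \<nu> ` (cells \<nu> \<rightarrow>\<^sub>E {..<sum_list \<nu>})"
  proof safe
    fix t assume t: "t \<in> tableaux \<nu>"
    have "restrict t (cells \<nu>) \<in> cells \<nu> \<rightarrow>\<^sub>E {..<sum_list \<nu>}" using tableauxD(2)[OF t] by auto
    then show "polytabloid \<nu> t \<in> polytabloid \<nu> ` (cells \<nu> \<rightarrow>\<^sub>E {..<sum_list \<nu>})"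
      using polytabloid_restrict by (metis image_eqI)
  qed
qed (simp add: finite_cells finite_PiE)

text \<open>By nondegeneracy the pairings with polytabloids have no common zero in the Specht module
  except \<open>0\<close>, so a coefficient is a combination of them.\<close>

lemma pairing_represents_coef:
  "\<exists>s\<in>specht \<nu>. \<forall>u\<in>specht \<nu>. coef u U = pairing \<nu> s (u :: _ \<Rightarrow>\<^sub>0 'k::field_char_0)"
proof -
  let ?E = "polytabloid \<nu> ` tableaux \<nu> :: (_ \<Rightarrow>\<^sub>0 'k) set"
  have "\<exists>a. \<forall>u\<in>specht \<nu>. coef u U = (\<Sum>e\<in>?E. a e * pairing \<nu> e u)"
  proof (rule functional_on_comb[OF finite_polytabloids subspace_specht functional_on_coef])
    show "functional_on (specht \<nu>) (pairing \<nu> e)" for e :: "_ \<Rightarrow>\<^sub>0 'k"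
      by (simp add: functional_on_def pairing_linear)
    fix u :: "_ \<Rightarrow>\<^sub>0 'k" assume u: "u \<in> specht \<nu>" "\<forall>e\<in>?E. pairing \<nu> e u = 0"
    then have "u = 0" by (intro pairing_nondegenerate[of u \<nu>]) (auto simp: pairing_commute)
    then show "coef u U = 0" by simp
  qed
  then obtain a where a: "\<forall>u\<in>specht \<nu>. coef u U = (\<Sum>e\<in>?E. a e * pairing \<nu> e u)" ..
  show ?thesis
    by (rule bexI[of _ "\<Sum>e\<in>?E. fscale (a e) e"])
      (use a in \<open>auto simp: pairing_linear intro!: specht_sum specht_scale polytabloid_in_specht\<close>)
qed

lemma specht_functional:
  assumes "functional_on (specht \<mu>) (f :: (_ \<Rightarrow>\<^sub>0 'a::field) \<Rightarrow> 'a)"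
  shows "\<exists>a. \<forall>u\<in>specht \<mu>. f u = (\<Sum>T\<in>tabloids \<mu>. a T * coef u T)"
proof (rule functional_on_comb[OF finite_tabloids subspace_specht assms functional_on_coef])
  fix u :: "_ \<Rightarrow>\<^sub>0 'a" assume "u \<in> specht \<mu>" "\<forall>T\<in>tabloids \<mu>. coef u T = 0"
  then have "coef u T = 0" for T by (cases "T \<in> tabloids \<mu>") (simp_all add: coef_specht_outside)
  then have "u = 0" by (intro poly_mapping_eqI) simp
  then show "f u = 0" using functional_onD(2)[OF assms specht_0, of 0] by simp
qed

section \<open>Diagrams\<close>

abbreviation label :: "nat list \<Rightarrow> nat list \<Rightarrow> nat + nat \<Rightarrow> nat" where
  "label v w \<equiv> case_sum ((!) v) ((!) w)"

lemma diagramsD: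
  assumes "x \<in> diagrams r s"
  shows "\<Union>x = {..<r} <+> {..<s}" "B \<in> x \<Longrightarrow> B' \<in> x \<Longrightarrow> q \<in> B \<Longrightarrow> q \<in> B' \<Longrightarrow> B = B'" "{} \<notin> x"
proof -
  have p: "partition_on ({..<r} <+> {..<s}) x" using assms by (simp add: diagrams_def)
  show "\<Union>x = {..<r} <+> {..<s}" "{} \<notin> x" using partition_onD1[OF p] partition_onD3[OF p] by simp_all
  show "B \<in> x \<Longrightarrow> B' \<in> x \<Longrightarrow> q \<in> B \<Longrightarrow> q \<in> B' \<Longrightarrow> B = B'"
    using partition_onD2[OF p] by (auto simp: disjoint_def)
qed

lemma diagrams_block:
  assumes "x \<in> diagrams r s" "q \<in> {..<r} <+> {..<s}"
  obtains B where "B \<in> x" "q \<in> B"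
  using assms diagramsD(1) by blast

lemma finite_diagrams [simp]: "finite (diagrams r s)"
proof (rule finite_subset)
  show "diagrams r s \<subseteq> Pow (Pow ({..<r} <+> {..<s}))"
    using diagramsD(1) by (metis PowI Sup_upper subsetI)
qed simp

lemma finite_prop_diagrams [simp]: "finite (prop_diagrams r s p)"
  by (simp add: prop_diagrams_def)

lemma finite_diagram:
  assumes "x \<in> diagrams r s"
  shows "finite x"
proof (rule finite_subset)
  show "x \<subseteq> Pow ({..<r} <+> {..<s})" using diagramsD(1)[OF assms] by (metis PowI Sup_upper subsetI)
qed simp

lemma finite_words [simp]: "finite (words n r)"
  using finite_lists_length_eq[of "{..<n}" r] by (simp add: words_def conj_commute)

lemma words_nth: "v \<in> words n r \<Longrightarrow> i < r \<Longrightarrow> v ! i < n"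
  unfolding words_def using nth_mem by blast

lemma words_length: "v \<in> words n r \<Longrightarrow> length v = r"
  by (simp add: words_def)

definition same_block :: "'a set set \<Rightarrow> 'a \<Rightarrow> 'a \<Rightarrow> bool" where
  "same_block x q q' \<longleftrightarrow> (\<exists>B\<in>x. q \<in> B \<and> q' \<in> B)"

lemma diagrams_eqI:
  assumes x: "x \<in> diagrams r s" and y: "y \<in> diagrams r s"
    and same: "\<And>q q'. q \<in> {..<r} <+> {..<s} \<Longrightarrow> q' \<in> {..<r} <+> {..<s} \<Longrightarrow> same_block x q q' \<longleftrightarrow> same_block y q q'"
  shows "x = y"
proof -
  have "x \<subseteq> y" if x: "x \<in> diagrams r s" and y: "y \<in> diagrams r s"
    and same: "\<And>q q'. q \<in> {..<r} <+> {..<s} \<Longrightarrow> q' \<in> {..<r} <+> {..<s} \<Longrightarrow> same_block x q q' \<longleftrightarrow> same_block y q q'"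
  for x y
  proof
    fix B assume B: "B \<in> x"
    then obtain q where q: "q \<in> B" using diagramsD(3)[OF x] by fastforce
    then have qQ: "q \<in> {..<r} <+> {..<s}" using B diagramsD(1)[OF x] by blast
    obtain B' where B': "B' \<in> y" "q \<in> B'" using diagrams_block[OF y qQ] .
    have "B = B'"
    proof (rule Set.set_eqI)
      fix q'
      have "q' \<in> B \<longleftrightarrow> q' \<in> {..<r} <+> {..<s} \<and> same_block x q q'"
        using diagramsD(1,2)[OF x] B q unfolding same_block_def by blast
      also have "\<dots> \<longleftrightarrow> q' \<in> {..<r} <+> {..<s} \<and> same_block y q q'" using same[OF qQ] by blast
      also have "\<dots> \<longleftrightarrow> q' \<in> B'"
        using diagramsD(1,2)[OF y] B' unfolding same_block_def by blast
      finally show "q' \<in> B \<longleftrightarrow> q' \<in> B'" .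
    qed
    then show "B \<in> y" using B' by simp
  qed
  from this[OF x y same] this[OF y x same[symmetric]] show ?thesis by blast
qed

lemma compatible_iff:
  "compatible x v w \<longleftrightarrow> (\<forall>q q'. same_block x q q' \<longrightarrow> label v w q = label v w q')"
  unfolding compatible_def same_block_def by blast

text \<open>Two letters suffice: the indicator of a block is a compatible labelling that separates
  it from all other points. A diagram is therefore determined by its compatible words, and
  identities between composites can be checked without computing the generated equivalence
  relation.\<close>

lemma same_block_iff_compatible:
  assumes x: "x \<in> diagrams r s" and q: "q \<in> {..<r} <+> {..<s}" "q' \<in> {..<r} <+> {..<s}"
  shows "same_block x q q' \<longleftrightarrow>
    (\<forall>v\<in>words 2 r. \<forall>w\<in>words 2 s. compatible x v w \<longrightarrow> label v w q = label v w q')"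
proof
  assume R: "\<forall>v\<in>words 2 r. \<forall>w\<in>words 2 s. compatible x v w \<longrightarrow> label v w q = label v w q'"
  obtain B where B: "B \<in> x" "q \<in> B" using diagrams_block[OF x q(1)] .
  let ?v = "map (\<lambda>i. of_bool (Inl i \<in> B)) [0..<r]" and ?w = "map (\<lambda>i. of_bool (Inr i \<in> B)) [0..<s]"
  have l: "label ?v ?w a = of_bool (a \<in> B)" if "a \<in> {..<r} <+> {..<s}" for a
    using that by (auto split: sum.splits)
  have "compatible x ?v ?w"
    unfolding compatible_def
  proof (intro ballI)
    fix B' k k' assume B': "B' \<in> x" "k \<in> B'" "k' \<in> B'"
    then have "k \<in> {..<r} <+> {..<s}" "k' \<in> {..<r} <+> {..<s}" using diagramsD(1)[OF x] by blast+
    moreover have "k \<in> B \<longleftrightarrow> k' \<in> B" using diagramsD(2)[OF x] B B' by blast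
    ultimately show "label ?v ?w k = label ?v ?w k'" by (simp only: l)
  qed
  moreover have "?v \<in> words 2 r" "?w \<in> words 2 s" by (auto simp: words_def)
  ultimately have "label ?v ?w q = label ?v ?w q'" using R by blast
  then have "q' \<in> B" using B(2) by (simp only: l[OF q(1)] l[OF q(2)]) (simp add: of_bool_def split: if_splits)
  then show "same_block x q q'" using B by (auto simp: same_block_def)
qed (auto simp: compatible_iff)

lemma diagrams_eqI_compatible:
  assumes "x \<in> diagrams r s" "y \<in> diagrams r s"
    and "\<And>v w. v \<in> words 2 r \<Longrightarrow> w \<in> words 2 s \<Longrightarrow> compatible x v w \<longleftrightarrow> compatible y v w"
  shows "x = y"
  by (rule diagrams_eqI[OF assms(1,2)])
    (simp add: same_block_iff_compatible[OF assms(1)] same_block_iff_compatible[OF assms(2)] assms(3))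

section \<open>Composition of diagrams\<close>

context
  fixes x y :: diagram and r s t :: nat
  assumes x: "x \<in> diagrams r s" and y: "y \<in> diagrams s t"
begin

private abbreviation "Q \<equiv> \<Union>(stacked_blocks x y)"
private definition "E = {(a, b). \<exists>B\<in>stacked_blocks x y. a \<in> B \<and> b \<in> B}"
private abbreviation "outer \<equiv> map_sum id Inr :: nat + nat \<Rightarrow> nat + nat + nat"
private definition label3 :: "nat list \<Rightarrow> nat list \<Rightarrow> nat list \<Rightarrow> nat + nat + nat \<Rightarrow> nat" where
  "label3 u v w = case_sum ((!) u) (label v w)"

private lemma label3_simps [simp]:
  "label3 u v w (map_sum id Inl a) = label u v a" "label3 u v w (Inr b) = label v w b"
  "label3 u v w (outer c) = label u w c" "label3 u v w (Inl i) = u ! i"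
  by (cases a; cases c; auto simp: label3_def)+

private lemma Q_iff: "Inl i \<in> Q \<longleftrightarrow> i < r" "Inr (Inl i) \<in> Q \<longleftrightarrow> i < s" "Inr (Inr i) \<in> Q \<longleftrightarrow> i < t"
proof -
  have "Q = map_sum id Inl ` ({..<r} <+> {..<s}) \<union> Inr ` ({..<s} <+> {..<t})"
    unfolding stacked_blocks_def diagramsD(1)[OF x, symmetric] diagramsD(1)[OF y, symmetric] by blast
  also have "\<dots> = Inl ` {..<r} \<union> (Inr \<circ> Inl) ` {..<s} \<union> (Inr \<circ> Inr) ` {..<t}"
    by (simp add: Plus_def image_Un image_image o_def Un_assoc)
  finally have Q: "Q = Inl ` {..<r} \<union> (Inr \<circ> Inl) ` {..<s} \<union> (Inr \<circ> Inr) ` {..<t}" .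
  show "Inl i \<in> Q \<longleftrightarrow> i < r" "Inr (Inl i) \<in> Q \<longleftrightarrow> i < s" "Inr (Inr i) \<in> Q \<longleftrightarrow> i < t"
    unfolding Q by auto
qed

private lemma classes_eq: "stacked_classes x y = Q // E\<^sup>+"
  by (simp add: stacked_classes_def E_def)

private lemma equiv_E: "equiv Q (E\<^sup>+)"
proof (rule equivI)
  have sub: "E \<subseteq> Q \<times> Q" by (auto simp: E_def)
  then show "E\<^sup>+ \<subseteq> Q \<times> Q" by (rule trancl_subset_Sigma)
  show "refl_on Q (E\<^sup>+)" using sub by (auto simp: refl_on_def E_def)
  show "sym (E\<^sup>+)" by (rule sym_trancl) (auto simp: sym_def E_def)
  show "trans (E\<^sup>+)" by simp
qed

private lemma finite_Q: "finite Q"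
proof (rule finite_subset)
  show "Q \<subseteq> {..<r} <+> ({..<s} <+> {..<t})"
  proof
    fix a assume "a \<in> Q"
    then show "a \<in> {..<r} <+> ({..<s} <+> {..<t})"
      by (cases a; cases "projr a") (auto simp: Q_iff simp del: Union_iff)
  qed
qed simp

private lemma classes:
  shows "\<Union>(stacked_classes x y) = Q" "finite (stacked_classes x y)" "{} \<notin> stacked_classes x y"
    "C \<in> stacked_classes x y \<Longrightarrow> C' \<in> stacked_classes x y \<Longrightarrow> a \<in> C \<Longrightarrow> a \<in> C' \<Longrightarrow> C = C'"
proof -
  show "\<Union>(stacked_classes x y) = Q" unfolding classes_eq by (rule Union_quotient[OF equiv_E])
  then show "finite (stacked_classes x y)" using finite_Q by (metis finite_UnionD)
  show "{} \<notin> stacked_classes x y"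
    unfolding classes_eq using in_quotient_imp_non_empty[OF equiv_E] by blast
  show "C \<in> stacked_classes x y \<Longrightarrow> C' \<in> stacked_classes x y \<Longrightarrow> a \<in> C \<Longrightarrow> a \<in> C' \<Longrightarrow> C = C'"
    unfolding classes_eq using quotient_disj[OF equiv_E] by blast
qed

private lemma constant_on_classes_iff:
  "(\<forall>B\<in>stacked_blocks x y. \<forall>a\<in>B. \<forall>b\<in>B. f a = f b) \<longleftrightarrow>
   (\<forall>C\<in>stacked_classes x y. \<forall>a\<in>C. \<forall>b\<in>C. f a = f b)" (is "?L \<longleftrightarrow> ?R")
proof
  assume ?L
  then have E: "f a = f b" if "(a, b) \<in> E" for a b using that by (auto simp: E_def)
  have "f a = f b" if "(a, b) \<in> E\<^sup>+" for a b
    using that by (induction rule: trancl_induct) (auto dest: E)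
  then show ?R
    unfolding classes_eq by (intro ballI) (simp add: in_quotient_imp_in_rel[OF equiv_E])
next
  assume R: ?R
  show ?L
  proof (intro ballI)
    fix B a b assume B: "B \<in> stacked_blocks x y" "a \<in> B" "b \<in> B"
    have "(a, b) \<in> E" "(a, a) \<in> E" "a \<in> Q" using B by (auto simp: E_def)
    then have "(a, b) \<in> E\<^sup>+" "(a, a) \<in> E\<^sup>+" "a \<in> Q" by (simp_all add: r_into_trancl' del: Union_iff)
    then have "E\<^sup>+ `` {a} \<in> stacked_classes x y" "a \<in> E\<^sup>+ `` {a}" "b \<in> E\<^sup>+ `` {a}"
      by (simp_all add: classes_eq quotientI del: Union_iff)
    then show "f a = f b" by (rule R[rule_format])
  qed
qed

private lemma compatible_both_iff:
  "compatible x u v \<and> compatible y v w \<longleftrightarrow>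
   (\<forall>C\<in>stacked_classes x y. \<forall>a\<in>C. \<forall>b\<in>C. label3 u v w a = label3 u v w b)"
  unfolding constant_on_classes_iff[symmetric] stacked_blocks_def compatible_def
  by (simp only: ball_Un ball_simps label3_simps)

private lemma compatible_dcomp_iff:
  "compatible (dcomp x y) u w \<longleftrightarrow> (\<forall>C\<in>stacked_classes x y. \<forall>a\<in>C. \<forall>b\<in>C.
     a \<in> range outer \<longrightarrow> b \<in> range outer \<longrightarrow> label3 u v w a = label3 u v w b)"
    (is "_ \<longleftrightarrow> ?R")
proof
  assume L: "compatible (dcomp x y) u w"
  show ?R
  proof (intro ballI impI)
    fix C a b assume C: "C \<in> stacked_classes x y" "a \<in> C" "b \<in> C" "a \<in> range outer" "b \<in> range outer"
    then obtain c d where cd: "a = outer c" "b = outer d" by blast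
    have "outer c \<in> C" "outer d \<in> C" using C(2,3) by (simp_all only: cd)
    then have mem: "c \<in> outer -` C" "d \<in> outer -` C" by (simp_all only: vimage_eq)
    have "outer -` C \<in> dcomp x y"
      unfolding dcomp_def using C(1) mem(1) by (intro DiffI imageI) blast+
    then have "label u w c = label u w d" using mem by (rule L[unfolded compatible_def, rule_format])
    then show "label3 u v w a = label3 u v w b" by (simp only: cd label3_simps)
  qed
next
  assume R: ?R
  show "compatible (dcomp x y) u w"
    unfolding compatible_def
  proof (intro ballI)
    fix B k l assume B: "B \<in> dcomp x y" "k \<in> B" "l \<in> B"
    from B(1) have "B \<in> (\<lambda>C. outer -` C) ` stacked_classes x y" unfolding dcomp_def by (rule DiffD1)
    then obtain C where C: "C \<in> stacked_classes x y" "B = outer -` C" by (rule imageE) (rule that)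
    have "outer k \<in> C" "outer l \<in> C" using B(2,3) by (simp_all only: C(2) vimage_eq)
    then have "label3 u v w (outer k) = label3 u v w (outer l)"
      by (intro R[rule_format, OF C(1)] rangeI)
    then show "label u w k = label u w l" by (simp only: label3_simps)
  qed
qed

private lemma outer_iff: "a \<in> range outer \<longleftrightarrow> a \<notin> range (Inr \<circ> Inl)"
proof -
  have 1: "Inl i \<in> range outer" "Inr (Inr i) \<in> range outer" for i
    using rangeI[of outer "Inl i"] rangeI[of outer "Inr i"] by simp_all
  have 2: "outer c \<noteq> Inr (Inl i)" for c i by (cases c) simp_all
  have 3: "Inr (Inl i) \<notin> range outer" for i
  proof
    assume "Inr (Inl i) \<in> range outer"
    then show False by (rule imageE) (metis 2)
  qed
  have 4: "Inr (Inl i) \<in> range (Inr \<circ> Inl)" for i by (rule range_eqI[of _ _ i]) simp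
  have 5: "Inl i \<notin> range (Inr \<circ> Inl)" "Inr (Inr i) \<notin> range (Inr \<circ> Inl)" for i by auto
  show ?thesis
  proof (cases a)
    case (Inl i)
    show ?thesis unfolding Inl using 1 5 by iprover
  next
    case (Inr b)
    show ?thesis
    proof (cases b)
      case (Inl i)
      show ?thesis unfolding \<open>a = Inr b\<close> Inl using 3 4 by iprover
    next
      case (Inr i)
      show ?thesis unfolding \<open>a = Inr b\<close> Inr using 1 5 by iprover
    qed
  qed
qed

lemma dcomp_in_diagrams: "dcomp x y \<in> diagrams r t"
proof -
  have "partition_on ({..<r} <+> {..<t}) (dcomp x y)"
  proof (rule partition_onI)
    have "\<Union>(dcomp x y) = outer -` \<Union>(stacked_classes x y)" by (auto simp: dcomp_def)
    also have "\<dots> = {..<r} <+> {..<t}"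
      unfolding classes(1)
    proof (rule Set.set_eqI)
      fix c :: "nat + nat"
      show "c \<in> outer -` Q \<longleftrightarrow> c \<in> {..<r} <+> {..<t}"
        by (cases c) (auto simp: Q_iff simp del: Union_iff)
    qed
    finally show "\<Union>(dcomp x y) = {..<r} <+> {..<t}" .
    show "disjnt p q" if "p \<in> dcomp x y" "q \<in> dcomp x y" "p \<noteq> q" for p q
      using that classes(4) unfolding dcomp_def disjnt_def by blast
  qed (auto simp: dcomp_def)
  then show ?thesis by (simp add: diagrams_def)
qed

text \<open>The labels of the middle row are forced except on the classes inside the middle row, where
  they can be chosen freely.\<close>

lemma card_compatible_middle:
  assumes u: "u \<in> words n r" and w: "w \<in> words n t"
  shows "card {v \<in> words n s. compatible x u v \<and> compatible y v w} =
    (if compatible (dcomp x y) u w then n ^ loops x y else 0)"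
proof (cases "compatible (dcomp x y) u w")
  case False
  have "compatible (dcomp x y) u w" if "compatible x u v" "compatible y v w" for v
  proof -
    have R: "\<forall>C\<in>stacked_classes x y. \<forall>a\<in>C. \<forall>b\<in>C. label3 u v w a = label3 u v w b"
      by (rule iffD1[OF compatible_both_iff]) (intro conjI that)
    show ?thesis
      by (rule iffD2[OF compatible_dcomp_iff[of u w v]]) (intro ballI impI; rule R[rule_format]; assumption)
  qed
  then have "{v \<in> words n s. compatible x u v \<and> compatible y v w} = {}" using False by blast
  then show ?thesis using False by simp
next
  case True
  let ?S = "stacked_classes x y"
  let ?M = "range (Inr \<circ> Inl) :: (nat + nat + nat) set"
  let ?V = "{v \<in> words n s. compatible x u v \<and> compatible y v w}"
  define L where "L = {C \<in> ?S. C \<subseteq> ?M}"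
  have finL: "finite L" using classes(2) by (simp add: L_def)
  \<comment> \<open>A class inside the middle row carries a free value. Any other class takes the
    label of one of its outer points; such a label does not depend on the middle word, whence the
    dummy \<open>[]\<close>.\<close>
  define val where "val g C = (if C \<in> L then g C else label3 u [] w (SOME c. c \<in> C \<and> c \<notin> ?M))"
    for g :: "(nat + nat + nat) set \<Rightarrow> nat" and C
  define cls where "cls i = (THE C. C \<in> ?S \<and> Inr (Inl i) \<in> C)" for i
  have cls: "cls i = C" if "C \<in> ?S" "Inr (Inl i) \<in> C" for i C
    unfolding cls_def using that classes(4) by (intro the_equality) auto
  have cls_mem: "cls i \<in> ?S" "Inr (Inl i) \<in> cls i" if "i < s" for i
  proof -
    have "Inr (Inl i) \<in> \<Union>?S" using that Q_iff(2) classes(1) by simp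
    then obtain C where "C \<in> ?S" "Inr (Inl i) \<in> C" by blast
    then show "cls i \<in> ?S" "Inr (Inl i) \<in> cls i" using cls by auto
  qed
  \<comment> \<open>\<open>F\<close> reads off the values on the free classes, and \<open>G\<close>
    rebuilds the middle word from them.\<close>
  define G where "G g = map (\<lambda>i. val g (cls i)) [0..<s]" for g
  define F where "F v = (\<lambda>C\<in>L. label3 u v w (SOME c. c \<in> C))" for v
  have const: "label3 u v w a = label3 u v w b" if "v \<in> ?V" "C \<in> ?S" "a \<in> C" "b \<in> C" for v C a b
  proof -
    have "\<forall>C\<in>?S. \<forall>a\<in>C. \<forall>b\<in>C. label3 u v w a = label3 u v w b"
      by (rule iffD1[OF compatible_both_iff]) (use that(1) in simp)
    then show ?thesis using that(2-4) by blast
  qed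
  have some: "(SOME c. c \<in> C) \<in> C" if "C \<in> ?S" for C
    using that classes(3) by (metis some_in_eq)
  have out: "(SOME c. c \<in> C \<and> c \<notin> ?M) \<in> C" "(SOME c. c \<in> C \<and> c \<notin> ?M) \<notin> ?M" if "C \<in> ?S - L" for C
  proof -
    from that have "\<exists>c. c \<in> C \<and> c \<notin> ?M" by (auto simp: L_def)
    from someI_ex[OF this]
    show "(SOME c. c \<in> C \<and> c \<notin> ?M) \<in> C" "(SOME c. c \<in> C \<and> c \<notin> ?M) \<notin> ?M" by blast+
  qed
  have lout: "label3 u v w c = label3 u v' w c" if "c \<notin> ?M" for c v v'
    using that unfolding outer_iff[symmetric] by auto
  have vS: "\<exists>i<s. c = Inr (Inl i)" if "C \<in> ?S" "c \<in> C" "c \<in> ?M" for c C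
    using that classes(1) Q_iff(2) by fastforce
  have "bij_betw F ?V (L \<rightarrow>\<^sub>E {..<n})"
  proof (rule bij_betw_byWitness[of _ G])
    show "\<forall>v\<in>?V. G (F v) = v"
    proof
      fix v assume v: "v \<in> ?V"
      show "G (F v) = v"
      proof (rule nth_equalityI)
        show "length (G (F v)) = length v" using v words_length[of v n s] by (simp add: G_def)
        fix i assume "i < length (G (F v))"
        then have i: "i < s" by (simp add: G_def)
        note C = cls_mem[OF i]
        have "val (F v) (cls i) = label3 u v w (Inr (Inl i))"
        proof (cases "cls i \<in> L")
          case True
          then show ?thesis using const[OF v C(1) some[OF C(1)] C(2)] by (simp add: val_def F_def)
        next
          case False
          then have "cls i \<in> ?S - L" using C by simp
          note o = out[OF this]
          show ?thesis using False const[OF v C(1) o(1) C(2)] lout[OF o(2), of v "[]"] by (simp add: val_def)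
        qed
        then show "G (F v) ! i = v ! i" using i by (simp add: G_def)
      qed
    qed
    show "\<forall>g\<in>L \<rightarrow>\<^sub>E {..<n}. F (G g) = g"
    proof
      fix g assume g: "g \<in> L \<rightarrow>\<^sub>E {..<n}"
      have "F (G g) C = g C" if C: "C \<in> L" for C
      proof -
        have CS: "C \<in> ?S" "C \<subseteq> ?M" using C by (auto simp: L_def)
        obtain i where i: "i < s" "(SOME c. c \<in> C) = Inr (Inl i)"
          using vS[OF CS(1) some[OF CS(1)]] CS(2) some[OF CS(1)] by auto
        then have "cls i = C" using cls[OF CS(1)] some[OF CS(1)] by simp
        then show ?thesis using i C by (simp add: F_def G_def val_def)
      qed
      moreover have "F (G g) C = g C" if "C \<notin> L" for C
        using that PiE_arb[OF g that] by (simp add: F_def)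
      ultimately show "F (G g) = g" by (intro ext) blast
    qed
    show "F ` ?V \<subseteq> L \<rightarrow>\<^sub>E {..<n}"
    proof (rule image_subsetI)
      fix v assume "v \<in> ?V"
      then have v: "v \<in> words n s" by simp
      have "F v C < n" if C: "C \<in> L" for C
      proof -
        have CS: "C \<in> ?S" "C \<subseteq> ?M" using C by (auto simp: L_def)
        obtain i where i: "i < s" "(SOME c. c \<in> C) = Inr (Inl i)"
          using vS[OF CS(1) some[OF CS(1)]] CS(2) some[OF CS(1)] by auto
        then show ?thesis using words_nth[OF v] C by (simp add: F_def)
      qed
      then show "F v \<in> L \<rightarrow>\<^sub>E {..<n}" by (intro PiE_I) (simp_all add: F_def)
    qed
    show "G ` (L \<rightarrow>\<^sub>E {..<n}) \<subseteq> ?V"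
    proof
      fix v assume "v \<in> G ` (L \<rightarrow>\<^sub>E {..<n})"
      then obtain g where g: "g \<in> L \<rightarrow>\<^sub>E {..<n}" "v = G g" by blast
      have lt: "val g C < n" if C: "C \<in> ?S" for C
      proof (cases "C \<in> L")
        case False
        then have "C \<in> ?S - L" using C by simp
        note o = out[OF this]
        define c where "c = (SOME c. c \<in> C \<and> c \<notin> ?M)"
        have "c \<in> Q" "c \<in> range outer" using o C classes(1) outer_iff unfolding c_def by blast+
        then obtain d where "c = outer d" "outer d \<in> Q" by blast
        then have "label3 u [] w c < n"
          using words_nth[OF u] words_nth[OF w] by (cases d) (auto simp: Q_iff label3_def simp del: Union_iff)
        then show ?thesis using False by (simp add: val_def c_def)
      qed (use g in \<open>auto simp: val_def\<close>)
      have "label3 u v w a = val g C" if C: "C \<in> ?S" "a \<in> C" for C a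
      proof (cases "a \<in> ?M")
        case True
        then obtain i where i: "i < s" "a = Inr (Inl i)" using vS C by blast
        then have "cls i = C" using cls C by simp
        then show ?thesis using i g by (simp add: G_def)
      next
        case False
        then have CL: "C \<in> ?S - L" using C by (auto simp: L_def)
        note o = out[OF CL]
        have "label3 u v w a = label3 u v w (SOME c. c \<in> C \<and> c \<notin> ?M)"
          using compatible_dcomp_iff[of u w v, THEN iffD1, OF \<open>compatible (dcomp x y) u w\<close>] C(1) C(2) o False
          unfolding outer_iff by blast
        then show ?thesis using CL lout[OF o(2), of v "[]"] by (simp add: val_def)
      qed
      then have "compatible x u v \<and> compatible y v w" unfolding compatible_both_iff by simp
      moreover have "v \<in> words n s" using g(2) lt cls_mem by (auto simp: words_def G_def)
      ultimately show "v \<in> ?V" by simp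
    qed
  qed
  then have "card ?V = card (L \<rightarrow>\<^sub>E {..<n})" by (rule bij_betw_same_card)
  also have "\<dots> = n ^ card L" using finL by (simp add: card_PiE)
  finally show ?thesis using True by (simp add: loops_def L_def)
qed

end

section \<open>The action of diagrams on tensors\<close>

lemma free_on_induct [consumes 1, case_names zero add scale basis]:
  assumes "f \<in> free_on X" "P 0" "\<And>f g. f \<in> free_on X \<Longrightarrow> g \<in> free_on X \<Longrightarrow> P f \<Longrightarrow> P g \<Longrightarrow> P (f + g)"
    "\<And>c f. f \<in> free_on X \<Longrightarrow> P f \<Longrightarrow> P (fscale c f)" "\<And>x. x \<in> X \<Longrightarrow> P (basis x)"
  shows "P f"
proof -
  have k: "Poly_Mapping.keys f \<subseteq> X" using assms(1) by (simp add: free_on_def)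
  have "(\<Sum>x\<in>A. fscale (coef f x) (basis x)) \<in> free_on X \<and> P (\<Sum>x\<in>A. fscale (coef f x) (basis x))"
    if "finite A" "A \<subseteq> X" for A
    using that
  proof (induction A rule: finite_induct)
    case (insert x A)
    then have b: "fscale (coef f x) (basis x) \<in> free_on X" "P (fscale (coef f x) (basis x))"
      by (auto intro!: free_on_fscale assms(4,5))
    with insert show ?case by (auto intro!: free_on_add assms(3))
  qed (simp add: assms(2))
  from this[OF _ k] show ?thesis
    using poly_mapping_eq_sum[of "Poly_Mapping.keys f" f] by simp
qed

lemma lin_ext_fun_add: "lin_ext (\<lambda>x. g x + h x) f = lin_ext g f + lin_ext h f"
  by (simp add: lin_ext_def fvs.scale_right_distrib sum.distrib)

lemma lin_ext_fun_fscale: "lin_ext (\<lambda>x. fscale c (g x)) f = fscale c (lin_ext g f)"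
  by (simp add: lin_ext_def fvs.scale_sum_right mult.commute)

lemma lin_ext_fun_zero: "lin_ext (\<lambda>x. 0) f = 0"
  by (simp add: lin_ext_def)

lemma ev_linear:
  "ev n s (a + b) u = ev n s a u + ev n s b u"
  "ev n s (fscale c a) u = fscale c (ev n s a u)"
  "ev n s 0 u = 0"
  "ev n s a (u + v) = ev n s a u + ev n s a v"
  "ev n s a (fscale c u) = fscale c (ev n s a u)"
  "ev n s a 0 = 0"
  by (simp_all add: ev_def lin_ext_add lin_ext_fscale lin_ext_fun_add lin_ext_fun_fscale lin_ext_fun_zero)

lemma ev_basis:
  "ev n s (basis x) (basis v) = (\<Sum>w\<in>words n s. if compatible x v w then basis w else 0)"
  by (simp add: ev_def)

lemma coef_ev_basis:
  "coef (ev n s (basis x) (basis v) :: _ \<Rightarrow>\<^sub>0 'k::field) w =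
     (if w \<in> words n s \<and> compatible x v w then 1 else 0)"
proof -
  have "coef (ev n s (basis x) (basis v) :: _ \<Rightarrow>\<^sub>0 'k) w =
    (\<Sum>w'\<in>words n s. if w' = w then (if compatible x v w then 1 else 0) else 0)"
    unfolding ev_basis lookup_sum by (intro sum.cong) (auto simp: lookup_single when_def)
  then show ?thesis by (simp add: sum.delta)
qed

lemma coef_ev:
  assumes "u \<in> free_on (words n r)"
  shows "coef (ev n s (basis x) u) w =
    (if w \<in> words n s then \<Sum>v\<in>words n r. if compatible x v w then coef u v else 0 else 0)"
proof -
  have k: "Poly_Mapping.keys u \<subseteq> words n r" using assms by (simp add: free_on_def)
  have "coef (ev n s (basis x) u) w = (\<Sum>v\<in>words n r. coef u v * coef (ev n s (basis x) (basis v)) w)"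
    by (simp add: ev_def coef_lin_ext[OF finite_words k])
  then show ?thesis by (auto simp: coef_ev_basis intro!: sum.cong)
qed

lemma ev_in_free_on: "ev n s a u \<in> free_on (words n s)"
  unfolding ev_def
  by (intro lin_ext_in_subspace subspace_free_on free_on_sum) auto

lemma dmult_linear:
  "dmult d (a + a') b = dmult d a b + dmult d a' b"
  "dmult d (fscale c a) b = fscale c (dmult d a b)"
  "dmult d 0 b = 0"
  "dmult d a (b + b') = dmult d a b + dmult d a b'"
  "dmult d a (fscale c b) = fscale c (dmult d a b)"
  "dmult d a 0 = 0"
  by (simp_all add: dmult_def lin_ext_add lin_ext_fscale lin_ext_fun_add lin_ext_fun_fscale lin_ext_fun_zero)

lemma dmult_basis: "dmult d (basis x) (basis y) = fscale (d ^ loops x y) (basis (dcomp x y))"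
  by (simp add: dmult_def)

lemma dmult_in_free_on:
  assumes "a \<in> free_on (diagrams r s)" "b \<in> free_on (diagrams s t)"
  shows "dmult d a b \<in> free_on (diagrams r t)"
  unfolding dmult_def
  using assms by (intro lin_ext_in_subspace subspace_free_on free_on_fscale)
    (auto simp: free_on_def intro!: dcomp_in_diagrams)

text \<open>Each coefficient of the composite operator counts the middle words compatible with both
  diagrams. This is where the parameter becomes \<open>n\<close>: every class inside the middle row
  contributes a factor \<open>n\<close>.\<close>

lemma ev_dmult:
  assumes a: "a \<in> free_on (diagrams r s)" and b: "b \<in> free_on (diagrams s t)"
    and u: "u \<in> free_on (words n r)"
  shows "ev n t (dmult (of_nat n :: 'k::field) a b) u = ev n t b (ev n s a u)"
  using a
proof (induction rule: free_on_induct)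
  case (basis x)
  note x = basis
  show ?case
    using b
  proof (induction rule: free_on_induct)
    case (basis y)
    note y = basis
    show ?case
      using u
    proof (induction rule: free_on_induct)
      case (basis v)
      show ?case
      proof (rule poly_mapping_eqI)
        fix w
        have "coef (ev n t (basis y) (ev n s (basis x) (basis v :: _ \<Rightarrow>\<^sub>0 'k))) w =
           of_nat (card {v' \<in> words n s. compatible x v v' \<and> compatible y v' w})" if w: "w \<in> words n t"
        proof -
          have "coef (ev n t (basis y) (ev n s (basis x) (basis v :: _ \<Rightarrow>\<^sub>0 'k))) w =
            (\<Sum>v'\<in>words n s. if compatible y v' w then coef (ev n s (basis x) (basis v)) v' else 0)"
            using w by (simp add: coef_ev[OF ev_in_free_on])
          also have "\<dots> = (\<Sum>v'\<in>words n s. if compatible x v v' \<and> compatible y v' w then 1 else 0)"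
            by (intro sum.cong) (simp_all add: coef_ev_basis)
          finally show ?thesis by (simp add: sum.If_cases Int_def)
        qed
        moreover have "coef (ev n t (basis y) (ev n s (basis x) (basis v :: _ \<Rightarrow>\<^sub>0 'k))) w = 0" if "w \<notin> words n t"
          using that by (intro free_on_coef[OF ev_in_free_on])
        moreover have "coef (ev n t (dmult (of_nat n) (basis x) (basis y)) (basis v :: _ \<Rightarrow>\<^sub>0 'k)) w =
          (if w \<in> words n t then if compatible (dcomp x y) v w then of_nat n ^ loops x y else 0 else 0)"
          by (simp add: dmult_basis ev_linear lookup_fscale coef_ev_basis)
        ultimately show "coef (ev n t (dmult (of_nat n) (basis x) (basis y)) (basis v :: _ \<Rightarrow>\<^sub>0 'k)) w =
          coef (ev n t (basis y) (ev n s (basis x) (basis v))) w"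
          using card_compatible_middle[OF x y basis, of w] by auto
      qed
    qed (simp_all add: ev_linear)
  qed (simp_all add: ev_linear dmult_linear)
qed (simp_all add: ev_linear dmult_linear)

section \<open>Kernel diagrams and permutation diagrams\<close>

text \<open>The coarsest diagram with which \<open>v\<close> and \<open>w\<close> are compatible:
  its blocks correspond to the letters that occur in the two words.\<close>

definition kernel_diagram :: "nat list \<Rightarrow> nat list \<Rightarrow> diagram" where
  "kernel_diagram v w =
     (\<lambda>c. {q \<in> {..<length v} <+> {..<length w}. label v w q = c}) ` (set v \<union> set w)"

lemma same_block_kernel:
  "same_block (kernel_diagram v w) q q' \<longleftrightarrow> q \<in> {..<length v} <+> {..<length w} \<and>
     q' \<in> {..<length v} <+> {..<length w} \<and> label v w q = label v w q'"
proof -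
  have "label v w q \<in> set v \<union> set w" if "q \<in> {..<length v} <+> {..<length w}"
    using that by auto
  then show ?thesis by (auto simp: same_block_def kernel_diagram_def)
qed

lemma kernel_diagram_in_diagrams:
  "kernel_diagram v w \<in> diagrams (length v) (length w)"
proof -
  have l: "label v w q \<in> set v \<union> set w" if "q \<in> {..<length v} <+> {..<length w}" for q
    using that by auto
  have "partition_on ({..<length v} <+> {..<length w}) (kernel_diagram v w)"
  proof (rule partition_onI)
    show "\<Union>(kernel_diagram v w) = {..<length v} <+> {..<length w}"
    proof
      show "\<Union>(kernel_diagram v w) \<subseteq> {..<length v} <+> {..<length w}"
        unfolding kernel_diagram_def by blast
      show "{..<length v} <+> {..<length w} \<subseteq> \<Union>(kernel_diagram v w)"
      proof
        fix q :: "nat + nat" assume q: "q \<in> {..<length v} <+> {..<length w}"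
        have "{q' \<in> {..<length v} <+> {..<length w}. label v w q' = label v w q} \<in> kernel_diagram v w"
          unfolding kernel_diagram_def by (intro imageI l q)
        then show "q \<in> \<Union>(kernel_diagram v w)" by (rule UnionI) (intro CollectI conjI q refl)
      qed
    qed
    show "disjnt p q" if "p \<in> kernel_diagram v w" "q \<in> kernel_diagram v w" "p \<noteq> q" for p q
      using that by (auto simp: kernel_diagram_def disjnt_def)
    have "p \<noteq> {}" if p: "p \<in> kernel_diagram v w" for p
    proof -
      obtain c where c: "c \<in> set v \<union> set w" "p = {q \<in> {..<length v} <+> {..<length w}. label v w q = c}"
        using p by (auto simp: kernel_diagram_def)
      from c(1) consider i where "i < length v" "c = v ! i" | i where "i < length w" "c = w ! i"
        by (auto simp: in_set_conv_nth)
      then show ?thesis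
      proof cases
        case (1 i)
        then have "Inl i \<in> p" unfolding c(2) by auto
        then show ?thesis by blast
      next
        case (2 i)
        then have "Inr i \<in> p" unfolding c(2) by auto
        then show ?thesis by blast
      qed
    qed
    then show "{} \<notin> kernel_diagram v w" by blast
  qed
  then show ?thesis by (simp add: diagrams_def)
qed

text \<open>The map \<open>g\<close> is read off one representative point for each letter. It need
  not be injective: compatible words may merge letters of \<open>v\<close> and \<open>w\<close>,
  which is why later arguments order words by their number of letters.\<close>

lemma compatible_kernel_diagram:
  assumes "length v' = length v" "length w' = length w"
  shows "compatible (kernel_diagram v w) v' w' \<longleftrightarrow> (\<exists>g. v' = map g v \<and> w' = map g w)"
proof
  let ?Q = "{..<length v} <+> {..<length w}"
  assume c: "compatible (kernel_diagram v w) v' w'"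
  define g where "g c = label v' w' (SOME q. q \<in> ?Q \<and> label v w q = c)" for c
  have g: "g (label v w q) = label v' w' q" if q: "q \<in> ?Q" for q
  proof -
    define q' where "q' = (SOME q'. q' \<in> ?Q \<and> label v w q' = label v w q)"
    have "q' \<in> ?Q \<and> label v w q' = label v w q"
      unfolding q'_def by (rule someI[of _ q]) (intro conjI q refl)
    then have "same_block (kernel_diagram v w) q' q"
      unfolding same_block_kernel using q by blast
    then have "label v' w' q' = label v' w' q"
      by (rule c[unfolded compatible_iff, rule_format])
    then show ?thesis by (simp only: g_def q'_def)
  qed
  have "g (v ! i) = v' ! i" if "i < length v" for i using g[OF InlI, of i] that by simp
  then have "v' = map g v" using assms by (intro nth_equalityI) simp_all
  moreover have "g (w ! i) = w' ! i" if "i < length w" for i using g[OF InrI, of i] that by simp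
  then have "w' = map g w" using assms by (intro nth_equalityI) simp_all
  ultimately show "\<exists>g. v' = map g v \<and> w' = map g w" by blast
next
  assume "\<exists>g. v' = map g v \<and> w' = map g w"
  then obtain g where g: "v' = map g v" "w' = map g w" by blast
  have "label v' w' q = g (label v w q)" if "q \<in> {..<length v} <+> {..<length w}" for q
    using that by (auto simp: g)
  then show "compatible (kernel_diagram v w) v' w'" unfolding compatible_iff same_block_kernel by simp
qed

lemma eq_kernel_diagramI:
  assumes y: "y \<in> diagrams (length v) (length w)"
    and same: "\<And>q q'. q \<in> {..<length v} <+> {..<length w} \<Longrightarrow> q' \<in> {..<length v} <+> {..<length w} \<Longrightarrow>
      label v w q = label v w q' \<longleftrightarrow> same_block y q q'"
  shows "y = kernel_diagram v w"
  by (rule diagrams_eqI[OF y kernel_diagram_in_diagrams]) (simp add: same_block_kernel same)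

section \<open>Permutation diagrams and their composites\<close>

lemma perm_diagram_in_diagrams:
  assumes "\<sigma> permutes {..<p}"
  shows "perm_diagram p \<sigma> \<in> diagrams p p"
proof -
  have "partition_on ({..<p} <+> {..<p}) (perm_diagram p \<sigma>)"
  proof (rule partition_onI)
    have "\<Union>(perm_diagram p \<sigma>) = Inl ` \<sigma> ` {..<p} \<union> Inr ` {..<p}" by (auto simp: perm_diagram_def)
    then show "\<Union>(perm_diagram p \<sigma>) = {..<p} <+> {..<p}" using permutes_image[OF assms] by (simp add: Plus_def)
    show "disjnt B C" if "B \<in> perm_diagram p \<sigma>" "C \<in> perm_diagram p \<sigma>" "B \<noteq> C" for B C
      using that permutes_inj[OF assms] by (auto simp: perm_diagram_def disjnt_def dest: injD)
  qed (auto simp: perm_diagram_def)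
  then show ?thesis by (simp add: diagrams_def)
qed

lemma compatible_perm_diagram: "compatible (perm_diagram p \<sigma>) v w \<longleftrightarrow> (\<forall>i<p. v ! \<sigma> i = w ! i)"
  by (auto simp: compatible_def perm_diagram_def)

text \<open>A word and a permutation diagram determine the middle row, so counting middle rows over two
  letters gives \<open>2 ^ loops \<le> 1\<close>.\<close>

lemma dcomp_perm_diagram:
  assumes \<sigma>: "\<sigma> permutes {..<p}" and y: "y \<in> diagrams p r"
  shows "loops (perm_diagram p \<sigma>) y = 0"
    and "v \<in> words n p \<Longrightarrow> w \<in> words n r \<Longrightarrow>
      compatible (dcomp (perm_diagram p \<sigma>) y) v w \<longleftrightarrow> compatible y (map (\<lambda>i. v ! \<sigma> i) [0..<p]) w"
proof -
  let ?x = "perm_diagram p \<sigma>"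
  have \<sigma>lt: "\<sigma> i < p" if "i < p" for i using permutes_in_image[OF \<sigma>, of i] that by simp
  have count: "(if compatible y (map (\<lambda>i. v ! \<sigma> i) [0..<p]) w then 1 else 0) =
     (if compatible (dcomp ?x y) v w then n ^ loops ?x y else 0)"
    if v: "v \<in> words n p" and w: "w \<in> words n r" for v w n
  proof -
    let ?v = "map (\<lambda>i. v ! \<sigma> i) [0..<p]"
    have "?v \<in> words n p" using words_nth[OF v \<sigma>lt] by (auto simp: words_def)
    moreover have "compatible ?x v v' \<longleftrightarrow> v' = ?v" if "v' \<in> words n p" for v'
      unfolding compatible_perm_diagram
    proof
      assume "\<forall>i<p. v ! \<sigma> i = v' ! i"
      then show "v' = ?v" using words_length[OF that] by (intro nth_equalityI) simp_all
    qed simp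
    ultimately have "{v' \<in> words n p. compatible ?x v v' \<and> compatible y v' w} =
       (if compatible y ?v w then {?v} else {})" by auto
    then show ?thesis
      using card_compatible_middle[OF perm_diagram_in_diagrams[OF \<sigma>] y v w] by (simp split: if_splits)
  qed
  \<comment> \<open>Constant words are compatible with every diagram, so for them the left side of
    \<open>count\<close> is \<open>1\<close>.\<close>
  have z: "replicate p 0 \<in> words 2 p" "replicate r 0 \<in> words 2 r" by (auto simp: words_def)
  have z0: "label (map (\<lambda>i. replicate p 0 ! \<sigma> i) [0..<p]) (replicate r 0) k = 0"
    if "k \<in> {..<p} <+> {..<r}" for k
    using that by (rule PlusE) (simp_all add: \<sigma>lt)
  have "compatible y (map (\<lambda>i. replicate p 0 ! \<sigma> i) [0..<p]) (replicate r 0)"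
    unfolding compatible_def
  proof (intro ballI)
    fix B k l assume "B \<in> y" "k \<in> B" "l \<in> B"
    then have "k \<in> {..<p} <+> {..<r}" "l \<in> {..<p} <+> {..<r}" using diagramsD(1)[OF y] by blast+
    then show "label (map (\<lambda>i. replicate p 0 ! \<sigma> i) [0..<p]) (replicate r 0) k =
      label (map (\<lambda>i. replicate p 0 ! \<sigma> i) [0..<p]) (replicate r 0) l"
      by (simp only: z0)
  qed
  with count[OF z] have "1 = (if compatible (dcomp ?x y) (replicate p 0) (replicate r 0) then 2 ^ loops ?x y else (0::nat))"
    by simp
  then have "2 ^ loops ?x y = Suc 0" by (simp split: if_splits)
  then show l: "loops ?x y = 0" by simp
  show "compatible (dcomp ?x y) v w \<longleftrightarrow> compatible y (map (\<lambda>i. v ! \<sigma> i) [0..<p]) w"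
    if "v \<in> words n p" "w \<in> words n r"
    using count[OF that] by (simp add: l split: if_splits)
qed

text \<open>On kernels, a permutation diagram just reorders the top word. Both sides are compared
  through their compatible words over two letters.\<close>

lemma kernel_diagram_permute:
  assumes \<sigma>: "\<sigma> permutes {..<p}" and v: "length v = p"
  shows "dcomp (perm_diagram p \<sigma>) (kernel_diagram (map (\<lambda>i. v ! \<sigma> i) [0..<p]) w) = kernel_diagram v w"
proof -
  let ?v = "map (\<lambda>i. v ! \<sigma> i) [0..<p]"
  have \<sigma>lt: "\<sigma> i < p" if "i < p" for i using permutes_in_image[OF \<sigma>, of i] that by simp
  have K: "kernel_diagram ?v w \<in> diagrams p (length w)" using kernel_diagram_in_diagrams[of ?v w] by simp
  have K': "kernel_diagram v w \<in> diagrams p (length w)" using kernel_diagram_in_diagrams[of v w] v by simp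
  show ?thesis
  proof (rule diagrams_eqI_compatible[OF dcomp_in_diagrams[OF perm_diagram_in_diagrams[OF \<sigma>] K] K'])
    fix a b assume a: "a \<in> words 2 p" and b: "b \<in> words 2 (length w)"
    have "map (\<lambda>i. a ! \<sigma> i) [0..<p] = map g ?v \<longleftrightarrow> a = map g v" for g
    proof
      assume eq: "map (\<lambda>i. a ! \<sigma> i) [0..<p] = map g ?v"
      show "a = map g v"
      proof (rule nth_equalityI)
        fix i assume "i < length a"
        then have i: "i < p" using words_length[OF a] by simp
        define j where "j = invf \<sigma> i"
        have j: "\<sigma> j = i" "j < p"
          using permutes_inverses(1)[OF \<sigma>] permutes_in_image[OF permutes_inv[OF \<sigma>], of i] i by (simp_all add: j_def)
        have "map (\<lambda>i. a ! \<sigma> i) [0..<p] ! j = map g ?v ! j" by (simp only: eq)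
        then show "a ! i = map g v ! i" using j v i by simp
      qed (simp add: words_length[OF a] v)
    next
      assume "a = map g v"
      then show "map (\<lambda>i. a ! \<sigma> i) [0..<p] = map g ?v" using v \<sigma>lt by simp
    qed
    then show "compatible (dcomp (perm_diagram p \<sigma>) (kernel_diagram ?v w)) a b \<longleftrightarrow> compatible (kernel_diagram v w) a b"
      using dcomp_perm_diagram(2)[OF \<sigma> K a b] words_length[OF a] words_length[OF b] v
      by (simp add: compatible_kernel_diagram del: map_map map_eq_conv)
  qed
qed

section \<open>Propagating numbers\<close>

definition block_of :: "'a set set \<Rightarrow> 'a \<Rightarrow> 'a set" where
  "block_of x q = (THE B. B \<in> x \<and> q \<in> B)"

lemma block_of_eq: "x \<in> diagrams r s \<Longrightarrow> B \<in> x \<Longrightarrow> q \<in> B \<Longrightarrow> block_of x q = B"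
  unfolding block_of_def using diagramsD(2) by (intro the_equality) blast+

lemma block_of_mem:
  assumes "x \<in> diagrams r s" "q \<in> {..<r} <+> {..<s}"
  shows "block_of x q \<in> x" "q \<in> block_of x q"
  using assms block_of_eq diagrams_block by metis+

definition prop_blocks :: "diagram \<Rightarrow> diagram" where
  "prop_blocks x = {B \<in> x. B \<inter> range Inl \<noteq> {} \<and> B \<inter> range Inr \<noteq> {}}"

lemma prop_blocks_subset:
  assumes x: "x \<in> diagrams r s"
  shows "prop_blocks x \<subseteq> (\<lambda>i. block_of x (Inl i)) ` {..<r}"
proof
  fix B assume "B \<in> prop_blocks x"
  then obtain i where i: "B \<in> x" "Inl i \<in> B" by (auto simp: prop_blocks_def)
  then have "Inl i \<in> {..<r} <+> {..<s}" using diagramsD(1)[OF x] by blast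
  then show "B \<in> (\<lambda>i. block_of x (Inl i)) ` {..<r}" using block_of_eq[OF x i] by auto
qed

lemma prop_number_le:
  assumes x: "x \<in> diagrams r s"
  shows "prop_number x \<le> r"
proof -
  have "card (prop_blocks x) \<le> card ((\<lambda>i. block_of x (Inl i)) ` {..<r})"
    by (rule card_mono[OF _ prop_blocks_subset[OF x]]) simp
  also have "\<dots> \<le> r" using card_image_le[of "{..<r}"] by simp
  finally show ?thesis by (simp add: prop_number_def prop_blocks_def)
qed

text \<open>At most \<open>p\<close> blocks meet the top row, and here \<open>p\<close> blocks
  propagate. So the top points lie in distinct blocks, all of them propagating, and a block without
  top points must contain a bottom point.\<close>

lemma prop_number_eq_top:
  assumes x: "x \<in> diagrams p r" and "prop_number x = p"
  shows "i < p \<Longrightarrow> i' < p \<Longrightarrow> same_block x (Inl i) (Inl i') \<Longrightarrow> i = i'"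
    and "B \<in> x \<Longrightarrow> \<exists>j<r. Inr j \<in> B"
proof -
  let ?f = "\<lambda>i. block_of x (Inl i)"
  have c: "card (prop_blocks x) = p" using assms(2) by (simp add: prop_number_def prop_blocks_def)
  have le: "card (?f ` {..<p}) \<le> p" using card_image_le[of "{..<p}" ?f] by simp
  have eq: "prop_blocks x = ?f ` {..<p}"
    by (rule card_seteq[OF _ prop_blocks_subset[OF x]]) (use c le in simp_all)
  then have "inj_on ?f {..<p}" using c by (intro eq_card_imp_inj_on) simp_all
  note inj = this
  show "i = i'" if i: "i < p" "i' < p" and same: "same_block x (Inl i) (Inl i')"
  proof -
    obtain B where "B \<in> x" "Inl i \<in> B" "Inl i' \<in> B" using same unfolding same_block_def by blast
    then have "?f i = ?f i'" using block_of_eq[OF x] by simp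
    then show ?thesis using inj i by (auto dest: inj_onD)
  qed
  assume B: "B \<in> x"
  have "\<exists>j. Inr j \<in> B"
  proof (cases "\<exists>i. Inl i \<in> B")
    case True
    then obtain i where i: "Inl i \<in> B" by blast
    then have "i < p" using B diagramsD(1)[OF x] by blast
    then have "B \<in> prop_blocks x" using eq block_of_eq[OF x B i] by auto
    then show ?thesis by (auto simp: prop_blocks_def)
  next
    case False
    then show ?thesis using B diagramsD(3)[OF x] by (metis equals0I sum.exhaust)
  qed
  then show "\<exists>j<r. Inr j \<in> B" using B diagramsD(1)[OF x] by blast
qed

text \<open>Either two top points share a block, or each has its own and some block of a top point
  fails to propagate, hence is a singleton. In the first case \<open>phi s\<close> is killed because
  it lives on words without repetitions, in the second by a Garnir relation.\<close>

lemma prop_number_less_top: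
  assumes x: "x \<in> diagrams p r" and "prop_number x < p"
  obtains i i' where "i < p" "i' < p" "i \<noteq> i'" "same_block x (Inl i) (Inl i')"
    | i where "i < p" "{Inl i} \<in> x"
proof (cases "inj_on (\<lambda>i. block_of x (Inl i)) {..<p}")
  case False
  then obtain i i' where i: "i < p" "i' < p" "i \<noteq> i'" "block_of x (Inl i) = block_of x (Inl i')"
    by (auto simp: inj_on_def)
  have m: "block_of x (Inl k) \<in> x" "Inl k \<in> block_of x (Inl k)" if "k < p" for k
    using that by (auto intro!: block_of_mem[OF x])
  have "same_block x (Inl i) (Inl i')"
    unfolding same_block_def using m[OF i(1)] m[OF i(2)] i(4) by metis
  then show ?thesis using that(1) i by blast
next
  case True
  let ?f = "\<lambda>i. block_of x (Inl i)"
  have m: "?f k \<in> x" "Inl k \<in> ?f k" if "k < p" for k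
    using that by (auto intro!: block_of_mem[OF x])
  have "card (?f ` {..<p}) = p" using True by (simp add: card_image)
  moreover have "card (prop_blocks x) < p" using assms(2) by (simp add: prop_number_def prop_blocks_def)
  ultimately have "\<not> ?f ` {..<p} \<subseteq> prop_blocks x"
    using card_mono[of "prop_blocks x" "?f ` {..<p}"] finite_subset[OF prop_blocks_subset[OF x]] by auto
  then obtain i where i: "i < p" "?f i \<notin> prop_blocks x" by auto
  have "q = Inl i" if q: "q \<in> ?f i" for q
  proof (cases q)
    case (Inl k)
    then have k: "k < p" using q m(1)[OF i(1)] diagramsD(1)[OF x] by blast
    have "?f k = ?f i" using block_of_eq[OF x m(1)[OF i(1)], of "Inl k"] q Inl by simp
    then show ?thesis using inj_onD[OF True, of k i] k i Inl by simp
  next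
    case (Inr k)
    then have "?f i \<in> prop_blocks x" using m[OF i(1)] q by (auto simp: prop_blocks_def)
    then show ?thesis using i by simp
  qed
  then have "?f i = {Inl i}" using m(2)[OF i(1)] by blast
  then show ?thesis using that(2)[OF i(1)] m(1)[OF i(1)] by simp
qed

lemma prop_number_kernel_diagram:
  assumes "distinct v" "set v \<subseteq> set w"
  shows "prop_number (kernel_diagram v w) = length v"
proof -
  let ?B = "\<lambda>c. {q \<in> {..<length v} <+> {..<length w}. label v w q = c}"
  have "prop_blocks (kernel_diagram v w) = ?B ` set v"
  proof safe
    fix B assume "B \<in> prop_blocks (kernel_diagram v w)"
    then obtain c i where c: "B = ?B c" and i: "Inl i \<in> B"
      unfolding prop_blocks_def kernel_diagram_def by blast
    have "i < length v" "v ! i = c" using i unfolding c by auto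
    then show "B \<in> ?B ` set v" using c nth_mem by blast
  next
    fix c assume c: "c \<in> set v"
    then obtain i j where "i < length v" "v ! i = c" "j < length w" "w ! j = c"
      using assms(2) by (metis in_set_conv_nth subsetD)
    then have "Inl i \<in> ?B c" "Inr j \<in> ?B c" by auto
    then show "?B c \<in> prop_blocks (kernel_diagram v w)"
      using c unfolding prop_blocks_def kernel_diagram_def by blast
  qed
  moreover have "inj_on ?B (set v)"
  proof (rule inj_onI)
    fix c d assume c: "c \<in> set v" and eq: "?B c = ?B d"
    then obtain i where i: "i < length v" "v ! i = c" by (metis in_set_conv_nth)
    then have "Inl i \<in> ?B c" by auto
    then have "Inl i \<in> ?B d" by (simp only: eq)
    then show "c = d" using i by simp
  qed
  ultimately have "card (prop_blocks (kernel_diagram v w)) = length v"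
    using assms(1) by (simp add: card_image distinct_card)
  then show ?thesis by (simp add: prop_number_def prop_blocks_def)
qed

section \<open>Homomorphisms attached to elements of the Specht module\<close>

lemma tabloids_permute:
  assumes "\<sigma> permutes {..<sum_list \<nu>}" "T \<in> tabloids \<nu>"
  shows "map ((`) \<sigma>) T \<in> tabloids \<nu>"
  using assms tableaux_comp by (force simp: tabloids_def tabloid_comp[symmetric])

text \<open>Two symmetric groups act on words, one on the letters and one on the positions. The
  first passes through \<open>fill\<close> to the whole tabloid; \<open>fill_permute\<close> moves
  the second to the pattern \<open>U\<close>.\<close>

lemma fill_map:
  assumes "\<tau> permutes {..<n}" "\<Union>(set U) \<subseteq> {..<length v}"
  shows "fill n (map \<tau> v) U = map ((`) \<tau>) (fill n v U)"
proof -
  have "\<tau> ` ({..<n} - set v) = {..<n} - \<tau> ` set v"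
    using image_set_diff[OF permutes_inj[OF assms(1)], of "{..<n}" "set v"] permutes_image[OF assms(1)] by simp
  moreover have "(!) (map \<tau> v) ` A = \<tau> ` (!) v ` A" if "A \<in> set U" for A
  proof -
    have "A \<subseteq> {..<length v}" using that assms(2) by blast
    then show ?thesis unfolding image_image by (intro image_cong) auto
  qed
  ultimately show ?thesis by (simp add: fill_def)
qed

lemma fill_permute:
  assumes "\<sigma> permutes {..<p}" "\<Union>(set U) \<subseteq> {..<p}" "length v = p"
  shows "fill n (map (\<lambda>i. v ! \<sigma> i) [0..<p]) U = fill n v (map ((`) \<sigma>) U)"
proof -
  have "set (map (\<lambda>i. v ! \<sigma> i) [0..<p]) = (!) v ` \<sigma> ` {..<p}" by auto
  also have "\<dots> = set v" using permutes_image[OF assms(1)] assms(3) by (auto simp: set_conv_nth)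
  finally have "set (map (\<lambda>i. v ! \<sigma> i) [0..<p]) = set v" .
  moreover have "(!) (map (\<lambda>i. v ! \<sigma> i) [0..<p]) ` A = (!) v ` \<sigma> ` A" if "A \<in> set U" for A
  proof -
    have "A \<subseteq> {..<p}" using that assms(2) by blast
    then show ?thesis unfolding image_image by (intro image_cong) auto
  qed
  ultimately show ?thesis by (simp add: fill_def)
qed

locale long_first_row =
  fixes n m :: nat and \<nu> :: "nat list"
  assumes n: "n = m + sum_list \<nu>" and rows_le: "\<And>i. i < length \<nu> \<Longrightarrow> \<nu> ! i \<le> m"
begin

abbreviation "p \<equiv> sum_list \<nu>"
abbreviation "\<mu> \<equiv> m # \<nu>"

lemma cells_lt: "(i, j) \<in> cells \<nu> \<Longrightarrow> j < m"
  using rows_le[of i] by (simp add: cells_def)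

lemma sum_list_mu: "sum_list \<mu> = n"
  by (simp add: n)

text \<open>\<open>phi s\<close> is the homomorphism from the Specht module to the \<open>p\<close>-th tensor power attached to \<open>s\<close>,
  supported on words without repetitions.\<close>

definition dual :: "(nat set list \<Rightarrow>\<^sub>0 'k::field) \<Rightarrow> (nat set list \<Rightarrow>\<^sub>0 'k) \<Rightarrow> nat list \<Rightarrow> 'k" where
  "dual s u v = (if distinct v then \<Sum>U\<in>tabloids \<nu>. coef s U * coef u (fill n v U) else 0)"

definition phi :: "(nat set list \<Rightarrow>\<^sub>0 'k::field) \<Rightarrow> (nat set list \<Rightarrow>\<^sub>0 'k) \<Rightarrow> (nat list \<Rightarrow>\<^sub>0 'k)" where
  "phi s u = (\<Sum>v\<in>words n p. fscale (dual s u v) (basis v))"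

lemma dual_linear:
  "dual (s + s') u v = dual s u v + dual s' u v"
  "dual s (u + u') v = dual s u v + dual s u' v"
  "dual (fscale c s) u v = c * dual s u v"
  "dual s (fscale c u) v = c * dual s u v"
  "dual 0 u v = 0" "dual s 0 v = 0"
  by (simp_all add: dual_def lookup_add lookup_fscale distrib_left distrib_right sum.distrib
      sum_distrib_left mult.assoc mult.left_commute)

lemma coef_phi: "coef (phi s u) v = (if v \<in> words n p then dual s u v else 0)"
proof -
  have "coef (phi s u) v = (\<Sum>v'\<in>words n p. if v' = v then dual s u v else 0)"
    unfolding phi_def lookup_sum by (intro sum.cong) (auto simp: lookup_fscale lookup_single when_def)
  then show ?thesis by (simp add: sum.delta)
qed

lemma phi_in_free_on [simp]: "phi s u \<in> free_on (words n p)"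
  by (simp add: free_on_iff coef_phi)

lemma phi_linear:
  "phi (s + s') u = phi s u + phi s' u"
  "phi s (u + u') = phi s u + phi s u'"
  "phi (fscale c s) u = fscale c (phi s u)"
  "phi s (fscale c u) = fscale c (phi s u)"
  "phi 0 u = 0" "phi s 0 = 0"
  by (rule poly_mapping_eqI, simp add: coef_phi lookup_add lookup_fscale dual_linear)+

lemma dual_specht_perm:
  assumes \<sigma>: "\<sigma> permutes {..<n}" and v: "length v = p"
  shows "dual s (specht_perm \<sigma> u) v = dual s u (map (invf \<sigma>) v)"
proof -
  have "coef (specht_perm \<sigma> u) (fill n v U) = coef u (fill n (map (invf \<sigma>) v) U)" if "U \<in> tabloids \<nu>" for U
    using fill_map[OF permutes_inv[OF \<sigma>], of U v] tabloidsD(4)[OF that] v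
    by (simp add: coef_specht_perm permutes_bij[OF \<sigma>])
  moreover have "distinct (map (invf \<sigma>) v) \<longleftrightarrow> distinct v"
    using inj_on_subset[OF permutes_inj[OF permutes_inv[OF \<sigma>]]] by (simp add: distinct_map)
  ultimately show ?thesis by (simp add: dual_def)
qed

lemma words_map:
  assumes "\<sigma> permutes {..<n}"
  shows "map \<sigma> v \<in> words n r \<longleftrightarrow> v \<in> words n r"
  using permutes_in_image[OF assms] by (auto simp: words_def)

lemma phi_specht_perm:
  assumes \<sigma>: "\<sigma> permutes {..<n}"
  shows "phi s (specht_perm \<sigma> u) = tensor_perm \<sigma> (phi s u)"
  by (rule poly_mapping_eqI)
    (simp add: coef_phi coef_tensor_perm permutes_bij[OF \<sigma>] words_map[OF permutes_inv[OF \<sigma>]]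
      dual_specht_perm[OF \<sigma>] words_length)

text \<open>Substituting along \<open>\<sigma>\<close> in the sum over tabloids trades the action on
  \<open>s\<close> for a permutation of the positions of \<open>v\<close>.\<close>

lemma dual_permute:
  assumes \<sigma>: "\<sigma> permutes {..<p}" and v: "length v = p"
  shows "dual (specht_perm (invf \<sigma>) s) u v = dual s u (map (\<lambda>i. v ! invf \<sigma> i) [0..<p])"
proof -
  let ?\<tau> = "invf \<sigma>"
  have \<tau>: "?\<tau> permutes {..<p}" by (rule permutes_inv[OF \<sigma>])
  have inv: "map ((`) ?\<tau>) (map ((`) \<sigma>) U) = U" "map ((`) \<sigma>) (map ((`) ?\<tau>) U) = U" for U
    using permutes_inverses[OF \<sigma>] by (simp_all add: image_image comp_def)
  have "dist": "distinct (map (\<lambda>i. v ! ?\<tau> i) [0..<p]) \<longleftrightarrow> distinct v"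
  proof -
    have "map (\<lambda>i. v ! ?\<tau> i) [0..<p] = permute_list ?\<tau> v" using v by (simp add: permute_list_def)
    then show ?thesis using \<tau> v by simp
  qed
  have "(\<Sum>U\<in>tabloids \<nu>. coef (specht_perm ?\<tau> s) U * coef u (fill n v U)) =
    (\<Sum>U\<in>tabloids \<nu>. coef s U * coef u (fill n v (map ((`) ?\<tau>) U)))"
  proof (rule sum.reindex_bij_witness[of _ "map ((`) ?\<tau>)" "map ((`) \<sigma>)"])
    show "coef s (map ((`) \<sigma>) U) * coef u (fill n v (map ((`) ?\<tau>) (map ((`) \<sigma>) U))) =
      coef (specht_perm ?\<tau> s) U * coef u (fill n v U)" for U
      by (simp only: inv coef_specht_perm[OF permutes_bij[OF \<tau>]] permutes_inv_inv[OF \<sigma>])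
  qed (use inv tabloids_permute[OF \<sigma>] tabloids_permute[OF \<tau>] in auto)
  also have "\<dots> = (\<Sum>U\<in>tabloids \<nu>. coef s U * coef u (fill n (map (\<lambda>i. v ! ?\<tau> i) [0..<p]) U))"
    using fill_permute[OF \<tau> _ v] tabloidsD(4) by (intro sum.cong) auto
  finally show ?thesis unfolding dual_def "dist" by simp
qed

text \<open>A permutation diagram is compatible with exactly one top word for each bottom word, so
  the sum has a single term. The inverse is the one in \<open>specht_ract\<close>, and the identity
  makes the later map \<open>Psi\<close> balanced over the group algebra.\<close>

lemma ev_perm_diagram_phi:
  assumes \<sigma>: "\<sigma> permutes {..<p}"
  shows "ev n p (basis (perm_diagram p \<sigma>)) (phi s u) = phi (specht_perm (invf \<sigma>) s) u"
proof (rule poly_mapping_eqI)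
  fix w
  show "coef (ev n p (basis (perm_diagram p \<sigma>)) (phi s u)) w = coef (phi (specht_perm (invf \<sigma>) s) u) w"
  proof (cases "w \<in> words n p")
    case True
    let ?v = "map (\<lambda>i. w ! invf \<sigma> i) [0..<p]"
    have lt: "\<sigma> i < p" "invf \<sigma> i < p" if "i < p" for i
      using permutes_in_image[OF \<sigma>, of i] permutes_in_image[OF permutes_inv[OF \<sigma>], of i] that by simp_all
    have "compatible (perm_diagram p \<sigma>) v w \<longleftrightarrow> v = ?v" if "v \<in> words n p" for v
      unfolding compatible_perm_diagram
    proof
      assume h: "\<forall>i<p. v ! \<sigma> i = w ! i"
      show "v = ?v"
      proof (rule nth_equalityI)
        fix i assume "i < length v"
        then have "i < p" using words_length[OF that] by simp
        then show "v ! i = ?v ! i" using h[rule_format, of "invf \<sigma> i"] lt permutes_inverses(1)[OF \<sigma>] by simp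
      qed (simp add: words_length[OF that])
    next
      assume "v = ?v"
      then show "\<forall>i<p. v ! \<sigma> i = w ! i" using lt permutes_inverses(2)[OF \<sigma>] by simp
    qed
    then have "coef (ev n p (basis (perm_diagram p \<sigma>)) (phi s u)) w =
      (\<Sum>v\<in>words n p. if v = ?v then dual s u ?v else 0)"
      using True by (auto simp: coef_ev[OF phi_in_free_on] coef_phi intro!: sum.cong)
    moreover have "?v \<in> words n p" using words_nth[OF True lt(2)] by (auto simp: words_def)
    ultimately show ?thesis
      using True dual_permute[OF \<sigma> words_length[OF True], of s u] by (simp add: coef_phi sum.delta)
  next
    case False
    then show ?thesis by (simp add: coef_phi free_on_coef[OF ev_in_free_on])
  qed
qed

text \<open>If the other \<open>p - 1\<close> entries are distinct, the letters \<open>a\<close>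
  that complete them to a word without repetitions form a set \<open>X\<close> of
  \<open>m + 1\<close> elements. For each tabloid \<open>U\<close> the sum over \<open>X\<close> is
  a Garnir relation: \<open>a\<close> enters the row that contains position \<open>i\<close>, and
  the rest of \<open>X\<close> is the first row.\<close>

lemma sum_dual_update_eq_0:
  fixes s u :: "nat set list \<Rightarrow>\<^sub>0 'k::field_char_0"
  assumes u: "u \<in> specht \<mu>" and v: "v \<in> words n p" and i: "i < p"
  shows "(\<Sum>a<n. dual s u (v[i := a])) = 0"
proof -
  define Oth where "Oth = (!) v ` ({..<p} - {i})"
  have len: "length v = p" by (rule words_length[OF v])
  have Oth_n: "Oth \<subseteq> {..<n}" using words_nth[OF v] by (auto simp: Oth_def)
  have set_upd: "set (v[i := a]) = insert a Oth" for a
  proof -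
    have "set (v[i := a]) = (!) (v[i := a]) ` {..<p}" using len by (auto simp: set_conv_nth)
    also have "\<dots> = (!) (v[i := a]) ` insert i ({..<p} - {i})"
      using i by (intro arg_cong[of _ _ "(`) ((!) (v[i := a]))"]) auto
    also have "\<dots> = insert a ((!) (v[i := a]) ` ({..<p} - {i}))"
      using i len by (simp only: image_insert nth_list_update_eq)
    also have "(!) (v[i := a]) ` ({..<p} - {i}) = Oth"
      unfolding Oth_def by (intro image_cong) auto
    finally show ?thesis .
  qed
  have dist: "distinct (v[i := a]) \<longleftrightarrow> card (insert a Oth) = p" for a
    unfolding set_upd[symmetric] using len by (metis card_distinct distinct_card length_list_update)
  have Oth: "finite Oth" "card Oth \<le> p - 1"
    using card_image_le[of "{..<p} - {i}" "(!) v"] i by (simp_all add: Oth_def)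
  show ?thesis
  proof (cases "card Oth = p - 1")
    case False
    \<comment> \<open>The other entries already repeat a letter, so no choice of \<open>a\<close>
      gives a distinct word.\<close>
    then have "card Oth < p - 1" using Oth(2) by linarith
    moreover have "card (insert a Oth) \<le> Suc (card Oth)" for a
      using Oth(1) by (simp add: card_insert_if)
    ultimately have "card (insert a Oth) < p" for a
      by (metis less_diff_conv Suc_eq_plus1 le_less_trans)
    then have "\<not> distinct (v[i := a])" for a using dist[of a] by (metis less_irrefl)
    then show ?thesis by (simp add: dual_def)
  next
    case True
    define X where "X = {..<n} - Oth"
    have dX: "distinct (v[i := a]) \<longleftrightarrow> a \<in> X" if "a < n" for a
      unfolding dist using True Oth i that by (auto simp: card_insert_if X_def)
    have "card X = n - (p - 1)" using Oth Oth_n True by (simp add: X_def card_Diff_subset)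
    then have cX: "card X = Suc m" using n i by simp
    have inner: "(\<Sum>a\<in>X. coef u (fill n (v[i := a]) U)) = 0" if U: "U \<in> tabloids \<nu>" for U
    proof -
      \<comment> \<open>The lower rows without position \<open>i\<close>; the row \<open>j\<close>
        that contained \<open>i\<close> is waiting for \<open>a\<close>.\<close>
      define L where "L = map (\<lambda>A. (!) v ` (A - {i})) U"
      have "i \<in> \<Union>(set U)" using tabloidsD(4)[OF U] i by simp
      then obtain j where j: "j < length U" "i \<in> U ! j" by (auto simp: in_set_conv_nth)
      have lU: "length U = length \<nu>" by (rule tabloidsD(1)[OF U])
      have Up: "U ! k \<subseteq> {..<p}" if "k < length U" for k
        using tabloidsD(4)[OF U] nth_mem[OF that] by blast
      have "fill n (v[i := a]) U = (X - {a}) # L[j := insert a (L ! j)]" if a: "a \<in> X" for a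
      proof -
        have "{..<n} - insert a Oth = X - {a}" by (auto simp: X_def)
        moreover have "map ((`) ((!) (v[i := a]))) U = L[j := insert a (L ! j)]"
        proof (rule nth_equalityI)
          fix k assume "k < length (map ((`) ((!) (v[i := a]))) U)"
          then have k: "k < length U" by simp
          have eq: "(!) (v[i := a]) ` (U ! k - {i}) = (!) v ` (U ! k - {i})"
            by (intro image_cong) auto
          show "map ((`) ((!) (v[i := a]))) U ! k = L[j := insert a (L ! j)] ! k"
          proof (cases "k = j")
            case True
            then have "U ! k = insert i (U ! k - {i})" using j by auto
            then have "(!) (v[i := a]) ` (U ! k) = insert (v[i := a] ! i) ((!) (v[i := a]) ` (U ! k - {i}))"
              by (metis image_insert)
            then show ?thesis using True k j i len by (simp add: L_def eq)
          next
            case False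
            then have "i \<notin> U ! k" using tabloidsD(3)[OF U, of k j] k j lU by auto
            then have "U ! k - {i} = U ! k" by simp
            then show ?thesis using False k eq by (simp add: L_def)
          qed
        qed (simp add: L_def)
        ultimately show ?thesis by (simp add: fill_def set_upd)
      qed
      moreover have "(\<Sum>a\<in>X. coef u ((X - {a}) # L[j := insert a (L ! j)])) = 0"
      proof (rule coef_sum_updates_eq_0[OF u rows_le _ cX])
        show "X \<subseteq> {..<m + sum_list \<nu>}" using n by (auto simp: X_def)
        show "j < length L" using j by (simp add: L_def)
        fix A assume "A \<in> set L"
        then obtain k where "k < length U" "A = (!) v ` (U ! k - {i})"
          by (auto simp: L_def in_set_conv_nth)
        then have "A \<subseteq> Oth" using Up by (auto simp: Oth_def)
        then show "X \<inter> A = {}" by (auto simp: X_def)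
      qed
      ultimately show ?thesis by simp
    qed
    have "(\<Sum>a<n. dual s u (v[i := a])) = (\<Sum>a\<in>X. dual s u (v[i := a]))"
    proof (rule sum.mono_neutral_right)
      show "X \<subseteq> {..<n}" by (auto simp: X_def)
      show "\<forall>a\<in>{..<n} - X. dual s u (v[i := a]) = 0" using dX unfolding dual_def by simp
    qed simp
    also have "\<dots> = (\<Sum>a\<in>X. \<Sum>U\<in>tabloids \<nu>. coef s U * coef u (fill n (v[i := a]) U))"
    proof (rule sum.cong[OF refl])
      fix a assume "a \<in> X"
      moreover from this have "a < n" by (simp add: X_def)
      ultimately show "dual s u (v[i := a]) = (\<Sum>U\<in>tabloids \<nu>. coef s U * coef u (fill n (v[i := a]) U))"
        using dX unfolding dual_def by simp
    qed
    also have "\<dots> = (\<Sum>U\<in>tabloids \<nu>. coef s U * (\<Sum>a\<in>X. coef u (fill n (v[i := a]) U)))"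
      by (subst sum.swap) (simp add: sum_distrib_left)
    finally show ?thesis by (simp add: inner)
  qed
qed

text \<open>If the diagram joins two top points, compatible words repeat a letter. If it isolates a
  top point, the letter there is unconstrained and summing over it gives zero. This is the
  counterpart of setting diagrams with fewer than \<open>p\<close> propagating blocks to zero in the
  bimodule.\<close>

lemma ev_phi_eq_0:
  fixes s u :: "nat set list \<Rightarrow>\<^sub>0 'k::field_char_0"
  assumes x: "x \<in> diagrams p r" and "prop_number x < p" and u: "u \<in> specht \<mu>"
  shows "ev n r (basis x) (phi s u) = 0"
proof (rule poly_mapping_eqI)
  fix w
  let ?F = "\<lambda>v. if compatible x v w then dual s u v else 0"
  have "(\<Sum>v\<in>words n p. ?F v) = 0"
    using x assms(2)
  proof (cases rule: prop_number_less_top)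
    case (1 i i')
    have "?F v = 0" if v: "v \<in> words n p" for v
    proof -
      have "\<not> distinct v" if "compatible x v w"
      proof -
        have "v ! i = v ! i'" using that 1(4) unfolding compatible_iff by fastforce
        then show ?thesis using 1(1-3) words_length[OF v] by (auto simp: distinct_conv_nth)
      qed
      then show ?thesis by (simp add: dual_def)
    qed
    then show ?thesis by simp
  next
    case (2 i)
    have n0: "0 < n" using 2(1) n by simp
    have comp: "compatible x (v[i := a]) w \<longleftrightarrow> compatible x v w" for v a
    proof -
      have "label (v[i := a]) w k = label (v[i := a]) w l \<longleftrightarrow> label v w k = label v w l"
        if B: "B \<in> x" "k \<in> B" "l \<in> B" for B k l
      proof (cases "B = {Inl i}")
        case False
        then have "Inl i \<notin> B" using diagramsD(2)[OF x B(1) 2(2)] by blast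
        then have "k \<noteq> Inl i" "l \<noteq> Inl i" using B by blast+
        then have "label (v[i := a]) w k = label v w k" "label (v[i := a]) w l = label v w l"
          by (cases k; cases l; simp)+
        then show ?thesis by simp
      qed (use B in simp)
      then show ?thesis unfolding compatible_def by blast
    qed
    \<comment> \<open>The letter at the isolated point is split off from the word, with
      \<open>0\<close> as placeholder; the inner sums over this letter are those of
      \<open>sum_dual_update_eq_0\<close>.\<close>
    let ?V = "{v \<in> words n p. v ! i = 0}"
    have "(\<Sum>v\<in>words n p. ?F v) = (\<Sum>(v, a)\<in>?V \<times> {..<n}. ?F (v[i := a]))"
    proof (rule sum.reindex_bij_witness[of _ "\<lambda>(v, a). v[i := a]" "\<lambda>v. (v[i := 0], v ! i)"])
      have upd: "v[i := a] \<in> words n p" if "v \<in> words n p" "a < n" for v a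
        using that set_update_subset_insert[of v i a] unfolding words_def by auto
      fix v assume v: "v \<in> words n p"
      have il: "i < length v" using 2(1) words_length[OF v] by simp
      show "(v[i := 0], v ! i) \<in> ?V \<times> {..<n}" using upd[OF v n0] words_nth[OF v 2(1)] il by simp
    next
      fix b assume "b \<in> ?V \<times> {..<n}"
      then obtain v a where b: "b = (v, a)" and v: "v \<in> words n p" "v ! i = 0" and a: "a < n" by auto
      have il: "i < length v" using 2(1) words_length[OF v(1)] by simp
      show "((case b of (v, a) \<Rightarrow> v[i := a])[i := 0], (case b of (v, a) \<Rightarrow> v[i := a]) ! i) = b"
        using v(2) il list_update_id[of v i] by (simp add: b)
      show "(case b of (v, a) \<Rightarrow> v[i := a]) \<in> words n p"
        using v(1) a set_update_subset_insert[of v i a] unfolding b words_def by auto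
    qed simp_all
    also have "\<dots> = (\<Sum>v\<in>?V. \<Sum>a<n. ?F (v[i := a]))" by (simp add: sum.cartesian_product)
    also have "\<dots> = (\<Sum>v\<in>?V. if compatible x v w then \<Sum>a<n. dual s u (v[i := a]) else 0)"
      by (intro sum.cong) (simp_all add: comp)
    also have "\<dots> = 0" using sum_dual_update_eq_0[OF u _ 2(1), of _ s] by (simp add: sum.neutral)
    finally show ?thesis .
  qed
  moreover have "(\<Sum>v\<in>words n p. if compatible x v w then coef (phi s u) v else 0) = (\<Sum>v\<in>words n p. ?F v)"
    by (rule sum.cong[OF refl]) (simp add: coef_phi)
  ultimately show "coef (ev n r (basis x) (phi s u)) w = coef 0 w"
    by (simp add: coef_ev[OF phi_in_free_on])
qed

end

section \<open>The map from the inflation\<close>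

context long_first_row
begin

text \<open>Defined on formal sums of pairs, before passing to the tensor product, so that linearity
  in \<open>z\<close> is automatic and the relators remain to be checked.\<close>

definition Psi :: "nat \<Rightarrow> ((nat set list \<Rightarrow>\<^sub>0 'k::field) \<times> (diagram \<Rightarrow>\<^sub>0 'k) \<Rightarrow>\<^sub>0 'k) \<Rightarrow>
    (nat set list \<Rightarrow>\<^sub>0 'k) \<Rightarrow> (nat list \<Rightarrow>\<^sub>0 'k)" where
  "Psi r z u = lin_ext (\<lambda>(s, y). ev n r y (phi s u)) z"

abbreviation pre_inflation :: "nat \<Rightarrow> ((nat set list \<Rightarrow>\<^sub>0 'k::field) \<times> (diagram \<Rightarrow>\<^sub>0 'k) \<Rightarrow>\<^sub>0 'k) set" where
  "pre_inflation r \<equiv> free_on (specht \<nu> \<times> free_on (prop_diagrams p r p))"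

abbreviation relators :: "nat \<Rightarrow> ((nat set list \<Rightarrow>\<^sub>0 'k::field) \<times> (diagram \<Rightarrow>\<^sub>0 'k) \<Rightarrow>\<^sub>0 'k) set" where
  "relators r \<equiv> tensor_relators (sym_group_algebra p) specht_ract (diagram_lact (of_nat n) p)
     (specht \<nu>) (free_on (prop_diagrams p r p))"

lemma Psi_linear:
  "Psi r (z + z') u = Psi r z u + Psi r z' u"
  "Psi r (z - z') u = Psi r z u - Psi r z' u"
  "Psi r (fscale c z) u = fscale c (Psi r z u)"
  "Psi r 0 u = 0"
  "Psi r (\<Sum>i\<in>I. f i) u = (\<Sum>i\<in>I. Psi r (f i) u)"
  by (simp_all add: Psi_def lin_ext_add lin_ext_diff lin_ext_fscale lin_ext_sum)

lemma Psi_linear_right: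
  "Psi r z (u + u') = Psi r z u + Psi r z u'"
  "Psi r z (fscale c u) = fscale c (Psi r z u)"
  by (simp_all add: Psi_def phi_linear ev_linear case_prod_unfold lin_ext_fun_add lin_ext_fun_fscale)

lemma Psi_basis: "Psi r (basis (s, y)) u = ev n r y (phi s u)"
  by (simp add: Psi_def)

lemma Psi_in_free_on: "Psi r z u \<in> free_on (words n r)"
  unfolding Psi_def by (intro lin_ext_in_subspace subspace_free_on) (auto intro: ev_in_free_on)

section \<open>Truncation and the relations of the tensor product\<close>

lemma prop_truncate_linear:
  "prop_truncate q (a + b) = prop_truncate q a + prop_truncate q b"
  "prop_truncate q (fscale c a) = fscale c (prop_truncate q a)"
  "prop_truncate q 0 = 0"
  by (simp_all add: prop_truncate_def lin_ext_add lin_ext_fscale)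

lemma prop_truncate_basis:
  "prop_truncate q (basis x) = (if prop_number x < q then 0 else basis x)"
  by (simp add: prop_truncate_def)

lemma prop_truncate_in_free_on:
  assumes "b \<in> free_on (diagrams q r)"
  shows "prop_truncate q b \<in> free_on (prop_diagrams q r q)"
  using assms
proof (induction rule: free_on_induct)
  case (basis x)
  then show ?case using prop_number_le[OF basis] by (auto simp: prop_truncate_basis prop_diagrams_def)
qed (simp_all add: prop_truncate_linear free_on_add free_on_fscale)

text \<open>Truncation discards only diagrams that annihilate \<open>phi s\<close>, so products in
  the truncated bimodule can be computed with \<open>ev\<close> as if there were no
  truncation.\<close>

lemma ev_prop_truncate:
  fixes s u :: "nat set list \<Rightarrow>\<^sub>0 'k::field_char_0"
  assumes b: "b \<in> free_on (diagrams p r)" and u: "u \<in> specht \<mu>"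
  shows "ev n r (prop_truncate p b) (phi s u) = ev n r b (phi s u)"
  using b
proof (induction rule: free_on_induct)
  case (basis x)
  then show ?case using ev_phi_eq_0[OF basis _ u] by (simp add: prop_truncate_basis ev_linear)
qed (simp_all add: prop_truncate_linear ev_linear)

lemma free_on_mono: "X \<subseteq> Y \<Longrightarrow> free_on X \<subseteq> free_on Y"
  by (auto simp: free_on_def)

lemma prop_diagrams_subset: "free_on (prop_diagrams q r k) \<subseteq> free_on (diagrams q r)"
  by (rule free_on_mono) (auto simp: prop_diagrams_def)

lemma perm_diagrams_in_free_on:
  assumes "a \<in> free_on {\<sigma>. \<sigma> permutes {..<q}}"
  shows "lin_ext (\<lambda>\<sigma>. basis (perm_diagram q \<sigma>)) a \<in> free_on (diagrams q q)"
  using assms by (intro lin_ext_in_subspace subspace_free_on) (auto simp: free_on_def perm_diagram_in_diagrams)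

text \<open>The truncation is invisible, \<open>ev\<close> turns the product into a composition, and
  permutation diagrams act on \<open>phi s\<close> through \<open>specht_ract\<close>.\<close>

lemma ev_diagram_lact:
  fixes s u :: "nat set list \<Rightarrow>\<^sub>0 'k::field_char_0"
  assumes a: "a \<in> carrier (sym_group_algebra p)" and w: "w \<in> free_on (prop_diagrams p r p)"
    and u: "u \<in> specht \<mu>"
  shows "ev n r (diagram_lact (of_nat n) p a w) (phi s u) = ev n r w (phi (specht_ract s a) u)"
proof -
  have a': "a \<in> free_on {\<sigma>. \<sigma> permutes {..<p}}" using a by (simp add: sym_group_algebra_def)
  have w': "w \<in> free_on (diagrams p r)" using w prop_diagrams_subset by blast
  let ?a = "lin_ext (\<lambda>\<sigma>. basis (perm_diagram p \<sigma>)) a"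
  have "ev n p ?a (phi s u) = phi (specht_ract s a) u"
    using a'
  proof (induction rule: free_on_induct)
    case (basis \<sigma>)
    then show ?case by (simp add: specht_ract_def ev_perm_diagram_phi)
  qed (simp_all add: specht_ract_def lin_ext_add lin_ext_fscale ev_linear phi_linear)
  moreover have "ev n r (diagram_lact (of_nat n) p a w) (phi s u) = ev n r w (ev n p ?a (phi s u))"
    unfolding diagram_lact_def
      ev_prop_truncate[OF dmult_in_free_on[OF perm_diagrams_in_free_on[OF a'] w'] u]
    by (rule ev_dmult[OF perm_diagrams_in_free_on[OF a'] w' phi_in_free_on])
  ultimately show ?thesis by simp
qed

lemma specht_ract_in:
  assumes s: "s \<in> specht \<nu>" and a: "a \<in> free_on {\<sigma>. \<sigma> permutes {..<p}}"
  shows "specht_ract s a \<in> specht \<nu>"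
  unfolding specht_ract_def
  using a by (intro lin_ext_in_subspace subspace_specht specht_perm_specht s permutes_inv) (auto simp: free_on_def)

lemma Psi_relators:
  fixes u :: "nat set list \<Rightarrow>\<^sub>0 'k::field_char_0"
  assumes \<rho>: "\<rho> \<in> fvs.span (relators r)" and u: "u \<in> specht \<mu>"
  shows "Psi r \<rho> u = 0"
proof -
  have base: "Psi r \<rho> u = 0" if "\<rho> \<in> relators r" for \<rho>
    using that unfolding tensor_relators_def
    by (elim UnE CollectE exE conjE)
      (simp_all add: Psi_linear Psi_basis phi_linear ev_linear ev_diagram_lact[OF _ _ u])
  have "fvs.subspace {\<rho>. Psi r \<rho> u = 0}"
    by (rule fvs.subspaceI) (simp_all add: Psi_linear)
  from fvs.span_induct[OF \<rho> this] base show ?thesis by simp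
qed

section \<open>Equivariance under permutations of the letters\<close>

lemma compatible_map_inj:
  assumes x: "x \<in> diagrams q r" and v: "length v = q" "length w = r" and \<sigma>: "inj \<sigma>"
  shows "compatible x (map \<sigma> v) (map \<sigma> w) \<longleftrightarrow> compatible x v w"
proof -
  have l: "label (map \<sigma> v) (map \<sigma> w) k = \<sigma> (label v w k)" if "k \<in> {..<q} <+> {..<r}" for k
    using that by (rule PlusE) (simp_all add: v)
  have "label (map \<sigma> v) (map \<sigma> w) k = label (map \<sigma> v) (map \<sigma> w) k' \<longleftrightarrow> label v w k = label v w k'"
    if "B \<in> x" "k \<in> B" "k' \<in> B" for B k k'
  proof -
    have "k \<in> {..<q} <+> {..<r}" "k' \<in> {..<q} <+> {..<r}" using that diagramsD(1)[OF x] by blast+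
    then show ?thesis by (simp only: l inj_eq[OF \<sigma>])
  qed
  then show ?thesis unfolding compatible_def by (intro ball_cong refl)
qed

lemma tensor_perm_linear:
  "tensor_perm \<sigma> (u + v) = tensor_perm \<sigma> u + tensor_perm \<sigma> v"
  "tensor_perm \<sigma> (fscale c u) = fscale c (tensor_perm \<sigma> u)"
  "tensor_perm \<sigma> 0 = 0"
  by (simp_all add: tensor_perm_def lin_ext_add lin_ext_fscale)

lemma tensor_perm_in_free_on:
  assumes "\<sigma> permutes {..<n}" "x \<in> free_on (words n q)"
  shows "tensor_perm \<sigma> x \<in> free_on (words n q)"
  using assms(2) unfolding tensor_perm_def
  by (intro lin_ext_in_subspace subspace_free_on) (auto simp: free_on_def words_map[OF assms(1)])

lemma ev_tensor_perm:
  assumes y: "y \<in> free_on (diagrams q r)" and \<sigma>: "\<sigma> permutes {..<n}" and v: "v \<in> free_on (words n q)"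
  shows "ev n r y (tensor_perm \<sigma> v) = tensor_perm \<sigma> (ev n r y v)"
  using y
proof (induction rule: free_on_induct)
  case (basis x)
  show ?case
  proof (rule poly_mapping_eqI)
    fix w
    have b: "bij_betw (map \<sigma>) (words n q) (words n q)"
      by (rule bij_betw_byWitness[of _ "map (invf \<sigma>)"])
        (auto simp: words_map[OF \<sigma>] words_map[OF permutes_inv[OF \<sigma>]] comp_def permutes_inverses[OF \<sigma>])
    have \<sigma>inv: "map (invf \<sigma>) (map \<sigma> v') = v'" "map \<sigma> (map (invf \<sigma>) v') = v'" for v'
      by (simp_all add: comp_def permutes_inverses[OF \<sigma>])
    show "coef (ev n r (basis x) (tensor_perm \<sigma> v)) w = coef (tensor_perm \<sigma> (ev n r (basis x) v)) w"
    proof (cases "w \<in> words n r")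
      case True
      have w': "map (invf \<sigma>) w \<in> words n r" using True words_map[OF permutes_inv[OF \<sigma>]] by simp
      have "(\<Sum>v'\<in>words n q. if compatible x v' w then coef (tensor_perm \<sigma> v) v' else 0) =
        (\<Sum>v'\<in>words n q. if compatible x (map \<sigma> v') w then coef (tensor_perm \<sigma> v) (map \<sigma> v') else 0)"
        by (rule sum.reindex_bij_betw[OF b, symmetric])
      also have "\<dots> = (\<Sum>v'\<in>words n q. if compatible x v' (map (invf \<sigma>) w) then coef v v' else 0)"
      proof (rule sum.cong[OF refl])
        fix v' assume v': "v' \<in> words n q"
        have "compatible x (map \<sigma> v') w \<longleftrightarrow> compatible x v' (map (invf \<sigma>) w)"
          using compatible_map_inj[OF basis words_length[OF v'] words_length[OF w'] permutes_inj[OF \<sigma>]]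
          by (simp only: \<sigma>inv)
        then show "(if compatible x (map \<sigma> v') w then coef (tensor_perm \<sigma> v) (map \<sigma> v') else 0) =
          (if compatible x v' (map (invf \<sigma>) w) then coef v v' else 0)"
          by (simp only: coef_tensor_perm[OF permutes_bij[OF \<sigma>]] \<sigma>inv)
      qed
      finally show ?thesis
        using True w' by (simp add: coef_ev[OF v] coef_ev[OF tensor_perm_in_free_on[OF \<sigma> v]]
            coef_tensor_perm[OF permutes_bij[OF \<sigma>], of "ev n r (basis x) v"])
    next
      case False
      then have "map (invf \<sigma>) w \<notin> words n r" using words_map[OF permutes_inv[OF \<sigma>]] by simp
      then show ?thesis using False
        by (simp add: free_on_coef[OF ev_in_free_on] coef_tensor_perm[OF permutes_bij[OF \<sigma>]])
    qed
  qed
qed (simp_all add: ev_linear tensor_perm_linear)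

lemma Psi_specht_perm:
  assumes z: "z \<in> pre_inflation r" and \<sigma>: "\<sigma> permutes {..<n}"
  shows "Psi r z (specht_perm \<sigma> u) = tensor_perm \<sigma> (Psi r z u)"
  using z
proof (induction rule: free_on_induct)
  case (basis sy)
  then obtain s y where sy: "sy = (s, y)" "y \<in> free_on (diagrams p r)"
    using prop_diagrams_subset by (cases sy) blast
  then show ?case by (simp add: Psi_basis phi_specht_perm[OF \<sigma>] ev_tensor_perm[OF _ \<sigma>])
qed (simp_all add: Psi_linear tensor_perm_linear)

lemma Psi_in_hom_space:
  assumes z: "z \<in> pre_inflation r"
  shows "restrict (Psi r z) (specht \<mu>) \<in> hom_space n \<mu> r"
proof -
  have "specht_perm \<sigma> u \<in> specht \<mu>" if "\<sigma> permutes {..<n}" "u \<in> specht \<mu>" for \<sigma> and u :: "_ \<Rightarrow>\<^sub>0 'a"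
    using specht_perm_specht[of \<sigma> \<mu> u] that sum_list_mu by simp
  then show ?thesis unfolding hom_space_def
    by (auto simp: Psi_in_free_on specht_add specht_scale Psi_linear_right Psi_specht_perm[OF z])
qed

text \<open>The formula on representatives that occurs inside \<open>inflation_act\<close>.\<close>

definition act :: "(diagram \<Rightarrow>\<^sub>0 'k::field) \<Rightarrow> ((nat set list \<Rightarrow>\<^sub>0 'k) \<times> (diagram \<Rightarrow>\<^sub>0 'k) \<Rightarrow>\<^sub>0 'k) \<Rightarrow>
    ((nat set list \<Rightarrow>\<^sub>0 'k) \<times> (diagram \<Rightarrow>\<^sub>0 'k) \<Rightarrow>\<^sub>0 'k)" where
  "act a z = lin_ext (\<lambda>(u, w). basis (u, prop_truncate p (dmult (of_nat n) w a))) z"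

lemma act_in_pre_inflation:
  assumes z: "z \<in> pre_inflation r" and a: "a \<in> free_on (diagrams r s)"
  shows "act a z \<in> pre_inflation s"
  unfolding act_def
proof (intro lin_ext_in_subspace subspace_free_on)
  fix sy assume "sy \<in> Poly_Mapping.keys z"
  then obtain t y where sy: "sy = (t, y)" "t \<in> specht \<nu>" "y \<in> free_on (prop_diagrams p r p)"
    using z unfolding free_on_def[of "specht \<nu> \<times> _"] by (cases sy) blast
  then have "y \<in> free_on (diagrams p r)" using prop_diagrams_subset by blast
  from prop_truncate_in_free_on[OF dmult_in_free_on[OF this a]]
  show "(case sy of (u, w) \<Rightarrow> basis (u, prop_truncate p (dmult (of_nat n) w a))) \<in> pre_inflation s"
    using sy by simp
qed

text \<open>Here \<open>s\<close> may differ from \<open>r\<close>, so this gives naturality as well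
  as compatibility with the partition algebra.\<close>

lemma Psi_act:
  fixes u :: "nat set list \<Rightarrow>\<^sub>0 'k::field_char_0"
  assumes z: "z \<in> pre_inflation r" and a: "a \<in> free_on (diagrams r s)" and u: "u \<in> specht \<mu>"
  shows "Psi s (act a z) u = ev n s a (Psi r z u)"
  using z
proof (induction rule: free_on_induct)
  case (basis sy)
  then obtain t y where sy: "sy = (t, y)" "y \<in> free_on (diagrams p r)"
    using prop_diagrams_subset by (cases sy) blast
  then show ?case
    using ev_prop_truncate[OF dmult_in_free_on[OF sy(2) a] u, where s = t]
    by (simp add: act_def Psi_basis ev_dmult[OF sy(2) a phi_in_free_on])
qed (simp_all add: act_def lin_ext_add lin_ext_fscale Psi_linear ev_linear)

end

section \<open>Injectivity\<close>

context long_first_row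
begin

text \<open>One Specht vector for every diagram, not for every orbit of diagrams under permutations
  of the top row. Such a form is not unique, and the freedom is used to shrink its support.\<close>

abbreviation normal_form :: "nat \<Rightarrow> (diagram \<Rightarrow> (nat set list \<Rightarrow>\<^sub>0 'k::field)) \<Rightarrow>
    ((nat set list \<Rightarrow>\<^sub>0 'k) \<times> (diagram \<Rightarrow>\<^sub>0 'k) \<Rightarrow>\<^sub>0 'k)" where
  "normal_form r S \<equiv> (\<Sum>y\<in>prop_diagrams p r p. basis (S y, basis y))"

lemma relators_span:
  fixes s s' :: "nat set list \<Rightarrow>\<^sub>0 'k::field"
  assumes "s \<in> specht \<nu>" "w \<in> free_on (prop_diagrams p r p)"
  shows "s' \<in> specht \<nu> \<Longrightarrow> basis (s + s', w) - basis (s, w) - basis (s', w) \<in> fvs.span (relators r)"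
    and "w' \<in> free_on (prop_diagrams p r p) \<Longrightarrow>
      basis (s, w + w') - basis (s, w) - basis (s, w') \<in> fvs.span (relators r)"
    and "basis (fscale c s, w) - fscale c (basis (s, w)) \<in> fvs.span (relators r)"
    and "basis (s, fscale c w) - fscale c (basis (s, w)) \<in> fvs.span (relators r)"
    and "\<sigma> permutes {..<p} \<Longrightarrow> basis (specht_ract s (basis \<sigma>), w) -
      basis (s, diagram_lact (of_nat n) p (basis \<sigma>) w) \<in> fvs.span (relators r)"
proof -
  show "s' \<in> specht \<nu> \<Longrightarrow> basis (s + s', w) - basis (s, w) - basis (s', w) \<in> fvs.span (relators r)"
    by (rule fvs.span_base, unfold tensor_relators_def, intro UnI1 CollectI) (use assms in blast)
  show "w' \<in> free_on (prop_diagrams p r p) \<Longrightarrow>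
      basis (s, w + w') - basis (s, w) - basis (s, w') \<in> fvs.span (relators r)"
    by (rule fvs.span_base, unfold tensor_relators_def, rule UnI1, rule UnI1, rule UnI1, rule UnI2, rule CollectI)
      (use assms in blast)
  show "basis (fscale c s, w) - fscale c (basis (s, w)) \<in> fvs.span (relators r)"
    by (rule fvs.span_base, unfold tensor_relators_def, rule UnI1, rule UnI1, rule UnI2, rule CollectI)
      (use assms in blast)
  show "basis (s, fscale c w) - fscale c (basis (s, w)) \<in> fvs.span (relators r)"
    by (rule fvs.span_base, unfold tensor_relators_def, rule UnI1, rule UnI2, rule CollectI)
      (use assms in blast)
  assume \<sigma>: "\<sigma> permutes {..<p}"
  have "basis \<sigma> \<in> carrier (sym_group_algebra p)" using \<sigma> by (simp add: sym_group_algebra_def)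
  then show "basis (specht_ract s (basis \<sigma>), w) -
      basis (s, diagram_lact (of_nat n) p (basis \<sigma>) w) \<in> fvs.span (relators r)"
    by (intro fvs.span_base, unfold tensor_relators_def, intro UnI2 CollectI) (use assms in blast)
qed

lemma relators_span_zero:
  "w \<in> free_on (prop_diagrams p r p) \<Longrightarrow> basis (0, w) \<in> fvs.span (relators r)"
  "s \<in> specht \<nu> \<Longrightarrow> basis (s, 0) \<in> fvs.span (relators r)"
  using relators_span(3)[OF specht_0, of w r 0] relators_span(4)[of s 0 r 0] by simp_all

text \<open>The bilinearity relators allow expanding every second component in diagrams and
  collecting the first components that belong to the same diagram. \<open>P\<close> is stable under
  congruence, sums and scalars, so only pairs of a vector and a diagram remain.\<close>

lemma ex_normal_form:
  fixes z :: "(nat set list \<Rightarrow>\<^sub>0 'k::field) \<times> (diagram \<Rightarrow>\<^sub>0 'k) \<Rightarrow>\<^sub>0 'k"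
  assumes "z \<in> pre_inflation r"
  shows "\<exists>S. (\<forall>y. S y \<in> specht \<nu>) \<and> z - normal_form r S \<in> fvs.span (relators r)"
proof -
  let ?D = "prop_diagrams p r p" and ?R = "fvs.span (relators r) :: (_ \<times> (diagram \<Rightarrow>\<^sub>0 'k) \<Rightarrow>\<^sub>0 'k) set"
  define P where "P z \<longleftrightarrow> (\<exists>S. (\<forall>y. S y \<in> specht \<nu>) \<and> z - normal_form r S \<in> ?R)" for z
  have cong: "P z'" if z: "P z" and z': "z' - z \<in> ?R" for z z'
  proof -
    obtain S where "\<forall>y. S y \<in> specht \<nu>" "z - normal_form r S \<in> ?R" using z unfolding P_def by blast
    moreover from this(2) have "(z' - z) + (z - normal_form r S) \<in> ?R" by (rule fvs.span_add[OF z'])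
    ultimately have "\<forall>y. S y \<in> specht \<nu>" "z' - normal_form r S \<in> ?R" by simp_all
    then show ?thesis unfolding P_def by blast
  qed
  have zero: "P 0"
  proof -
    have "normal_form r (\<lambda>_. 0) \<in> ?R" by (intro fvs.span_sum relators_span_zero(1)) auto
    then have "0 - normal_form r (\<lambda>_. 0) \<in> ?R" by (metis diff_0 fvs.span_neg)
    then show ?thesis unfolding P_def by (intro exI[of _ "\<lambda>_. 0"]) (simp add: specht_0)
  qed
  have add: "P (z + z')" if z: "P z" "P z'" for z z'
  proof -
    obtain S S' where S: "\<forall>y. S y \<in> specht \<nu>" "z - normal_form r S \<in> ?R"
      and S': "\<forall>y. S' y \<in> specht \<nu>" "z' - normal_form r S' \<in> ?R" using z unfolding P_def by blast
    have "(\<Sum>y\<in>?D. basis (S y + S' y, basis y) - basis (S y, basis y) - basis (S' y, basis y)) \<in> ?R"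
      using S S' by (intro fvs.span_sum relators_span(1)) auto
    then have nf: "normal_form r (\<lambda>y. S y + S' y) - normal_form r S - normal_form r S' \<in> ?R"
      by (simp add: sum_subtractf)
    have "(z - normal_form r S) + (z' - normal_form r S') -
      (normal_form r (\<lambda>y. S y + S' y) - normal_form r S - normal_form r S') \<in> ?R"
      by (rule fvs.span_diff[OF fvs.span_add[OF S(2) S'(2)] nf])
    then have "z + z' - normal_form r (\<lambda>y. S y + S' y) \<in> ?R" by (simp add: algebra_simps)
    then show ?thesis unfolding P_def using S S' by (intro exI[of _ "\<lambda>y. S y + S' y"]) (simp add: specht_add)
  qed
  have scale: "P (fscale c z)" if z: "P z" for c z
  proof -
    obtain S where S: "\<forall>y. S y \<in> specht \<nu>" "z - normal_form r S \<in> ?R" using z unfolding P_def by blast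
    have "(\<Sum>y\<in>?D. basis (fscale c (S y), basis y) - fscale c (basis (S y, basis y))) \<in> ?R"
      using S by (intro fvs.span_sum relators_span(3)) auto
    then have nf: "normal_form r (\<lambda>y. fscale c (S y)) - fscale c (normal_form r S) \<in> ?R"
      by (simp add: sum_subtractf fvs.scale_sum_right)
    have "fscale c (z - normal_form r S) -
      (normal_form r (\<lambda>y. fscale c (S y)) - fscale c (normal_form r S)) \<in> ?R"
      by (rule fvs.span_diff[OF fvs.span_scale[OF S(2)] nf])
    then have "fscale c z - normal_form r (\<lambda>y. fscale c (S y)) \<in> ?R"
      by (simp add: algebra_simps fvs.scale_right_diff_distrib)
    then show ?thesis unfolding P_def using S by (intro exI[of _ "\<lambda>y. fscale c (S y)"]) (simp add: specht_scale)
  qed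
  have "P z"
    using assms
  proof (induction rule: free_on_induct)
    case (basis sw)
    then obtain s w where sw: "sw = (s, w)" "s \<in> specht \<nu>" "w \<in> free_on ?D" by blast
    have "P (basis (s, w))"
      using sw(3)
    proof (induction rule: free_on_induct)
      case zero
      show ?case by (rule cong[OF \<open>P 0\<close>]) (use relators_span_zero(2)[OF sw(2)] in simp)
    next
      case (add w w')
      have "basis (s, w + w') - (basis (s, w) + basis (s, w')) \<in> ?R"
        using relators_span(2)[OF sw(2) add(1,2)] by (simp add: algebra_simps)
      then show ?case by (rule cong[OF \<open>\<And>z z'. P z \<Longrightarrow> P z' \<Longrightarrow> P (z + z')\<close>[OF add(3,4)]])
    next
      case (scale c w)
      show ?case by (rule cong[OF \<open>\<And>c z. P z \<Longrightarrow> P (fscale c z)\<close>[OF scale(2)]]) (rule relators_span(4)[OF sw(2) scale(1)])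
    next
      case (basis y0)
      define S where "S y = (if y = y0 then s else 0)" for y
      have "normal_form r S = basis (s, basis y0) + (\<Sum>y\<in>?D - {y0}. basis (0, basis y))"
        by (subst sum.remove[OF finite_prop_diagrams basis]) (simp add: S_def)
      moreover have "- (\<Sum>y\<in>?D - {y0}. basis (0, basis y)) \<in> ?R"
        by (intro fvs.span_neg fvs.span_sum relators_span_zero(1)) auto
      ultimately have "basis (s, basis y0) - normal_form r S \<in> ?R" by simp
      then show ?case unfolding P_def using sw(2) by (intro exI[of _ S]) (simp add: S_def specht_0)
    qed
    then show ?case by (simp add: sw(1))
  qed (rule zero add scale; assumption?)+
  then show ?thesis by (simp add: P_def)
qed

text \<open>The balancing relator moves the vector at \<open>y\<close> over to \<open>y0\<close>.
  Composition with a permutation diagram creates no loops and \<open>y\<close> still has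
  \<open>p\<close> propagating blocks, so neither the parameter nor the truncation
  interferes.\<close>

lemma normal_form_merge:
  fixes S :: "diagram \<Rightarrow> (nat set list \<Rightarrow>\<^sub>0 'k::field)"
  assumes S: "\<And>y. S y \<in> specht \<nu>" and y: "y \<in> prop_diagrams p r p" "y0 \<in> prop_diagrams p r p" "y \<noteq> y0"
    and \<sigma>: "\<sigma> permutes {..<p}" "y = dcomp (perm_diagram p \<sigma>) y0"
  defines "S' \<equiv> S(y := 0, y0 := S y0 + specht_ract (S y) (basis \<sigma>))"
  shows "\<And>y. S' y \<in> specht \<nu>" "normal_form r S - normal_form r S' \<in> fvs.span (relators r)"
proof -
  let ?R = "fvs.span (relators r) :: (_ \<times> (diagram \<Rightarrow>\<^sub>0 'k) \<Rightarrow>\<^sub>0 'k) set"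
  let ?t = "specht_ract (S y) (basis \<sigma> :: _ \<Rightarrow>\<^sub>0 'k)"
  have t: "?t \<in> specht \<nu>" using \<sigma>(1) by (intro specht_ract_in S) simp
  then show "S' y \<in> specht \<nu>" for y using S by (simp add: S'_def specht_0 specht_add)
  have b: "basis y \<in> free_on (prop_diagrams p r p)" "basis y0 \<in> free_on (prop_diagrams p r p)" using y by simp_all
  have y0: "y0 \<in> diagrams p r" and py: "prop_number y = p" using y by (simp_all add: prop_diagrams_def)
  have "diagram_lact (of_nat n) p (basis \<sigma>) (basis y0) = (basis y :: _ \<Rightarrow>\<^sub>0 'k)"
    using py by (simp add: diagram_lact_def dmult_basis dcomp_perm_diagram(1)[OF \<sigma>(1) y0] \<sigma>(2)[symmetric] prop_truncate_basis)
  then have 1: "basis (?t, basis y0) - basis (S y, basis y) \<in> ?R"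
    using relators_span(5)[OF S b(2) \<sigma>(1), of y] by simp
  have 2: "basis (S y0 + ?t, basis y0) - basis (S y0, basis y0) - basis (?t, basis y0) \<in> ?R"
    by (rule relators_span(1)[OF S b(2) t])
  have split: "normal_form r F = basis (F y, basis y) + basis (F y0, basis y0) +
      (\<Sum>y\<in>prop_diagrams p r p - {y} - {y0}. basis (F y, basis y))" for F :: "diagram \<Rightarrow> (nat set list \<Rightarrow>\<^sub>0 'k)"
    using y by (simp add: sum.remove[of _ y] sum.remove[of _ y0] add.assoc)
  have rest: "(\<Sum>y\<in>prop_diagrams p r p - {y} - {y0}. basis (S' y, basis y)) =
     (\<Sum>y\<in>prop_diagrams p r p - {y} - {y0}. basis (S y, basis y))"
    by (rule sum.cong) (auto simp: S'_def)
  have "normal_form r S - normal_form r S' =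
    - (basis (?t, basis y0) - basis (S y, basis y)) -
    (basis (S y0 + ?t, basis y0) - basis (S y0, basis y0) - basis (?t, basis y0)) - basis (0, basis y)"
    unfolding split rest using y(3) by (simp add: S'_def)
  also have "\<dots> \<in> ?R"
    by (rule fvs.span_diff[OF fvs.span_diff[OF fvs.span_neg[OF 1] 2] relators_span_zero(1)[OF b(1)]])
  finally show "normal_form r S - normal_form r S' \<in> ?R" .
qed

text \<open>The first row decreases, so the entries above the cells of \<open>\<nu>\<close>, which
  sit in the first columns, are the largest letters. This keeps them away from a test word written
  in the smallest letters.\<close>

lemma ex_tableau_over:
  assumes \<tau>: "\<tau> \<in> tableaux \<nu>"
  obtains t where "t \<in> tableaux \<mu>" "\<And>j. j < m \<Longrightarrow> t (0, j) = n - 1 - j" "lower_rows t = \<tau>"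
    "(\<lambda>j. t (0, j)) ` {..<m} = {p..<p + m}"
proof -
  define t where "t = (\<lambda>(i, j). if i = 0 then n - 1 - j else \<tau> (i - 1, j))"
  have row: "(\<lambda>j. t (0, j)) ` {..<m} = {p..<p + m}"
  proof
    show "(\<lambda>j. t (0, j)) ` {..<m} \<subseteq> {p..<p + m}" using n by (auto simp: t_def)
    show "{p..<p + m} \<subseteq> (\<lambda>j. t (0, j)) ` {..<m}"
    proof
      fix x assume "x \<in> {p..<p + m}"
      then show "x \<in> (\<lambda>j. t (0, j)) ` {..<m}" using n by (intro image_eqI[of _ _ "n - 1 - x"]) (auto simp: t_def)
    qed
  qed
  have tS: "t (Suc i, j) = \<tau> (i, j)" for i j by (simp add: t_def)
  have lt: "\<tau> (i, j) < p" if "(i, j) \<in> cells \<nu>" for i j using tableauxD(2)[OF \<tau> that] .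
  have ge: "p \<le> t (0, j)" if "j < m" for j using n that by (simp add: t_def)
  have "inj_on t (cells \<mu>)"
  proof (rule inj_onI)
    fix c d assume c: "c \<in> cells \<mu>" and d: "d \<in> cells \<mu>" and eq: "t c = t d"
    obtain i j i' j' where cd: "c = (i, j)" "d = (i', j')" by (cases c; cases d) blast
    show "c = d"
    proof (cases i; cases i')
      assume "i = 0" "i' = 0"
      then show ?thesis using c d eq cd n by (simp add: t_def)
    next
      fix k assume k: "i = 0" "i' = Suc k"
      then have "p \<le> t c" "t d < p" using c d cd ge lt[of k j'] by (simp_all add: tS)
      then show ?thesis using eq by simp
    next
      fix k assume k: "i = Suc k" "i' = 0"
      then have "p \<le> t d" "t c < p" using c d cd ge lt[of k j] by (simp_all add: tS)
      then show ?thesis using eq by simp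
    next
      fix k k' assume "i = Suc k" "i' = Suc k'"
      then show ?thesis using c d cd eq tableauxD(1)[OF \<tau>, of "(k, j)" "(k', j')"] by (simp add: tS)
    qed
  qed
  moreover have "t ` cells \<mu> = {..<sum_list \<mu>}"
  proof -
    have "t ` cells \<mu> = (\<lambda>j. t (0, j)) ` {..<m} \<union> \<tau> ` cells \<nu>"
    proof (intro equalityI subsetI)
      fix x assume "x \<in> t ` cells \<mu>"
      then obtain i j where ij: "(i, j) \<in> cells \<mu>" "x = t (i, j)" by auto
      show "x \<in> (\<lambda>j. t (0, j)) ` {..<m} \<union> \<tau> ` cells \<nu>"
      proof (cases i)
        case 0
        then show ?thesis using ij by auto
      next
        case (Suc k)
        then have "(k, j) \<in> cells \<nu>" "x = \<tau> (k, j)" using ij by (simp_all add: tS)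
        then show ?thesis by blast
      qed
    next
      fix x assume "x \<in> (\<lambda>j. t (0, j)) ` {..<m} \<union> \<tau> ` cells \<nu>"
      then consider j where "j < m" "x = t (0, j)" | i j where "(i, j) \<in> cells \<nu>" "x = t (Suc i, j)"
        by (auto simp: tS)
      then show "x \<in> t ` cells \<mu>"
      proof cases
        case (1 j)
        then show ?thesis by (intro image_eqI[of _ _ "(0, j)"]) simp_all
      next
        case (2 i j)
        then show ?thesis by (intro image_eqI[of _ _ "(Suc i, j)"]) simp_all
      qed
    qed
    then show ?thesis using tableauxD(3)[OF \<tau>] row by auto
  qed
  ultimately have "t \<in> tableaux \<mu>" by (simp add: tableaux_def bij_betw_def)
  then show ?thesis using that[of t] row by (simp add: t_def lower_rows_def)
qed

text \<open>Above a cell of \<open>\<nu>\<close> stands \<open>n - 1 - j\<close> with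
  \<open>j < p\<close>, which is at least \<open>n - p \<ge> k\<close> and so not a letter of
  \<open>v\<close>. The complement of \<open>set v\<close> thus contains all entries above the lower
  rows but is not the first row of \<open>t\<close>, and \<open>coef_polytabloid_other_top\<close>
  applies.\<close>

lemma dual_other_support:
  fixes s :: "nat set list \<Rightarrow>\<^sub>0 'k::field"
  assumes t: "t \<in> tableaux \<mu>" "\<And>j. j < m \<Longrightarrow> t (0, j) = n - 1 - j" "(\<lambda>j. t (0, j)) ` {..<m} = {p..<p + m}"
    and v: "set v \<subseteq> {..<k}" "set v \<noteq> {..<p}" and k: "p + k \<le> n"
  shows "dual s (polytabloid \<mu> t) v = 0"
proof -
  have "coef (polytabloid \<mu> t :: _ \<Rightarrow>\<^sub>0 'k) (fill n v U) = 0" for U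
    unfolding fill_def
  proof (rule coef_polytabloid_other_top[OF t(1)])
    fix i j assume ij: "(i, j) \<in> cells \<nu>"
    then have "j < \<nu> ! i" "i < length \<nu>" by (simp_all add: cells_def)
    then have "j < p" using member_le_sum_list[OF nth_mem, of i \<nu>] by linarith
    moreover have "j < m" using cells_lt[OF ij] .
    ultimately have "k \<le> t (0, j)" "t (0, j) < n" using t(2) k by simp_all
    then show "t (0, j) \<in> {..<n} - set v" using v(1) by auto
  next
    have "set v = {..<p}" if "{..<n} - set v = {p..<p + m}"
    proof -
      have "set v \<subseteq> {..<n}" using v(1) k by auto
      then have "set v = {..<n} - ({..<n} - set v)" by blast
      also have "\<dots> = {..<p}" unfolding that using n by auto
      finally show ?thesis .
    qed
    then show "{..<n} - set v \<noteq> (\<lambda>j. t (0, j)) ` {..<m}" unfolding t(3) using v(2) by blast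
  qed
  then show ?thesis by (simp add: dual_def)
qed

lemma dual_upt:
  assumes t: "t \<in> tableaux \<mu>" "(\<lambda>j. t (0, j)) ` {..<m} = {p..<p + m}"
  shows "dual s (polytabloid \<mu> t) [0..<p] = pairing \<nu> s (polytabloid \<nu> (lower_rows t))"
proof -
  have "coef (polytabloid \<mu> t) (fill n [0..<p] U) = coef (polytabloid \<nu> (lower_rows t) :: _ \<Rightarrow>\<^sub>0 'a) U"
    if U: "U \<in> tabloids \<nu>" for U
  proof -
    have "(!) [0..<p] ` A = A" if "A \<in> set U" for A
    proof -
      have "A \<subseteq> {..<p}" using tabloidsD(4)[OF U] that by blast
      then have "(!) [0..<p] ` A = id ` A" by (intro image_cong) auto
      then show ?thesis by simp
    qed
    then have "map ((`) ((!) [0..<p])) U = U" by (intro map_idI)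
    moreover have "{..<n} - set [0..<p] = {p..<p + m}" using n by auto
    ultimately have "fill n [0..<p] U = {p..<p + m} # U" by (simp only: fill_def)
    then show ?thesis using coef_polytabloid_same_top[OF t cells_lt, where ?'a = 'a] by simp
  qed
  then show ?thesis unfolding dual_def pairing_def by simp
qed

text \<open>The top points lie in distinct blocks, so the blocks can be numbered with the block of
  the top point \<open>i\<close> receiving \<open>i\<close>. Every block reaches the bottom row, so
  all numbers occur in \<open>w\<close>.\<close>

lemma ex_labelling:
  assumes y: "y \<in> prop_diagrams p r p"
  obtains w where "length w = r" "set w = {..<card y}" "y = kernel_diagram [0..<p] w"
proof -
  have yd: "y \<in> diagrams p r" and py: "prop_number y = p" using y by (simp_all add: prop_diagrams_def)
  note top = prop_number_eq_top[OF yd py]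
  let ?Q = "{..<p} <+> {..<r}"
  let ?k = "card y"
  obtain g where "bij_betw g y {0..<?k}" using ex_bij_betw_finite_nat[OF finite_diagram[OF yd]] by blast
  then have g: "inj_on g y" "g ` y = {..<?k}" by (auto simp: bij_betw_def lessThan_atLeast0)
  define f where "f i = g (block_of y (Inl i))" for i
  have m: "block_of y q \<in> y" "q \<in> block_of y q" if "q \<in> ?Q" for q using block_of_mem[OF yd that] .
  have fk: "f ` {..<p} \<subseteq> {..<?k}" using g(2) m(1) unfolding f_def by blast
  have finj: "inj_on f {..<p}"
  proof (rule inj_onI)
    fix i i' assume i: "i \<in> {..<p}" "i' \<in> {..<p}" and eq: "f i = f i'"
    have Q: "Inl i \<in> ?Q" "Inl i' \<in> ?Q" using i by blast+
    have "block_of y (Inl i) = block_of y (Inl i')"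
      using inj_onD[OF g(1) eq[unfolded f_def]] m(1)[OF Q(1)] m(1)[OF Q(2)] by simp
    then have "same_block y (Inl i) (Inl i')"
      using m[OF Q(1)] m[OF Q(2)] unfolding same_block_def by metis
    then show "i = i'" using top(1) i by simp
  qed
  have "p = card (f ` {..<p})" using finj by (simp add: card_image)
  also have "\<dots> \<le> ?k" using card_mono[OF _ fk] by simp
  finally have pk: "{..<p} \<subseteq> {..<?k}" by auto
  \<comment> \<open>\<open>\<beta>\<close> will correct the arbitrary numbering \<open>g\<close> at
    the blocks of the top points.\<close>
  obtain \<beta> where \<beta>: "\<beta> permutes {..<?k}" "\<And>i. i \<in> {..<p} \<Longrightarrow> \<beta> i = f i"
    using extend_to_permutation[OF _ pk fk finj] by blast
  define b where "b B = invf \<beta> (g B)" for B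
  have binj: "inj_on b y" unfolding b_def
    using g(1) permutes_inj[OF permutes_inv[OF \<beta>(1)]] by (auto simp: inj_on_def dest: injD)
  have bim: "b ` y = {..<?k}"
  proof -
    have "b ` y = invf \<beta> ` g ` y" by (auto simp: b_def)
    then show ?thesis using g(2) permutes_image[OF permutes_inv[OF \<beta>(1)]] by simp
  qed
  have btop: "b (block_of y (Inl i)) = i" if "i < p" for i
  proof -
    have "g (block_of y (Inl i)) = \<beta> i" using \<beta>(2) that by (simp add: f_def)
    then show ?thesis by (simp add: b_def permutes_inverses[OF \<beta>(1)])
  qed
  define w where "w = map (\<lambda>j. b (block_of y (Inr j))) [0..<r]"
  have lab: "label [0..<p] w q = b (block_of y q)" if "q \<in> ?Q" for q
    using that by (rule PlusE) (simp_all add: w_def btop)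
  have "length w = r" by (simp add: w_def)
  moreover have "set w = {..<?k}"
  proof -
    have "set w = (\<lambda>j. b (block_of y (Inr j))) ` {..<r}" by (auto simp: w_def)
    also have "\<dots> = b ` y"
    proof
      show "(\<lambda>j. b (block_of y (Inr j))) ` {..<r} \<subseteq> b ` y" using m(1) by blast
      show "b ` y \<subseteq> (\<lambda>j. b (block_of y (Inr j))) ` {..<r}"
      proof
        fix c assume "c \<in> b ` y"
        then obtain B where B: "B \<in> y" "c = b B" by blast
        then obtain j where "j < r" "Inr j \<in> B" using top(2) by blast
        then show "c \<in> (\<lambda>j. b (block_of y (Inr j))) ` {..<r}"
          using B block_of_eq[OF yd B(1)] by auto
      qed
    qed
    finally show ?thesis using bim by simp
  qed
  moreover have "y = kernel_diagram [0..<p] w"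
  proof (rule eq_kernel_diagramI)
    show "y \<in> diagrams (length [0..<p]) (length w)" using yd by (simp add: w_def)
    fix q q' assume "q \<in> {..<length [0..<p]} <+> {..<length w}" "q' \<in> {..<length [0..<p]} <+> {..<length w}"
    then have q: "q \<in> ?Q" "q' \<in> ?Q" by (simp_all add: w_def)
    have "b (block_of y q) = b (block_of y q') \<longleftrightarrow> block_of y q = block_of y q'"
      using binj m(1)[OF q(1)] m(1)[OF q(2)] by (simp add: inj_on_eq_iff)
    also have "\<dots> \<longleftrightarrow> same_block y q q'"
      using m[OF q(1)] m[OF q(2)] block_of_eq[OF yd] unfolding same_block_def by metis
    finally show "label [0..<p] w q = label [0..<p] w q' \<longleftrightarrow> same_block y q q'" using lab q by simp
  qed
  ultimately show ?thesis using that by blast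
qed

text \<open>Every block of \<open>y\<close> reaches the bottom row, so labelling maps the blocks
  onto the letters of \<open>w\<close>. With no more blocks than letters this map is a bijection,
  and \<open>y\<close> is the coarsest diagram compatible with the two words.\<close>

lemma compatible_coarse:
  assumes y: "y \<in> prop_diagrams p r p" and v: "length v = p" and w: "length w = r"
    and c: "compatible y v w" and card: "card y \<le> card (set w)"
  shows "y = kernel_diagram v w" "set v \<subseteq> set w"
proof -
  have yd: "y \<in> diagrams p r" and py: "prop_number y = p" using y by (simp_all add: prop_diagrams_def)
  note top = prop_number_eq_top[OF yd py]
  let ?Q = "{..<p} <+> {..<r}"
  define c where "c B = label v w (SOME q. q \<in> B)" for B
  have cB: "c B = label v w q" if B: "B \<in> y" "q \<in> B" for B q
  proof -
    have "(SOME q. q \<in> B) \<in> B" using B(2) by (rule someI)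
    then have "same_block y (SOME q. q \<in> B) q" unfolding same_block_def using B by blast
    then show ?thesis using assms(4) unfolding compatible_iff c_def by blast
  qed
  have sub: "set w \<subseteq> c ` y"
  proof
    fix a assume "a \<in> set w"
    then obtain j where j: "j < r" "w ! j = a" using w by (auto simp: in_set_conv_nth)
    then have Q: "Inr j \<in> ?Q" by blast
    from cB[OF block_of_mem[OF yd Q]] have "c (block_of y (Inr j)) = a" using j by simp
    then show "a \<in> c ` y" using block_of_mem(1)[OF yd Q] by blast
  qed
  have sup: "c ` y \<subseteq> set w"
  proof
    fix a assume "a \<in> c ` y"
    then obtain B where B: "B \<in> y" "a = c B" by blast
    then obtain j where j: "j < r" "Inr j \<in> B" using top(2) by blast
    then show "a \<in> set w" using cB[OF B(1) j(2)] B w by simp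
  qed
  have fin: "finite y" using finite_diagram[OF yd] .
  have "card (c ` y) = card y"
    using card_image_le[OF fin, of c] card sub sup by (simp add: subset_antisym)
  then have inj: "inj_on c y" using fin by (rule eq_card_imp_inj_on[rotated])
  show "y = kernel_diagram v w"
  proof (rule eq_kernel_diagramI)
    show "y \<in> diagrams (length v) (length w)" using yd v w by simp
    fix q q' assume "q \<in> {..<length v} <+> {..<length w}" "q' \<in> {..<length v} <+> {..<length w}"
    then have q: "q \<in> ?Q" "q' \<in> ?Q" by (simp_all add: v w)
    note m = block_of_mem[OF yd q(1)] and m' = block_of_mem[OF yd q(2)]
    have "label v w q = label v w q' \<longleftrightarrow> c (block_of y q) = c (block_of y q')"
      using cB[OF m] cB[OF m'] by simp
    also have "\<dots> \<longleftrightarrow> block_of y q = block_of y q'" using inj m(1) m'(1) by (simp add: inj_on_eq_iff)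
    also have "\<dots> \<longleftrightarrow> same_block y q q'"
      using m m' block_of_eq[OF yd] unfolding same_block_def by metis
    finally show "label v w q = label v w q' \<longleftrightarrow> same_block y q q'" .
  qed
  show "set v \<subseteq> set w"
  proof
    fix a assume "a \<in> set v"
    then obtain i where i: "i < p" "v ! i = a" using v by (auto simp: in_set_conv_nth)
    then have Q: "Inl i \<in> ?Q" by blast
    have "c (block_of y (Inl i)) = a" using cB[OF block_of_mem[OF yd Q]] i by simp
    then show "a \<in> set w" using sup block_of_mem(1)[OF yd Q] by blast
  qed
qed

end

context long_first_row
begin

text \<open>A word \<open>v\<close> using each of the letters \<open>0, ..., p - 1\<close> once is
  itself a permutation; composing with its inverse straightens the top word.\<close>

lemma kernel_merge:
  assumes v: "length v = p" "distinct v" "set v = {..<p}"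
  obtains \<sigma> where "\<sigma> permutes {..<p}"
    "kernel_diagram v w = dcomp (perm_diagram p \<sigma>) (kernel_diagram [0..<p] w)"
proof -
  define \<tau> where "\<tau> i = (if i < p then v ! i else i)" for i
  have "bij_betw ((!) v) {..<p} {..<p}" by (rule bij_betw_nth) (simp_all add: v)
  then have "bij_betw \<tau> {..<p} {..<p}" by (subst bij_betw_cong[of _ _ "(!) v"]) (simp_all add: \<tau>_def)
  then have \<tau>: "\<tau> permutes {..<p}" by (rule bij_imp_permutes) (simp add: \<tau>_def)
  have \<sigma>: "invf \<tau> permutes {..<p}" by (rule permutes_inv[OF \<tau>])
  have "map (\<lambda>i. v ! invf \<tau> i) [0..<p] = [0..<p]"
  proof (rule nth_equalityI)
    fix i assume "i < length (map (\<lambda>i. v ! invf \<tau> i) [0..<p])"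
    then have i: "i < p" by simp
    then have "invf \<tau> i < p" using permutes_in_image[OF \<sigma>, of i] by simp
    then have "v ! invf \<tau> i = \<tau> (invf \<tau> i)" by (simp add: \<tau>_def)
    then show "map (\<lambda>i. v ! invf \<tau> i) [0..<p] ! i = [0..<p] ! i"
      using i permutes_inverses(1)[OF \<tau>] by simp
  qed simp
  then show ?thesis using that[OF \<sigma>] kernel_diagram_permute[OF \<sigma> v(1), of w] by simp
qed

lemma coef_Psi_normal_form:
  "coef (Psi r (normal_form r S) u) w = (if w \<in> words n r then
     \<Sum>y\<in>prop_diagrams p r p. \<Sum>v\<in>words n p. if compatible y v w then dual (S y) u v else 0 else 0)"
  by (auto simp: Psi_linear Psi_basis lookup_sum coef_ev[OF phi_in_free_on] coef_phi intro!: sum.cong)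

text \<open>Among all normal forms of \<open>z\<close> take one with the fewest nonzero coefficients, so that no two of
  its diagrams differ by a permutation of the top row. A diagram \<open>y0\<close> of its support with the most
  blocks can be tested separately, on words whose kernel is the bottom row of \<open>y0\<close>.\<close>

lemma Psi_injective:
  fixes z :: "(nat set list \<Rightarrow>\<^sub>0 'k::field_char_0) \<times> (diagram \<Rightarrow>\<^sub>0 'k) \<Rightarrow>\<^sub>0 'k"
  assumes z: "z \<in> pre_inflation r" and r: "2 * r \<le> n" and ker: "\<And>u. u \<in> specht \<mu> \<Longrightarrow> Psi r z u = 0"
  shows "z \<in> fvs.span (relators r)"
proof -
  let ?D = "prop_diagrams p r p" and ?R = "fvs.span (relators r) :: (_ \<times> (diagram \<Rightarrow>\<^sub>0 'k) \<Rightarrow>\<^sub>0 'k) set"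
  define good where "good S \<longleftrightarrow> (\<forall>y. S y \<in> specht \<nu>) \<and> z - normal_form r S \<in> ?R" for S
  define supp where "supp S = {y \<in> ?D. S y \<noteq> 0}" for S :: "diagram \<Rightarrow> (nat set list \<Rightarrow>\<^sub>0 'k)"
  have fin: "finite (supp S)" for S by (simp add: supp_def)
  obtain S0 where "good S0" using ex_normal_form[OF z] unfolding good_def by blast
  from ex_has_least_nat[of good, OF this, of "\<lambda>S. card (supp S)"]
  obtain S where S: "good S" and least: "\<And>S'. good S' \<Longrightarrow> card (supp S) \<le> card (supp S')" by blast
  have Sy: "S y \<in> specht \<nu>" for y using S by (simp add: good_def)
  have "supp S = {}"
  proof (rule ccontr)
    assume "supp S \<noteq> {}"
    then have "Max (card ` supp S) \<in> card ` supp S" using fin by (intro Max_in) simp_all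
    then obtain y0 where y0: "y0 \<in> supp S" "Max (card ` supp S) = card y0" by blast
    have max: "card y \<le> card y0" if "y \<in> supp S" for y
      unfolding y0(2)[symmetric] using fin that by (intro Max_ge) simp_all
    have y0D: "y0 \<in> ?D" using y0 by (simp add: supp_def)
    obtain w where w: "length w = r" "set w = {..<card y0}" "y0 = kernel_diagram [0..<p] w"
      using ex_labelling[OF y0D] .
    define k where "k = card y0"
    have sw: "set w = {..<k}" using w(2) by (simp add: k_def)
    have "k \<le> r" using card_length[of w] w(1) sw by simp
    then have wW: "w \<in> words n r" using w(1) sw r by (auto simp: words_def)
    have c0: "compatible y0 [0..<p] w"
      unfolding w(3) by (subst compatible_kernel_diagram) (auto intro: exI[of _ id])
    have "set [0..<p] \<subseteq> set w"
      by (rule compatible_coarse(2)[OF y0D _ w(1) c0]) (simp_all add: w(2))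
    then have "p \<le> k" using sw card_mono[of "{..<k}" "{..<p}"] by (auto simp: lessThan_atLeast0)
    \<comment> \<open>From \<open>p \<le> k \<le> r\<close> and \<open>2 * r \<le> n\<close>: there
      is room for \<open>p\<close> letters outside the \<open>k\<close> letters of
      \<open>w\<close>.\<close>
    then have pk: "p + k \<le> n" using \<open>k \<le> r\<close> r by simp
    \<comment> \<open>Another diagram contributing at \<open>w\<close> through the same top letters
      would differ from \<open>y0\<close> by a permutation of the top row; merging it into
      \<open>y0\<close> would contradict the minimality of the support.\<close>
    have unique: "y = y0" if y: "y \<in> supp S" and v: "v \<in> words n p" "distinct v" "set v = {..<p}"
      and c: "compatible y v w" for y v
    proof (rule ccontr)
      assume ne: "y \<noteq> y0"
      have yD: "y \<in> ?D" using y by (simp add: supp_def)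
      have "y = kernel_diagram v w"
        by (rule compatible_coarse(1)[OF yD words_length[OF v(1)] w(1) c]) (use max[OF y] w(2) in simp)
      moreover obtain \<sigma> where \<sigma>: "\<sigma> permutes {..<p}"
        "kernel_diagram v w = dcomp (perm_diagram p \<sigma>) (kernel_diagram [0..<p] w)"
        using kernel_merge[OF words_length[OF v(1)] v(2,3)] .
      ultimately have "y = dcomp (perm_diagram p \<sigma>) y0" using w(3) by simp
      note merge = normal_form_merge[where S = S, OF Sy yD y0D ne \<sigma>(1) this]
      let ?S = "S(y := 0, y0 := S y0 + specht_ract (S y) (basis \<sigma>))"
      have "(z - normal_form r S) + (normal_form r S - normal_form r ?S) \<in> ?R"
        using S unfolding good_def by (intro fvs.span_add[OF _ merge(2)]) simp
      then have "z - normal_form r ?S \<in> ?R" by (simp only: diff_add_cancel add_diff_eq)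
      moreover have "\<forall>y'. ?S y' \<in> specht \<nu>" using merge(1) by blast
      ultimately have "good ?S" unfolding good_def by (intro conjI)
      have "supp ?S \<subseteq> supp S - {y}" using ne y0(1) by (auto simp: supp_def)
      then have "supp ?S \<subset> supp S" using y by blast
      then have "card (supp ?S) < card (supp S)" using fin by (intro psubset_card_mono)
      then show False using least[OF \<open>good ?S\<close>] by simp
    qed
    have "pairing \<nu> (S y0) (polytabloid \<nu> \<tau>) = 0" if \<tau>: "\<tau> \<in> tableaux \<nu>" for \<tau>
    proof -
      obtain t where t: "t \<in> tableaux \<mu>" "\<And>j. j < m \<Longrightarrow> t (0, j) = n - 1 - j" "lower_rows t = \<tau>"
        "(\<lambda>j. t (0, j)) ` {..<m} = {p..<p + m}" by (rule ex_tableau_over[OF \<tau>], rule that)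
      let ?e = "polytabloid \<mu> t :: _ \<Rightarrow>\<^sub>0 'k"
      have e: "?e \<in> specht \<mu>" by (rule polytabloid_in_specht[OF t(1)])
      have "Psi r (z - normal_form r S) ?e = 0"
        using S e by (intro Psi_relators) (simp_all add: good_def)
      then have "Psi r (normal_form r S) ?e = 0" using ker[OF e] by (simp add: Psi_linear)
      then have "0 = coef (Psi r (normal_form r S) ?e) w" by simp
      also have "\<dots> = (\<Sum>y\<in>?D. \<Sum>v\<in>words n p. if compatible y v w then dual (S y) ?e v else 0)"
        using wW by (simp add: coef_Psi_normal_form)
      \<comment> \<open>For \<open>y0\<close> compatibility with \<open>w\<close> fixes all letters
        and forces \<open>v = [0..<p]\<close>. For another diagram the vector vanishes, or
        \<open>v\<close> repeats a letter, or by \<open>unique\<close> the letters of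
        \<open>v\<close> are not \<open>{..<p}\<close> and the test polytabloid does not see
        them.\<close>
      also have "\<dots> = (\<Sum>y\<in>?D. \<Sum>v\<in>words n p. if y = y0 \<and> v = [0..<p] then dual (S y0) ?e [0..<p] else 0)"
      proof (intro sum.cong refl)
        fix y v assume y: "y \<in> ?D" and v: "v \<in> words n p"
        show "(if compatible y v w then dual (S y) ?e v else 0) =
          (if y = y0 \<and> v = [0..<p] then dual (S y0) ?e [0..<p] else 0)"
        proof (cases "y = y0")
          case True
          have "compatible y0 v w \<longleftrightarrow> v = [0..<p]"
          proof
            assume "compatible y0 v w"
            then obtain g where g: "v = map g [0..<p]" "w = map g w"
              unfolding w(3) by (subst (asm) compatible_kernel_diagram) (use words_length[OF v] in auto)
            have "g c = c" if "c \<in> set w" for c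
              using g(2) that by (metis in_set_conv_nth nth_map)
            then have "g i = i" if "i < p" for i using \<open>set [0..<p] \<subseteq> set w\<close> that by auto
            then show "v = [0..<p]" unfolding g(1) by (intro map_idI) simp
          qed (use c0 in simp)
          then show ?thesis using True by simp
        next
          case False
          have "dual (S y) ?e v = 0" if c: "compatible y v w"
          proof (cases "S y \<noteq> 0 \<and> distinct v")
            case True
            then have yS: "y \<in> supp S" using y by (simp add: supp_def)
            have "set v \<subseteq> {..<k}" unfolding sw[symmetric]
              by (rule compatible_coarse(2)[OF y words_length[OF v] w(1) c]) (use max[OF yS] w(2) in simp)
            moreover have "set v \<noteq> {..<p}" using unique[OF yS v _ _ c] True False by blast
            ultimately show ?thesis using dual_other_support[OF t(1,2,4) _ _ pk] by blast
          next
            case False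
            then show ?thesis by (auto simp: dual_linear) (simp add: dual_def)
          qed
          then show ?thesis using False by simp
        qed
      qed
      also have "\<dots> = (\<Sum>y\<in>?D. if y = y0 then \<Sum>v\<in>words n p. if v = [0..<p] then dual (S y0) ?e [0..<p] else 0 else 0)"
        by (intro sum.cong) auto
      also have "\<dots> = dual (S y0) ?e [0..<p]"
      proof -
        have "[0..<p] \<in> words n p" using n by (auto simp: words_def)
        then show ?thesis using y0D by (simp add: sum.delta)
      qed
      also have "\<dots> = pairing \<nu> (S y0) (polytabloid \<nu> \<tau>)" using dual_upt[OF t(1,4)] t(3) by simp
      finally show ?thesis ..
    qed
    then have "S y0 = 0" using pairing_nondegenerate[OF Sy] by blast
    then show False using y0 by (simp add: supp_def)
  qed
  then have "normal_form r S \<in> ?R"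
    by (intro fvs.span_sum) (auto simp: supp_def intro!: relators_span_zero(1))
  then have "(z - normal_form r S) + normal_form r S \<in> ?R"
    using S unfolding good_def by (intro fvs.span_add) simp_all
  then show ?thesis by simp
qed

end

section \<open>Surjectivity\<close>

context long_first_row
begin

text \<open>The shape of a coefficient, at a word with letter set \<open>W\<close>, of a combination
  of kernel diagrams of that word applied to the homomorphisms \<open>phi (S P)\<close>. One
  ordering of each \<open>P\<close> is enough: by \<open>dual_permute\<close> another ordering only
  changes \<open>S P\<close>.\<close>

definition representable :: "nat set \<Rightarrow> ((nat set list \<Rightarrow>\<^sub>0 'k::field) \<Rightarrow> 'k) \<Rightarrow> bool" where
  "representable W F \<longleftrightarrow> (\<exists>S. (\<forall>P. S P \<in> specht \<nu>) \<and> (\<forall>u\<in>specht \<mu>.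
     F u = (\<Sum>P | P \<subseteq> W \<and> card P = p. dual (S P) u (sorted_list_of_set P))))"

lemma representable_zero: "(\<And>u. u \<in> specht \<mu> \<Longrightarrow> F u = 0) \<Longrightarrow> representable W F"
  unfolding representable_def by (intro exI[of _ "\<lambda>_. 0"]) (simp add: specht_0 dual_linear)

lemma representable_add:
  assumes "representable W F" "representable W G"
  shows "representable W (\<lambda>u. F u + G u)"
proof -
  obtain S where S: "\<forall>P. S P \<in> specht \<nu>" "\<forall>u\<in>specht \<mu>.
     F u = (\<Sum>P | P \<subseteq> W \<and> card P = p. dual (S P) u (sorted_list_of_set P))"
    using assms(1) unfolding representable_def by blast
  obtain S' where S': "\<forall>P. S' P \<in> specht \<nu>" "\<forall>u\<in>specht \<mu>.
     G u = (\<Sum>P | P \<subseteq> W \<and> card P = p. dual (S' P) u (sorted_list_of_set P))"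
    using assms(2) unfolding representable_def by blast
  show ?thesis unfolding representable_def
    by (intro exI[of _ "\<lambda>P. S P + S' P"]) (simp add: S S' specht_add dual_linear sum.distrib)
qed

lemma representable_scale:
  assumes "representable W F"
  shows "representable W (\<lambda>u. c * F u)"
proof -
  obtain S where S: "\<forall>P. S P \<in> specht \<nu>" "\<forall>u\<in>specht \<mu>.
     F u = (\<Sum>P | P \<subseteq> W \<and> card P = p. dual (S P) u (sorted_list_of_set P))"
    using assms unfolding representable_def by blast
  show ?thesis unfolding representable_def
    by (intro exI[of _ "\<lambda>P. fscale c (S P)"]) (simp add: S specht_scale dual_linear sum_distrib_left)
qed

lemma representable_sum:
  "(\<And>i. i \<in> I \<Longrightarrow> representable W (F i)) \<Longrightarrow> representable W (\<lambda>u. \<Sum>i\<in>I. F i u)"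
proof (induction I rule: infinite_finite_induct)
  case (insert i I)
  then show ?case using representable_add[of W "F i" "\<lambda>u. \<Sum>i\<in>I. F i u"] by simp
qed (simp_all add: representable_zero)

lemma representable_cong:
  assumes "representable W F" "\<And>u. u \<in> specht \<mu> \<Longrightarrow> G u = F u"
  shows "representable W G"
  using assms unfolding representable_def by simp

text \<open>Only the set \<open>P\<close> of letters in the lower rows contributes. By
  \<open>restrict_word\<close> the coefficients of \<open>u\<close> over \<open>P\<close> form a
  vector of the Specht module of \<open>\<nu>\<close>, and by \<open>pairing_represents_coef\<close>
  its coefficient at the pattern of \<open>L\<close> is the pairing with some
  \<open>s\<close>.\<close>

lemma representable_coef:
  fixes W :: "nat set"
  assumes W: "W \<subseteq> {..<n}" and L: "\<Union>(set L) \<subseteq> W" and T: "R # L \<in> tabloids \<mu>"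
  shows "representable W (\<lambda>u :: _ \<Rightarrow>\<^sub>0 'k::field_char_0. coef u (R # L))"
proof -
  define P where "P = \<Union>(set L)"
  have disj: "R \<inter> P = {}"
  proof -
    have "R \<inter> A = {}" if A: "A \<in> set L" for A
    proof -
      obtain j where "j < length L" "A = L ! j" using A by (auto simp: in_set_conv_nth)
      then show ?thesis using tabloidsD(3)[OF T, of 0 "Suc j"] tabloidsD(1)[OF T] by simp
    qed
    then show ?thesis by (auto simp: P_def)
  qed
  have un: "R \<union> P = {..<n}" using tabloidsD(4)[OF T] sum_list_mu by (simp add: P_def)
  then have finP: "finite P" "finite R" using finite_Un[of R P] by (metis finite_lessThan)+
  have "card R = m" using tabloidsD(2)[OF T, of 0] by simp
  then have cP: "card P = p" using card_Un_disjoint[OF finP(2,1) disj] un n by simp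
  define v where "v = sorted_list_of_set P"
  have v: "set v = P" "distinct v" "length v = p" using finP cP by (simp_all add: v_def)
  have vW: "v \<in> words n p" using v un by (auto simp: words_def)
  \<comment> \<open>\<open>L\<close> pulled back to positions in \<open>v\<close>, so that filling
    in \<open>v\<close> recovers the tabloid.\<close>
  define U where "U = map (\<lambda>A. {i. i < p \<and> v ! i \<in> A}) L"
  have Up: "\<Union>(set U) \<subseteq> {..<p}" by (auto simp: U_def)
  have "map ((`) ((!) v)) U = L"
  proof (rule nth_equalityI)
    fix j assume "j < length (map ((`) ((!) v)) U)"
    then have j: "j < length L" by (simp add: U_def)
    then have "L ! j \<subseteq> set v" using v(1) by (auto simp: P_def)
    then have "(!) v ` {i. i < p \<and> v ! i \<in> L ! j} = L ! j" using v(3) by (auto simp: in_set_conv_nth subset_iff)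
    then show "map ((`) ((!) v)) U ! j = L ! j" using j by (simp add: U_def)
  qed (simp add: U_def)
  moreover have "{..<n} - P = R" using un disj by blast
  ultimately have fill: "fill n v U = R # L" by (simp add: fill_def v(1))
  obtain s where s: "s \<in> specht \<nu>" "\<And>s' :: _ \<Rightarrow>\<^sub>0 'k. s' \<in> specht \<nu> \<Longrightarrow> coef s' U = pairing \<nu> s s'"
    using pairing_represents_coef[of \<nu> U] by blast
  have ds: "dual s u v = coef u (R # L)" if u: "u \<in> specht \<mu>" for u :: "_ \<Rightarrow>\<^sub>0 'k"
  proof -
    have "\<exists>s\<in>specht \<nu>. \<forall>U. \<Union>(set U) \<subseteq> {..<p} \<longrightarrow> coef s U = coef u (fill n v U)"
      by (rule restrict_word[OF _ u n vW v(2)]) (rule cells_lt)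
    then obtain s' where s': "s' \<in> specht \<nu>"
      "\<And>U. \<Union>(set U) \<subseteq> {..<p} \<Longrightarrow> coef s' U = coef u (fill n v U)" by blast
    have "dual s u v = pairing \<nu> s s'"
      using v(2) s'(2) tabloidsD(4)[of _ \<nu>] by (simp add: dual_def pairing_def)
    also have "\<dots> = coef u (R # L)" using s(2)[OF s'(1)] s'(2)[OF Up] fill by simp
    finally show ?thesis .
  qed
  define S where "S P' = (if P' = P then s else 0)" for P'
  have finW: "finite {P. P \<subseteq> W \<and> card P = p}"
    by (rule finite_subset[of _ "Pow W"]) (use W finite_subset in auto)
  have "coef u (R # L) = (\<Sum>P | P \<subseteq> W \<and> card P = p. dual (S P) u (sorted_list_of_set P))"
    if u: "u \<in> specht \<mu>" for u
  proof -
    have "(\<Sum>P | P \<subseteq> W \<and> card P = p. dual (S P) u (sorted_list_of_set P)) =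
      (\<Sum>P' | P' \<subseteq> W \<and> card P' = p. if P' = P then coef u (R # L) else 0)"
      using ds[OF u] by (intro sum.cong) (simp_all add: S_def v_def dual_linear)
    also have "\<dots> = coef u (R # L)" using finW L cP by (simp add: sum.delta P_def)
    finally show ?thesis ..
  qed
  then show ?thesis unfolding representable_def
    by (intro exI[of _ S]) (simp add: S_def s(1) specht_0)
qed

text \<open>An unnormalised average over the pointwise stabilizer of \<open>W\<close>; the group
  order is divided out in \<open>representable_hom\<close>.\<close>

definition average :: "nat set \<Rightarrow> nat set list \<Rightarrow> (nat set list \<Rightarrow>\<^sub>0 'k::field) \<Rightarrow> 'k" where
  "average W T u = (\<Sum>\<sigma> | \<sigma> permutes {..<n} - W. coef u (map ((`) \<sigma>) T))"

lemma permutes_outside: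
  assumes "\<sigma> permutes {..<n} - W"
  shows "\<sigma> permutes {..<n}" "\<And>x. x \<in> W \<Longrightarrow> \<sigma> x = x"
  using permutes_subset[OF assms, of "{..<n}"] permutes_not_in[OF assms] by auto

lemma average_permute:
  assumes \<tau>: "\<tau> permutes {..<n} - W"
  shows "average W (map ((`) \<tau>) T) u = average W T u"
proof -
  have "average W T u = (\<Sum>\<sigma> | \<sigma> permutes {..<n} - W. coef u (map ((`) (\<sigma> \<circ> \<tau>)) T))"
    unfolding average_def
    by (rule sum.reindex_bij_betw[symmetric], rule bij_betw_byWitness[of _ "\<lambda>\<sigma>. \<sigma> \<circ> invf \<tau>"])
      (use \<tau> in \<open>auto simp: o_assoc[symmetric] permutes_inv_o[OF \<tau>] intro: permutes_compose permutes_inv\<close>)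
  also have "\<dots> = average W (map ((`) \<tau>) T) u"
    unfolding average_def by (intro sum.cong refl arg_cong[of _ _ "coef u"]) (simp add: image_comp)
  finally show ?thesis ..
qed

text \<open>The Garnir relations move the entries outside \<open>W\<close> to the first row, at the cost of terms with
  fewer such entries in the lower rows.\<close>

lemma representable_average:
  assumes W: "W \<subseteq> {..<n}"
  shows "representable W (average W T :: (_ \<Rightarrow>\<^sub>0 'k::field_char_0) \<Rightarrow> 'k)"
proof (induction "card (\<Union>(set (tl T)) - W)" arbitrary: T rule: less_induct)
  case less
  show ?case
  proof (cases "T \<in> tabloids \<mu>")
    case False
    have "map ((`) \<sigma>) T \<notin> tabloids \<mu>" if "\<sigma> permutes {..<n} - W" for \<sigma>
    proof
      assume "map ((`) \<sigma>) T \<in> tabloids \<mu>"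
      moreover have \<sigma>: "\<sigma> permutes {..<sum_list \<mu>}" using permutes_outside(1)[OF that] sum_list_mu by simp
      ultimately have "map ((`) (invf \<sigma>)) (map ((`) \<sigma>) T) \<in> tabloids \<mu>"
        using tabloids_permute[OF permutes_inv[OF \<sigma>]] by blast
      then show False using False by (simp add: image_image comp_def permutes_inverses[OF \<sigma>])
    qed
    then show ?thesis
      by (intro representable_zero) (simp add: average_def coef_specht_outside)
  next
    case True
    note T = True
    obtain R L where RL: "T = R # L" using tabloidsD(1)[OF T] by (cases T) simp_all
    note D = T[unfolded RL]
    have len: "length L = length \<nu>" using tabloidsD(1)[OF D] by simp
    have disjR: "R \<inter> A = {}" if A: "A \<in> set L" for A
    proof -
      obtain j where "j < length L" "A = L ! j" using A by (auto simp: in_set_conv_nth)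
      then show ?thesis using tabloidsD(3)[OF D, of 0 "Suc j"] len by simp
    qed
    have un: "R \<union> \<Union>(set L) = {..<n}" using tabloidsD(4)[OF D] sum_list_mu by simp
    have cR: "card R = m" using tabloidsD(2)[OF D, of 0] by simp
    show ?thesis
    proof (cases "\<Union>(set L) \<subseteq> W")
      case inside: True
      \<comment> \<open>All letters that can move lie in the first row, so the averaging group fixes
        \<open>T\<close> and the average is a multiple of a single coefficient.\<close>
      have fixT: "map ((`) \<sigma>) T = T" if \<sigma>: "\<sigma> permutes {..<n} - W" for \<sigma>
      proof -
        have A: "\<sigma> ` A = A" if "A \<subseteq> W" for A
        proof -
          have "\<sigma> ` A = id ` A" using permutes_outside(2)[OF \<sigma>] that by (intro image_cong) auto
          then show ?thesis by simp
        qed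
        have "R = {..<n} - \<Union>(set L)" using un disjR by blast
        then have "\<sigma> ` R = \<sigma> ` {..<n} - \<sigma> ` \<Union>(set L)"
          by (simp only: image_set_diff[OF permutes_inj[OF \<sigma>]])
        also have "\<dots> = R"
          unfolding A[OF inside] permutes_image[OF permutes_outside(1)[OF \<sigma>]] using un disjR by blast
        finally have "\<sigma> ` R = R" .
        moreover have "map ((`) \<sigma>) L = L" using inside by (intro map_idI A) blast
        ultimately show ?thesis by (simp add: RL)
      qed
      have "representable W (\<lambda>u :: _ \<Rightarrow>\<^sub>0 'k. of_nat (card {\<sigma>. \<sigma> permutes {..<n} - W}) * coef u T)"
        unfolding RL by (intro representable_scale representable_coef W inside D)
      then show ?thesis by (rule representable_cong) (simp add: average_def fixT)
    next
      case False
      \<comment> \<open>An entry \<open>b\<close> outside \<open>W\<close> in a lower row, together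
        with the first row, forms the \<open>m + 1\<close> letters of a Garnir relation. Its term
        for \<open>a = b\<close> is \<open>T\<close> itself.\<close>
      then obtain b j where j: "j < length L" "b \<in> L ! j" "b \<notin> W" by (auto simp: in_set_conv_nth subset_iff)
      define L' where "L' = L[j := L ! j - {b}]"
      define X where "X = insert b R"
      define T' where "T' a = (X - {a}) # L'[j := insert a (L' ! j)]" for a
      have bR: "b \<notin> R" using disjR[of "L ! j"] j by auto
      have finR: "finite R" using un finite_Un[of R "\<Union>(set L)"] by (metis finite_lessThan)
      have bn: "b < n" using un j nth_mem[OF j(1)] by blast
      have Xn: "X \<subseteq> {..<m + sum_list \<nu>}" using un bn n by (auto simp: X_def)
      have cX: "card X = Suc m" using bR finR cR by (simp add: X_def)
      have jL': "j < length L'" using j by (simp add: L'_def)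
      have nb: "b \<notin> L ! k" if "k < length L" "k \<noteq> j" for k
        using tabloidsD(3)[OF D, of "Suc k" "Suc j"] that j len by auto
      have L'k: "L' ! k = L ! k - {b}" if "k < length L" for k
        using that nb[OF that] j by (cases "k = j") (auto simp: L'_def)
      have XL': "X \<inter> A = {}" if A: "A \<in> set L'" for A
      proof -
        obtain k where "k < length L'" "A = L' ! k" using A by (auto simp: in_set_conv_nth)
        then have "k < length L" "A = L ! k - {b}" using L'k by (simp_all add: L'_def)
        then show ?thesis using disjR[of "L ! k"] by (auto simp: X_def)
      qed
      have T'b: "T' b = T"
      proof -
        have "X - {b} = R" using bR by (auto simp: X_def)
        moreover have "L'[j := insert b (L' ! j)] = L"
          using j by (simp add: L'_def insert_absorb)
        ultimately show ?thesis by (simp add: T'_def RL)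
      qed
      \<comment> \<open>For \<open>a\<close> outside \<open>W\<close> the transposition of
        \<open>a\<close> and \<open>b\<close> belongs to the averaging group, so these terms all
        agree with the one for \<open>T\<close>.\<close>
      have same: "average W (T' a) u = average W T u" if a: "a \<in> X - W" for a and u :: "_ \<Rightarrow>\<^sub>0 'k"
      proof -
        have bX: "b \<in> X" by (simp add: X_def)
        have "map ((`) (transpose a b)) (T' b) = T' a"
          using map_transpose_update[of a X b L' j b] a bX XL' jL' by (simp add: T'_def)
        moreover have "transpose a b permutes {..<n} - W"
          using a j(3) bn Xn n by (intro permutes_swap_id) auto
        ultimately show ?thesis using average_permute[of "transpose a b" W "T' b" u] T'b by simp
      qed
      have sum0: "(\<Sum>a\<in>X. average W (T' a) u) = 0" if u: "u \<in> specht \<mu>" for u :: "_ \<Rightarrow>\<^sub>0 'k"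
      proof -
        have "(\<Sum>a\<in>X. coef u (map ((`) \<sigma>) (T' a))) = 0" if \<sigma>: "\<sigma> permutes {..<n} - W" for \<sigma>
        proof -
          have \<sigma>n: "\<sigma> permutes {..<n}" by (rule permutes_outside(1)[OF \<sigma>])
          have "invf \<sigma> permutes {..<sum_list \<mu>}" using permutes_inv[OF \<sigma>n] sum_list_mu by simp
          from coef_sum_updates_eq_0[OF specht_perm_specht[OF this u] rows_le Xn cX XL' jL']
          show ?thesis
            by (simp add: T'_def coef_specht_perm[OF permutes_bij[OF permutes_inv[OF \<sigma>n]]] permutes_inv_inv[OF \<sigma>n])
        qed
        then show ?thesis unfolding average_def by (subst sum.swap) simp
      qed
      \<comment> \<open>For \<open>a\<close> in \<open>W\<close> the lower rows lose the outside
        entry \<open>b\<close> and gain only an entry of \<open>W\<close>.\<close>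
      have IH: "representable W (average W (T' a) :: (_ \<Rightarrow>\<^sub>0 'k) \<Rightarrow> 'k)" if a: "a \<in> X \<inter> W" for a
      proof (rule less.hyps)
        have sub: "\<Union>(set (tl (T' a))) - W \<subseteq> (\<Union>(set (tl T)) - W) - {b}"
        proof
          fix x assume x: "x \<in> \<Union>(set (tl (T' a))) - W"
          then obtain k where k: "k < length L" "x \<in> L'[j := insert a (L' ! j)] ! k"
            by (auto simp: T'_def in_set_conv_nth L'_def)
          then have "x \<in> insert a (L' ! k)" using j by (cases "k = j") (auto simp: L'_def)
          then have "x \<in> L' ! k" using x a by auto
          then have "x \<in> L ! k" "x \<noteq> b" using L'k[OF k(1)] by auto
          then show "x \<in> (\<Union>(set (tl T)) - W) - {b}" using x k(1) by (auto simp: RL)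
        qed
        have "finite (\<Union>(set (tl T)))" using un by (simp add: RL) (metis finite_Un finite_lessThan)
        then have fin: "finite (\<Union>(set (tl T)) - W)" by simp
        have "b \<in> \<Union>(set (tl T)) - W" using j by (auto simp: RL)
        then have "\<Union>(set (tl (T' a))) - W \<subset> \<Union>(set (tl T)) - W" using sub by blast
        then show "card (\<Union>(set (tl (T' a))) - W) < card (\<Union>(set (tl T)) - W)"
          by (rule psubset_card_mono[OF fin])
      qed
      have bX: "b \<in> X - W" using j by (simp add: X_def)
      have finX: "finite X" using finR by (simp add: X_def)
      have c0: "card (X - W) \<noteq> 0" using bX finX by (metis card_eq_0_iff empty_iff finite_Diff)
      \<comment> \<open>The relation is solved for the average at \<open>T\<close>. Its multiplicity
        \<open>card (X - W)\<close> is positive because of \<open>b\<close>, hence invertible in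
        characteristic zero.\<close>
      have eq: "average W T u = - 1 / of_nat (card (X - W)) * (\<Sum>a\<in>X \<inter> W. average W (T' a) u)"
        if u: "u \<in> specht \<mu>" for u :: "_ \<Rightarrow>\<^sub>0 'k"
      proof -
        have "0 = (\<Sum>a\<in>X - W. average W (T' a) u) + (\<Sum>a\<in>X \<inter> W. average W (T' a) u)"
          using sum0[OF u] sum.Int_Diff[OF finX, of "\<lambda>a. average W (T' a) u" W] by (simp add: add.commute)
        also have "(\<Sum>a\<in>X - W. average W (T' a) u) = of_nat (card (X - W)) * average W T u"
          by (simp add: same)
        finally show ?thesis using c0 by (simp add: field_simps eq_neg_iff_add_eq_0)
      qed
      have rep: "representable W (\<lambda>u :: _ \<Rightarrow>\<^sub>0 'k. - 1 / of_nat (card (X - W)) * (\<Sum>a\<in>X \<inter> W. average W (T' a) u))"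
        by (intro representable_scale representable_sum IH)
      show ?thesis by (rule representable_cong[OF rep eq])
    qed
  qed
qed

lemma hom_spaceD:
  assumes "f \<in> hom_space n \<mu> r"
  shows "u \<in> specht \<mu> \<Longrightarrow> f u \<in> free_on (words n r)"
    "u \<in> specht \<mu> \<Longrightarrow> v \<in> specht \<mu> \<Longrightarrow> f (u + v) = f u + f v"
    "u \<in> specht \<mu> \<Longrightarrow> f (fscale c u) = fscale c (f u)"
    "\<sigma> permutes {..<n} \<Longrightarrow> u \<in> specht \<mu> \<Longrightarrow> f (specht_perm \<sigma> u) = tensor_perm \<sigma> (f u)"
    "u \<notin> specht \<mu> \<Longrightarrow> f u = undefined"
proof -
  have f: "f \<in> specht \<mu> \<rightarrow>\<^sub>E free_on (words n r)" using assms by (simp add: hom_space_def)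
  show "u \<in> specht \<mu> \<Longrightarrow> f u \<in> free_on (words n r)" by (rule PiE_mem[OF f])
  show "u \<notin> specht \<mu> \<Longrightarrow> f u = undefined" by (rule PiE_arb[OF f])
qed (use assms in \<open>simp_all add: hom_space_def\<close>)

lemma coef_hom_permute:
  assumes f: "f \<in> hom_space n \<mu> r" and \<sigma>: "\<sigma> permutes {..<n}" and u: "u \<in> specht \<mu>"
  shows "coef (f (specht_perm (invf \<sigma>) u)) w = coef (f u) (map \<sigma> w)"
  by (simp add: hom_spaceD(4)[OF f permutes_inv[OF \<sigma>] u] coef_tensor_perm permutes_bij[OF permutes_inv[OF \<sigma>]]
      permutes_inv_inv[OF \<sigma>])

lemma representable_hom:
  fixes f :: "(nat set list \<Rightarrow>\<^sub>0 'k::field_char_0) \<Rightarrow> (nat list \<Rightarrow>\<^sub>0 'k)"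
  assumes f: "f \<in> hom_space n \<mu> r" and w: "w \<in> words n r"
  shows "representable (set w) (\<lambda>u. coef (f u) w)"
proof -
  let ?W = "set w" and ?G = "{\<sigma>. \<sigma> permutes {..<n} - set w}"
  have W: "?W \<subseteq> {..<n}" using w by (simp add: words_def)
  have "functional_on (specht \<mu>) (\<lambda>u. coef (f u) w)"
    by (simp add: functional_on_def hom_spaceD[OF f] lookup_add lookup_fscale)
  then obtain a where a: "\<forall>u\<in>specht \<mu>. coef (f u) w = (\<Sum>T\<in>tabloids \<mu>. a T * coef u T)"
    using specht_functional by blast
  have fin: "finite ?G" by (rule finite_permutations) simp
  have "id \<in> ?G" by (simp add: permutes_id)
  then have c0: "card ?G \<noteq> 0" using fin by (metis card_eq_0_iff empty_iff)
  have eq: "coef (f u) w = 1 / of_nat (card ?G) * (\<Sum>T\<in>tabloids \<mu>. a T * average ?W T u)"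
    if u: "u \<in> specht \<mu>" for u
  proof -
    \<comment> \<open>Since \<open>\<sigma>\<close> fixes \<open>w\<close>, equivariance leaves the
      coefficient unchanged when \<open>u\<close> is moved by the inverse of
      \<open>\<sigma>\<close>.\<close>
    have "coef (f u) w = (\<Sum>T\<in>tabloids \<mu>. a T * coef u (map ((`) \<sigma>) T))" if \<sigma>: "\<sigma> \<in> ?G" for \<sigma>
    proof -
      have \<sigma>n: "\<sigma> permutes {..<n}" using \<sigma> permutes_outside(1) by blast
      have "map \<sigma> w = w" using \<sigma> permutes_outside(2) by (intro map_idI) blast
      then have "coef (f u) w = coef (f (specht_perm (invf \<sigma>) u)) w"
        using coef_hom_permute[OF f \<sigma>n u, of w] by simp
      also have "\<dots> = (\<Sum>T\<in>tabloids \<mu>. a T * coef (specht_perm (invf \<sigma>) u) T)"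
        using a specht_perm_specht[of "invf \<sigma>" \<mu> u] permutes_inv[OF \<sigma>n] sum_list_mu u by simp
      finally show ?thesis
        by (simp add: coef_specht_perm[OF permutes_bij[OF permutes_inv[OF \<sigma>n]]] permutes_inv_inv[OF \<sigma>n])
    qed
    then have "of_nat (card ?G) * coef (f u) w = (\<Sum>\<sigma>\<in>?G. \<Sum>T\<in>tabloids \<mu>. a T * coef u (map ((`) \<sigma>) T))"
      by (subst sum_constant[symmetric]) (intro sum.cong refl)
    also have "\<dots> = (\<Sum>T\<in>tabloids \<mu>. a T * average ?W T u)"
      by (subst sum.swap) (simp add: average_def sum_distrib_left)
    finally show ?thesis using c0 by (simp add: field_simps)
  qed
  have rep: "representable ?W (\<lambda>u. 1 / of_nat (card ?G) * (\<Sum>T\<in>tabloids \<mu>. a T * average ?W T u))"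
    by (intro representable_scale representable_sum representable_average W)
  show ?thesis by (rule representable_cong[OF rep eq])
qed

end

context long_first_row
begin

text \<open>A word compatible with the diagram is an image \<open>map g w0\<close>. If it has at
  least as many letters as \<open>w0\<close>, then \<open>g\<close> is injective on these letters
  and extends to a permutation, so the word lies in the orbit of \<open>w0\<close>. This is the
  triangularity behind the induction on the number of letters.\<close>

lemma coef_ev_kernel_diagram:
  assumes v0: "v0 \<in> words n p" "set v0 \<subseteq> set w0" and w0: "w0 \<in> words n r" and w: "w \<in> words n r"
  shows "\<tau> permutes {..<n} \<Longrightarrow> w = map \<tau> w0 \<Longrightarrow>
      coef (ev n r (basis (kernel_diagram v0 w0)) (phi s u)) w = dual s u (map \<tau> v0)"
    and "card (set w0) \<le> card (set w) \<Longrightarrow> (\<And>\<tau>. \<tau> permutes {..<n} \<Longrightarrow> w \<noteq> map \<tau> w0) \<Longrightarrow>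
      coef (ev n r (basis (kernel_diagram v0 w0)) (phi s u)) w = 0"
proof -
  have comp: "compatible (kernel_diagram v0 w0) v w \<longleftrightarrow> (\<exists>g. v = map g v0 \<and> w = map g w0)"
    if "v \<in> words n p" for v
    using words_length[OF that] words_length[OF v0(1)] words_length[OF w0] words_length[OF w]
    by (intro compatible_kernel_diagram) simp_all
  have c: "coef (ev n r (basis (kernel_diagram v0 w0)) (phi s u)) w =
    (\<Sum>v\<in>words n p. if \<exists>g. v = map g v0 \<and> w = map g w0 then dual s u v else 0)"
    using w by (auto simp: coef_ev[OF phi_in_free_on] coef_phi comp intro!: sum.cong)
  {
    assume \<tau>: "\<tau> permutes {..<n}" "w = map \<tau> w0"
    have "(\<exists>g. v = map g v0 \<and> w = map g w0) \<longleftrightarrow> v = map \<tau> v0" for v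
    proof
      assume "\<exists>g. v = map g v0 \<and> w = map g w0"
      then obtain g where g: "v = map g v0" "w = map g w0" by blast
      then have "map g w0 = map \<tau> w0" using \<tau>(2) by simp
      then have "\<forall>c\<in>set w0. g c = \<tau> c" by simp
      then show "v = map \<tau> v0" using v0(2) g(1) by auto
    qed (use \<tau>(2) in blast)
    moreover have "map \<tau> v0 \<in> words n p" using v0(1) words_map[OF \<tau>(1)] by simp
    ultimately show "coef (ev n r (basis (kernel_diagram v0 w0)) (phi s u)) w = dual s u (map \<tau> v0)"
      unfolding c by (simp add: sum.delta)
  }
  assume card: "card (set w0) \<le> card (set w)" and no: "\<And>\<tau>. \<tau> permutes {..<n} \<Longrightarrow> w \<noteq> map \<tau> w0"
  have "w \<noteq> map g w0" for g
  proof
    assume g: "w = map g w0"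
    then have "g ` set w0 = set w" by simp
    then have "inj_on g (set w0)" using card card_image_le[of "set w0" g] by (intro eq_card_imp_inj_on) simp_all
    moreover have "set w0 \<subseteq> {..<n}" "g ` set w0 \<subseteq> {..<n}" using w0 w \<open>g ` set w0 = set w\<close> by (simp_all add: words_def)
    ultimately obtain \<tau> where \<tau>: "\<tau> permutes {..<n}" "\<And>x. x \<in> set w0 \<Longrightarrow> \<tau> x = g x"
      using extend_to_permutation[of "{..<n}" "set w0" g] by blast
    then have "w = map \<tau> w0" using g by simp
    then show False using no[OF \<tau>(1)] by simp
  qed
  then show "coef (ev n r (basis (kernel_diagram v0 w0)) (phi s u)) w = 0" unfolding c by simp
qed

lemma hom_space_diff:
  assumes f: "f \<in> hom_space n \<mu> r" and z: "z \<in> pre_inflation r"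
  shows "(\<lambda>u\<in>specht \<mu>. f u - Psi r z u) \<in> hom_space n \<mu> r"
proof -
  have sp: "specht_perm \<sigma> u \<in> specht \<mu>" if "\<sigma> permutes {..<n}" "u \<in> specht \<mu>" for \<sigma> and u :: "_ \<Rightarrow>\<^sub>0 'a"
    using specht_perm_specht[of \<sigma> \<mu> u] that sum_list_mu by simp
  have td: "tensor_perm \<sigma> (a - b) = tensor_perm \<sigma> a - tensor_perm \<sigma> b" for \<sigma> and a b :: "_ \<Rightarrow>\<^sub>0 'a"
    by (simp add: tensor_perm_def lin_ext_diff)
  note D = hom_spaceD[OF f]
  have "(\<lambda>u\<in>specht \<mu>. f u - Psi r z u) \<in> specht \<mu> \<rightarrow>\<^sub>E free_on (words n r)"
    by (intro PiE_I) (simp_all add: free_on_diff D(1) Psi_in_free_on)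
  then show ?thesis
    unfolding hom_space_def
    by (simp add: specht_add specht_scale sp D(2-4) Psi_linear_right Psi_specht_perm[OF z] td
        fvs.scale_right_diff_distrib)
qed

definition same_orbit :: "nat \<Rightarrow> nat list \<Rightarrow> nat list set" where
  "same_orbit r w = {w' \<in> words n r. \<exists>\<tau>. \<tau> permutes {..<n} \<and> w = map \<tau> w'}"

lemma same_orbit:
  assumes "w \<in> words n r"
  shows "w \<in> same_orbit r w" "finite (same_orbit r w)"
    "w' \<in> same_orbit r w \<Longrightarrow> same_orbit r w' = same_orbit r w"
    "w' \<in> same_orbit r w \<Longrightarrow> card (set w') = card (set w)"
proof -
  show "w \<in> same_orbit r w" unfolding same_orbit_def using assms permutes_id by (auto intro!: exI[of _ id])
  show "finite (same_orbit r w)" by (simp add: same_orbit_def)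
  assume "w' \<in> same_orbit r w"
  then obtain \<tau> where \<tau>: "\<tau> permutes {..<n}" "w = map \<tau> w'" by (auto simp: same_orbit_def)
  have w': "w' = map (invf \<tau>) w" using \<tau> by (simp add: comp_def permutes_inverses[OF \<tau>(1)])
  have "same_orbit r w' \<subseteq> same_orbit r w"
  proof
    fix x assume "x \<in> same_orbit r w'"
    then obtain \<rho> where \<rho>: "x \<in> words n r" "\<rho> permutes {..<n}" "w' = map \<rho> x" by (auto simp: same_orbit_def)
    have "w = map (\<tau> \<circ> \<rho>) x" using \<tau>(2) \<rho>(3) by simp
    then show "x \<in> same_orbit r w" using \<rho>(1) permutes_compose[OF \<rho>(2) \<tau>(1)] unfolding same_orbit_def by blast
  qed
  moreover have "same_orbit r w \<subseteq> same_orbit r w'"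
  proof
    fix x assume "x \<in> same_orbit r w"
    then obtain \<rho> where \<rho>: "x \<in> words n r" "\<rho> permutes {..<n}" "w = map \<rho> x" by (auto simp: same_orbit_def)
    have "w' = map (invf \<tau> \<circ> \<rho>) x" using w' \<rho>(3) by simp
    then show "x \<in> same_orbit r w'"
      using \<rho>(1) permutes_compose[OF \<rho>(2) permutes_inv[OF \<tau>(1)]] unfolding same_orbit_def by blast
  qed
  ultimately show "same_orbit r w' = same_orbit r w" by blast
  show "card (set w') = card (set w)"
    unfolding \<tau>(2) set_map using permutes_inj[OF \<tau>(1)] by (simp add: card_image inj_on_subset)
qed

text \<open>Words are treated in decreasing order of their number of letters: subtracting suitable images
  of kernel diagrams of words with \<open>k\<close> letters only affects words with at most \<open>k\<close> letters.\<close>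

lemma Psi_surjective_level:
  fixes f :: "(nat set list \<Rightarrow>\<^sub>0 'k::field_char_0) \<Rightarrow> (nat list \<Rightarrow>\<^sub>0 'k)"
  assumes "f \<in> hom_space n \<mu> r"
    "\<And>u w. u \<in> specht \<mu> \<Longrightarrow> w \<in> words n r \<Longrightarrow> k \<le> card (set w) \<Longrightarrow> coef (f u) w = 0"
  shows "\<exists>z\<in>pre_inflation r. \<forall>u\<in>specht \<mu>. Psi r z u = f u"
  using assms
proof (induction k arbitrary: f)
  case 0
  have "f u = 0" if u: "u \<in> specht \<mu>" for u
  proof (rule poly_mapping_eqI)
    fix w
    show "coef (f u) w = coef 0 w"
      using 0(2)[OF u, of w] free_on_coef[OF hom_spaceD(1)[OF 0(1) u], of w] by (cases "w \<in> words n r") simp_all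
  qed
  then show ?case by (intro bexI[of _ 0]) (simp_all add: Psi_linear)
next
  case (Suc k)
  note f = Suc.prems(1)
  let ?Ps = "\<lambda>w. {P. P \<subseteq> set w \<and> card P = p}"
  have "\<forall>w\<in>words n r. \<exists>S. (\<forall>P. S P \<in> specht \<nu>) \<and> (\<forall>u\<in>specht \<mu>. coef (f u) w =
      (\<Sum>P\<in>?Ps w. dual (S P) u (sorted_list_of_set P)))"
    using representable_hom[OF f] unfolding representable_def by blast
  from bchoice[OF this] obtain S where S: "\<And>w P. w \<in> words n r \<Longrightarrow> S w P \<in> specht \<nu>"
    "\<And>w u. w \<in> words n r \<Longrightarrow> u \<in> specht \<mu> \<Longrightarrow>
      coef (f u) w = (\<Sum>P\<in>?Ps w. dual (S w P) u (sorted_list_of_set P))" by blast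
  define K where "K = {w \<in> words n r. card (set w) = k}"
  \<comment> \<open>The vectors \<open>S w\<close> are chosen independently for the words of an
    orbit, and each word of the orbit alone reproduces the coefficients on the whole orbit; this
    factor compensates for its size.\<close>
  define c where "c w = (1 / of_nat (card (same_orbit r w)) :: 'k)" for w
  define z where "z = (\<Sum>w\<in>K. \<Sum>P\<in>?Ps w.
    fscale (c w) (basis (S w P, basis (kernel_diagram (sorted_list_of_set P) w) :: _ \<Rightarrow>\<^sub>0 'k)))"
  have P: "sorted_list_of_set P \<in> words n p" "set (sorted_list_of_set P) \<subseteq> set w"
    "kernel_diagram (sorted_list_of_set P) w \<in> prop_diagrams p r p"
    if "P \<in> ?Ps w" "w \<in> words n r" for P w
  proof -
    have fin: "finite P" using that(1) finite_subset[of P "set w"] by simp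
    show "set (sorted_list_of_set P) \<subseteq> set w" using that(1) fin by simp
    moreover have "length (sorted_list_of_set P) = p" using that(1) fin by simp
    ultimately show "sorted_list_of_set P \<in> words n p"
      using that(2) by (auto simp: words_def)
    show "kernel_diagram (sorted_list_of_set P) w \<in> prop_diagrams p r p"
      using kernel_diagram_in_diagrams[of "sorted_list_of_set P" w] words_length[OF that(2)]
        prop_number_kernel_diagram[of "sorted_list_of_set P" w] that(1) fin
      by (simp add: prop_diagrams_def)
  qed
  have z: "z \<in> pre_inflation r"
    unfolding z_def
  proof (intro free_on_sum free_on_fscale)
    fix w P assume "w \<in> K" "P \<in> ?Ps w"
    then show "basis (S w P, basis (kernel_diagram (sorted_list_of_set P) w)) \<in> pre_inflation r"
      using P(3)[of P w] S(1)[of w P] by (simp add: K_def)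
  qed
  have Pz: "coef (Psi r z u) w = coef (f u) w"
    if u: "u \<in> specht \<mu>" and w: "w \<in> words n r" and k: "k \<le> card (set w)" for u w
  proof -
    \<comment> \<open>A word \<open>w0\<close> of \<open>K\<close> contributes nothing to words of
      at least \<open>k\<close> letters outside its orbit; within the orbit, equivariance carries
      the coefficient at \<open>w0\<close> to the one at \<open>w\<close>.\<close>
    have inner: "(\<Sum>P\<in>?Ps w0. coef (ev n r (basis (kernel_diagram (sorted_list_of_set P) w0)) (phi (S w0 P) u)) w) =
      (if w0 \<in> same_orbit r w then coef (f u) w else 0)" if w0: "w0 \<in> K" for w0
    proof -
      have w0W: "w0 \<in> words n r" and cw0: "card (set w0) \<le> card (set w)" using w0 k by (simp_all add: K_def)
      show ?thesis
      proof (cases "w0 \<in> same_orbit r w")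
        case True
        then obtain \<tau> where \<tau>: "\<tau> permutes {..<n}" "w = map \<tau> w0" by (auto simp: same_orbit_def)
        have "(\<Sum>P\<in>?Ps w0. coef (ev n r (basis (kernel_diagram (sorted_list_of_set P) w0)) (phi (S w0 P) u)) w) =
          (\<Sum>P\<in>?Ps w0. dual (S w0 P) (specht_perm (invf \<tau>) u) (sorted_list_of_set P))"
        proof (rule sum.cong[OF refl])
          fix P assume "P \<in> ?Ps w0"
          note P = P(1,2)[OF this w0W]
          show "coef (ev n r (basis (kernel_diagram (sorted_list_of_set P) w0)) (phi (S w0 P) u)) w =
            dual (S w0 P) (specht_perm (invf \<tau>) u) (sorted_list_of_set P)"
            using coef_ev_kernel_diagram(1)[OF P w0W w \<tau>, of "S w0 P" u]
              dual_specht_perm[OF permutes_inv[OF \<tau>(1)] words_length[OF P(1)], of "S w0 P" u]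
            by (simp add: permutes_inv_inv[OF \<tau>(1)])
        qed
        also have "\<dots> = coef (f (specht_perm (invf \<tau>) u)) w0"
          using S(2)[OF w0W] specht_perm_specht[of "invf \<tau>" \<mu> u] permutes_inv[OF \<tau>(1)] sum_list_mu u by simp
        also have "\<dots> = coef (f u) w" unfolding \<tau>(2) by (rule coef_hom_permute[OF f \<tau>(1) u])
        finally show ?thesis using True by simp
      next
        case False
        then have "w \<noteq> map \<tau> w0" if "\<tau> permutes {..<n}" for \<tau>
          using that w0W by (auto simp: same_orbit_def)
        from coef_ev_kernel_diagram(2)[OF P(1,2) w0W w cw0 this]
        have "coef (ev n r (basis (kernel_diagram (sorted_list_of_set P) w0)) (phi (S w0 P) u)) w = 0"
          if "P \<in> ?Ps w0" for P using that w0W by blast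
        then show ?thesis using False by simp
      qed
    qed
    have "coef (Psi r z u) w = (\<Sum>w0\<in>K. c w0 * (\<Sum>P\<in>?Ps w0.
      coef (ev n r (basis (kernel_diagram (sorted_list_of_set P) w0)) (phi (S w0 P) u)) w))"
      by (simp add: z_def Psi_linear Psi_basis lookup_sum lookup_fscale sum_distrib_left)
    also have "\<dots> = (\<Sum>w0\<in>K. c w0 * (if w0 \<in> same_orbit r w then coef (f u) w else 0))"
      using inner by (intro sum.cong) simp_all
    also have "\<dots> = (\<Sum>w0\<in>K \<inter> same_orbit r w. c w0 * coef (f u) w)"
      unfolding K_def by (subst sum.inter_restrict) (auto intro!: sum.cong)
    also have "\<dots> = coef (f u) w"
    proof (cases "card (set w) = k")
      case True
      have "K \<inter> same_orbit r w = same_orbit r w"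
        using True same_orbit(4)[OF w] by (auto simp: K_def same_orbit_def)
      moreover have "c w0 = 1 / of_nat (card (same_orbit r w))" if "w0 \<in> same_orbit r w" for w0
        using same_orbit(3)[OF w that] by (simp add: c_def)
      moreover have "card (same_orbit r w) \<noteq> 0"
        using same_orbit(1,2)[OF w] by (metis card_eq_0_iff empty_iff)
      ultimately show ?thesis by simp
    next
      case False
      \<comment> \<open>For words with more than \<open>k\<close> letters the coefficient of
        \<open>f\<close> is already zero and must not be disturbed.\<close>
      then have "K \<inter> same_orbit r w = {}" using same_orbit(4)[OF w] by (auto simp: K_def)
      then show ?thesis using Suc.prems(2)[OF u w] False k by simp
    qed
    finally show ?thesis .
  qed
  have "\<exists>z'\<in>pre_inflation r. \<forall>u\<in>specht \<mu>. Psi r z' u = (\<lambda>u\<in>specht \<mu>. f u - Psi r z u) u"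
    by (rule Suc.IH[OF hom_space_diff[OF f z]]) (simp add: lookup_minus Pz)
  then obtain z' where z': "z' \<in> pre_inflation r" "\<And>u. u \<in> specht \<mu> \<Longrightarrow> Psi r z' u = f u - Psi r z u"
    by auto
  then show ?case using z by (intro bexI[of _ "z' + z"]) (simp_all add: Psi_linear free_on_add)
qed

lemma Psi_surjective:
  fixes f :: "(nat set list \<Rightarrow>\<^sub>0 'k::field_char_0) \<Rightarrow> (nat list \<Rightarrow>\<^sub>0 'k)"
  assumes "f \<in> hom_space n \<mu> r"
  shows "\<exists>z\<in>pre_inflation r. \<forall>u\<in>specht \<mu>. Psi r z u = f u"
proof (rule Psi_surjective_level[OF assms, of "Suc r"])
  fix u :: "nat set list \<Rightarrow>\<^sub>0 'k" and w assume "w \<in> words n r" "Suc r \<le> card (set w)"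
  \<comment> \<open>A word of length \<open>r\<close> has at most \<open>r\<close> letters, so the
    vanishing condition at \<open>Suc r\<close> is vacuous.\<close>
  then show "coef (f u) w = 0" using card_length[of w] by (simp add: words_length)
qed

section \<open>The isomorphism\<close>

text \<open>The inverse of the map induced by \<open>Psi\<close>: elements of the inflation are
  classes of formal sums, and the class belonging to \<open>f\<close> is the set of all formal sums
  mapping to \<open>f\<close>.\<close>

definition fibre :: "nat \<Rightarrow> ((nat set list \<Rightarrow>\<^sub>0 'k::field) \<Rightarrow> (nat list \<Rightarrow>\<^sub>0 'k)) \<Rightarrow>
    ((nat set list \<Rightarrow>\<^sub>0 'k) \<times> (diagram \<Rightarrow>\<^sub>0 'k) \<Rightarrow>\<^sub>0 'k) set" where
  "fibre r f = {z \<in> pre_inflation r. \<forall>u\<in>specht \<mu>. Psi r z u = f u}"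

text \<open>The two halves are \<open>Psi_relators\<close>, which makes \<open>Psi\<close> well
  defined on classes, and \<open>Psi_injective\<close>.\<close>

lemma inflation_rel_iff:
  fixes y z :: "(nat set list \<Rightarrow>\<^sub>0 'k::field_char_0) \<times> (diagram \<Rightarrow>\<^sub>0 'k) \<Rightarrow>\<^sub>0 'k"
  assumes r: "2 * r \<le> n"
  shows "(y, z) \<in> inflation_rel (of_nat n) \<nu> r \<longleftrightarrow>
    y \<in> pre_inflation r \<and> z \<in> pre_inflation r \<and> (\<forall>u\<in>specht \<mu>. Psi r y u = Psi r z u)"
proof -
  have "y - z \<in> fvs.span (relators r) \<longleftrightarrow> (\<forall>u\<in>specht \<mu>. Psi r y u = Psi r z u)"
    if "y \<in> pre_inflation r" "z \<in> pre_inflation r"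
  proof
    assume "y - z \<in> fvs.span (relators r)"
    from Psi_relators[OF this] show "\<forall>u\<in>specht \<mu>. Psi r y u = Psi r z u" by (simp add: Psi_linear)
  next
    assume "\<forall>u\<in>specht \<mu>. Psi r y u = Psi r z u"
    then show "y - z \<in> fvs.span (relators r)"
      by (intro Psi_injective free_on_diff that r) (simp add: Psi_linear)
  qed
  then show ?thesis by (auto simp: inflation_rel_def tensor_rel_def Let_def)
qed

lemma class_eq_fibre:
  fixes z :: "(nat set list \<Rightarrow>\<^sub>0 'k::field_char_0) \<times> (diagram \<Rightarrow>\<^sub>0 'k) \<Rightarrow>\<^sub>0 'k"
  assumes r: "2 * r \<le> n" and z: "z \<in> pre_inflation r" and f: "\<And>u. u \<in> specht \<mu> \<Longrightarrow> Psi r z u = f u"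
  shows "inflation_rel (of_nat n) \<nu> r `` {z} = fibre r f"
  unfolding Image_def fibre_def using z by (auto simp: inflation_rel_iff[OF r] f)

text \<open>Surjectivity in the form needed below: the operations of the inflation are unions over
  representatives, and an empty fibre would make such a union empty.\<close>

lemma fibre_nonempty:
  fixes f :: "(nat set list \<Rightarrow>\<^sub>0 'k::field_char_0) \<Rightarrow> (nat list \<Rightarrow>\<^sub>0 'k)"
  shows "f \<in> hom_space n \<mu> r \<Longrightarrow> fibre r f \<noteq> {}"
  using Psi_surjective unfolding fibre_def by blast

lemma fibreD:
  assumes "z \<in> fibre r f"
  shows "z \<in> pre_inflation r" "u \<in> specht \<mu> \<Longrightarrow> Psi r z u = f u"
  using assms by (simp_all add: fibre_def)

text \<open>Every representative \<open>z\<close> of the fibre contributes the same class, so the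
  union over representatives in \<open>inflation_act\<close> is that class.\<close>

lemma fibre_act:
  fixes f :: "(nat set list \<Rightarrow>\<^sub>0 'k::field_char_0) \<Rightarrow> (nat list \<Rightarrow>\<^sub>0 'k)"
  assumes s: "2 * s \<le> n" and a: "a \<in> free_on (diagrams r s)" and f: "f \<in> hom_space n \<mu> r"
  shows "fibre s (hom_act n \<mu> s f a) = inflation_act (of_nat n) \<nu> s (fibre r f) a"
proof -
  have "inflation_rel (of_nat n) \<nu> s `` {act a z} = fibre s (hom_act n \<mu> s f a)" if z: "z \<in> fibre r f" for z
    by (rule class_eq_fibre[OF s act_in_pre_inflation[OF fibreD(1)[OF z] a]])
      (simp add: Psi_act[OF fibreD(1)[OF z] a] fibreD(2)[OF z] hom_act_def)
  then show ?thesis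
    using fibre_nonempty[OF f] unfolding inflation_act_def act_def[symmetric] by auto
qed

lemma fibre_iso:
  assumes r: "2 * r \<le> n"
  shows "rmodule_iso (partition_algebra (of_nat n) r) (hom_module n \<mu> r) (inflation (of_nat n) \<nu> r)
    (fibre r :: ((_ \<Rightarrow>\<^sub>0 'k::field_char_0) \<Rightarrow> (_ \<Rightarrow>\<^sub>0 'k)) \<Rightarrow> _)"
proof -
  let ?H = "hom_space n \<mu> r :: ((_ \<Rightarrow>\<^sub>0 'k) \<Rightarrow> (_ \<Rightarrow>\<^sub>0 'k)) set" and ?rel = "inflation_rel (of_nat n :: 'k) \<nu> r"
  note fib = class_eq_fibre[OF r]
  have "bij_betw (fibre r) ?H (pre_inflation r // ?rel)"
    unfolding bij_betw_def
  proof
    show "inj_on (fibre r) ?H"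
    proof (rule inj_onI)
      fix f g assume f: "f \<in> ?H" and g: "g \<in> ?H" and eq: "fibre r f = fibre r g"
      obtain z where "z \<in> fibre r f" using fibre_nonempty[OF f] by blast
      then have "f u = g u" if "u \<in> specht \<mu>" for u
        using fibreD(2)[of z r f u] fibreD(2)[of z r g u] eq that by simp
      moreover have "f u = g u" if "u \<notin> specht \<mu>" for u
        using hom_spaceD(5)[OF f that] hom_spaceD(5)[OF g that] by simp
      ultimately show "f = g" by blast
    qed
    show "fibre r ` ?H = pre_inflation r // ?rel"
    proof (intro equalityI subsetI)
      fix Z assume "Z \<in> fibre r ` ?H"
      then obtain f where f: "f \<in> ?H" "Z = fibre r f" by blast
      obtain z where z: "z \<in> fibre r f" using fibre_nonempty[OF f(1)] by blast
      have "?rel `` {z} = Z" unfolding f(2) by (rule fib[OF fibreD[OF z]])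
      then show "Z \<in> pre_inflation r // ?rel" using quotientI[OF fibreD(1)[OF z], of ?rel] by simp
    next
      fix Z assume "Z \<in> pre_inflation r // ?rel"
      then obtain z where z: "z \<in> pre_inflation r" "Z = ?rel `` {z}" by (rule quotientE)
      have "Z = fibre r (restrict (Psi r z) (specht \<mu>))" unfolding z(2) by (rule fib[OF z(1)]) simp
      then show "Z \<in> fibre r ` ?H" using Psi_in_hom_space[OF z(1)] by blast
    qed
  qed
  moreover have "fibre r (\<lambda>u\<in>specht \<mu>. f u + g u) = (\<Union>y\<in>fibre r f. \<Union>z\<in>fibre r g. ?rel `` {y + z})"
    if f: "f \<in> ?H" and g: "g \<in> ?H" for f g
  proof -
    have "?rel `` {y + z} = fibre r (\<lambda>u\<in>specht \<mu>. f u + g u)" if "y \<in> fibre r f" "z \<in> fibre r g" for y z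
      by (rule fib) (simp_all add: Psi_linear free_on_add fibreD[OF that(1)] fibreD[OF that(2)])
    then show ?thesis using fibre_nonempty[OF f] fibre_nonempty[OF g] by auto
  qed
  moreover have "fibre r (\<lambda>u\<in>specht \<mu>. fscale c (f u)) = (\<Union>z\<in>fibre r f. ?rel `` {fscale c z})"
    if f: "f \<in> ?H" for f c
  proof -
    have "?rel `` {fscale c z} = fibre r (\<lambda>u\<in>specht \<mu>. fscale c (f u))" if "z \<in> fibre r f" for z
      by (rule fib) (simp_all add: Psi_linear free_on_fscale fibreD[OF that])
    then show ?thesis using fibre_nonempty[OF f] by auto
  qed
  ultimately show ?thesis
    unfolding rmodule_iso_def hom_module_def inflation_def partition_algebra_def
    by (simp add: fibre_act[OF r])
qed

end

theorem theorem8p5p1: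
  fixes n :: nat and \<mu> :: "nat list"
  assumes "n \<ge> 1" and "partition_of n \<mu>"
  shows "\<exists>\<Phi> :: nat \<Rightarrow>
        ((nat set list \<Rightarrow>\<^sub>0 'k::field_char_0) \<Rightarrow> (nat list \<Rightarrow>\<^sub>0 'k)) \<Rightarrow>
        ((nat set list \<Rightarrow>\<^sub>0 'k) \<times> (diagram \<Rightarrow>\<^sub>0 'k) \<Rightarrow>\<^sub>0 'k) set.
      (\<forall>r. n \<ge> 2 * r \<longrightarrow>
         rmodule_iso (partition_algebra (of_nat n) r)
           (hom_module n \<mu> r) (inflation (of_nat n) (tl \<mu>) r) (\<Phi> r)) \<and>
      (\<forall>r s. n \<ge> 2 * r \<longrightarrow> n \<ge> 2 * s \<longrightarrow>
         (\<forall>a\<in>free_on (diagrams r s). \<forall>\<phi>\<in>hom_space n \<mu> r.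
            \<Phi> s (hom_act n \<mu> s \<phi> a) = inflation_act (of_nat n) (tl \<mu>) s (\<Phi> r \<phi>) a))"
proof -
  \<comment> \<open>The empty partition is excluded by \<open>n \<ge> 1\<close>, so there is a first
    part to remove.\<close>
  obtain m \<nu> where \<mu>: "\<mu> = m # \<nu>" using assms by (cases \<mu>) (auto simp: partition_of_def)
  interpret long_first_row n m \<nu>
    by unfold_locales (use assms(2) \<mu> in \<open>auto simp: partition_of_def\<close>)
  show ?thesis
    unfolding \<mu> list.sel by (intro exI[of _ fibre]) (simp add: fibre_iso fibre_act)
qed

end
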